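(* Consider the $\beta$-model with true parameter $\boldsymbol\beta=(\beta_1,\dots,\beta_n)^\top$ (depending on $n$), and let $b_n,c_n$ be as defined in the context (evaluated at the true parameter). Let $\widehat{\boldsymbol\beta}=\arg\max_{\boldsymbol\beta\in\mathbb R^n}\ell(\boldsymbol\beta)$ be the MLE and, for a null parameter set $\Theta_0$, let $\widehat{\boldsymbol\beta}^0=\arg\max_{\boldsymbol\beta\in\Theta_0}\ell(\boldsymbol\beta)$ be the restricted MLE. (a) Let $r=r_n\to\infty$ and let $\beta_1^0,\dots,\beta_r^0$ be known numbers. Under the null $H_0:\beta_i=\beta_i^0$, $i=1,\dots,r$ (i.e. the data are generated with a true $\boldsymbol\beta$ satisfying this), with $\Theta_0=\{\boldsymbol\beta\in\mathbb R^n:(\beta_1,\dots,\beta_r)=(\beta_1^0,\dots,\beta_r^0)\}$, if $b_n^5/c_n^2=o\big(r^{1/2}/(\log n)^2\big)$, then $$\frac{2\{\ell(\widehat{\boldsymbol\beta})-\ell(\widehat{\boldsymbol\beta}^0)\}-r}{\sqrt{2r}}\xrightarrow{L}N(0,1)\quad\text{as }n\to\infty.$$ (b) Let $r=r_n\to\infty$. Under the homogeneous null $H_0:\beta_1=\cdots=\beta_r$, with $\Theta_0=\{\boldsymbol\beta\in\mathbb R^n:\beta_1=\cdots=\beta_r\}$, if $b_n^{15}/c_n^9=o\big(r^{1/2}/(\log n)^3\big)$, then the same normalized statistic $[2\{\ell(\widehat{\boldsymbol\beta})-\ell(\widehat{\boldsymbol\beta}^0)\}-r]/\sqrt{2r}$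 converges in distribution to $N(0,1)$.
   Context: $\beta$-model: for $n$ nodes, the adjacency entries $a_{ij}=a_{ji}\in\{0,1\}$, $1\le i<j\le n$, are mutually independent with $P(a_{ij}=1)=e^{\beta_i+\beta_j}/(1+e^{\beta_i+\beta_j})$, and $a_{ii}=0$. The degree of node $i$ is $d_i=\sum_{j\ne i}a_{ij}$. The log-likelihood is $\ell(\boldsymbol\beta)=\sum_{i=1}^n\beta_id_i-\sum_{1\le i<j\le n}\log(1+e^{\beta_i+\beta_j})$. Define $b_n=\max_{i\neq j}(1+e^{\beta_i+\beta_j})^2/e^{\beta_i+\beta_j}$ and $c_n=\min_{i\ne j}(1+e^{\beta_i+\beta_j})^2/e^{\beta_i+\beta_j}$ at the true parameter. Asymptotics are as $n\to\infty$. *)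

theory Defs
  imports "HOL-Probability.Probability" "HOL-Library.Landau_Symbols"
begin

text \<open>beta-model on n nodes, indexed 0,...,n-1 (node i of the paper is node i-1 here).
  An observed graph is a function A on pairs (i,j) with i<j<n; A (i,j) = True iff a_ij = 1.
  The parameter vector is a function beta :: nat => real (only values below n matter).\<close>

definition node_pairs :: "nat \<Rightarrow> (nat \<times> nat) set" where
  "node_pairs n = {(i, j). i < j \<and> j < n}"

definition edge_prob :: "(nat \<Rightarrow> real) \<Rightarrow> nat \<Rightarrow> nat \<Rightarrow> real" where
  "edge_prob beta i j = exp (beta i + beta j) / (1 + exp (beta i + beta j))"

definition beta_model :: "nat \<Rightarrow> (nat \<Rightarrow> real) \<Rightarrow> (nat \<times> nat \<Rightarrow> bool) pmf" where
  "beta_model n beta =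
     Pi_pmf (node_pairs n) False (\<lambda>(i, j). bernoulli_pmf (edge_prob beta i j))"

definition adj :: "(nat \<times> nat \<Rightarrow> bool) \<Rightarrow> nat \<Rightarrow> nat \<Rightarrow> bool" where
  "adj A i j = (i \<noteq> j \<and> A (min i j, max i j))"

definition degree :: "nat \<Rightarrow> (nat \<times> nat \<Rightarrow> bool) \<Rightarrow> nat \<Rightarrow> nat" where
  "degree n A i = card {j. j < n \<and> adj A i j}"

definition loglik :: "nat \<Rightarrow> (nat \<times> nat \<Rightarrow> bool) \<Rightarrow> (nat \<Rightarrow> real) \<Rightarrow> real" where
  "loglik n A beta =
     (\<Sum>i<n. beta i * real (degree n A i))
     - (\<Sum>(i, j)\<in>node_pairs n. ln (1 + exp (beta i + beta j)))"

definition bn :: "nat \<Rightarrow> (nat \<Rightarrow> real) \<Rightarrow> real" where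
  "bn n beta = Max {(1 + exp (beta i + beta j))^2 / exp (beta i + beta j) | i j. i < n \<and> j < n \<and> i \<noteq> j}"

definition cn :: "nat \<Rightarrow> (nat \<Rightarrow> real) \<Rightarrow> real" where
  "cn n beta = Min {(1 + exp (beta i + beta j))^2 / exp (beta i + beta j) | i j. i < n \<and> j < n \<and> i \<noteq> j}"

text \<open>Likelihood ratio statistic 2 (l(hat beta) - l(hat beta^0)), with the maximized
  log-likelihoods written as suprema over R^n and over the null set Theta0.\<close>
definition lrt :: "nat \<Rightarrow> ((nat \<Rightarrow> real) \<Rightarrow> bool) \<Rightarrow> (nat \<times> nat \<Rightarrow> bool) \<Rightarrow> real" where
  "lrt n Theta0 A = 2 * ((SUP beta. loglik n A beta) - (SUP beta \<in> {beta. Theta0 beta}. loglik n A beta))"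

definition lrt_norm :: "nat \<Rightarrow> nat \<Rightarrow> ((nat \<Rightarrow> real) \<Rightarrow> bool) \<Rightarrow> (nat \<times> nat \<Rightarrow> bool) \<Rightarrow> real" where
  "lrt_norm n r Theta0 A = (lrt n Theta0 A - real r) / sqrt (2 * real r)"

end

theory Submission
  imports Defs
begin

text \<open>
  Write \<open>xi i\<close> for the centred degree of node \<open>i\<close>, \<open>V i\<close> for its variance and \<open>x i = xi i / V i\<close>. The maximum of
  the log-likelihood over a null set is squeezed without locating the maximizer. The point \<open>beta + x\<close>,
  with \<open>x\<close> set to zero on the constrained nodes, gives a lower bound. For the upper bound, every edge array
  with the same row sums as the centred adjacency array (on the constrained nodes only their total has to
  agree) may replace the data, after which the log-likelihood is bounded edge by edge by a Kullback-Leibler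
  divergence; the array used is \<open>v (x i + x j)\<close> plus a small correction of the row sums. Both bounds
  have the form \<open>1/2 (sum of xi i ^ 2 / V i over free i)\<close> up to a quadratic form, a cubic form and
  remainders, all of which are \<open>O(b_n ^ 2)\<close> in mean by the Efron-Stein inequality, hence negligible
  because either hypothesis implies \<open>b_n ^ 3 = o(sqrt r)\<close>. What remains is the sum of \<open>xi i ^ 2 / V i\<close>
  over \<open>i < r\<close>, whose normalized characteristic function satisfies \<open>phi' = - t phi + o(1)\<close> by
  the discrete integration by parts \<open>E (eps e * f) = v e * E (D e f)\<close>.
\<close>

section \<open>Products of Bernoulli measures\<close>

text \<open>The Fisher information of the model has diagonal entries \<open>V i\<close>, each the
  sum of the n - 1 off-diagonal entries \<open>v\<close> in its row. It is thus close to its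
  diagonal, and \<open>x\<close> is the Newton step that keeps only the diagonal. The difficulty is
  accuracy: each maximum contains a sum of up to n squares, yet must be known up to o(sqrt r), where
  r may grow much more slowly than n, so no error may grow with n. Each \<open>x i\<close> has size
  at most about sqrt(b/n). The quartic remainder over about n^2/2 edges can then be summed in
  absolute value and gives b^2, whereas this would give n b for the quadratic form and sqrt(n)
  b^(3/2) for the cubic one. Those two need cancellation, hence mean and Efron-Stein variance
  separately. The data may be replaced because the log-likelihood pairs them with the parameter
  through row sums only. The free common value in the homogeneous null changes the error by O(b) in
  mean. In the difference of the two maxima, the log-likelihood at the true parameter and the
  squares of the nodes i >= r cancel.\<close>

locale bernoulli_product =
  fixes E :: "'e set" and p :: "'e \<Rightarrow> real"
  assumes finite_E: "finite E" and p_range: "e \<in> E \<Longrightarrow> 0 \<le> p e \<and> p e \<le> 1"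
begin

definition M :: "('e \<Rightarrow> bool) pmf" where
  "M = Pi_pmf E False (\<lambda>e. bernoulli_pmf (p e))"

definition expec :: "(('e \<Rightarrow> bool) \<Rightarrow> real) \<Rightarrow> real" where
  "expec f = measure_pmf.expectation M f"

definition v :: "'e \<Rightarrow> real" where "v e = p e * (1 - p e)"

definition eps :: "'e \<Rightarrow> ('e \<Rightarrow> bool) \<Rightarrow> real" where "eps e A = of_bool (A e) - p e"

definition D :: "'e \<Rightarrow> (('e \<Rightarrow> bool) \<Rightarrow> real) \<Rightarrow> ('e \<Rightarrow> bool) \<Rightarrow> real" where
  "D e f A = f (A(e := True)) - f (A(e := False))"

text \<open>The conditional expectation of \<open>f\<close> given every coordinate except
  \<open>e\<close>.\<close>

definition avg :: "'e \<Rightarrow> (('e \<Rightarrow> bool) \<Rightarrow> real) \<Rightarrow> ('e \<Rightarrow> bool) \<Rightarrow> real" where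
  "avg e f A = p e * f (A(e := True)) + (1 - p e) * f (A(e := False))"

lemma v_nonneg: "e \<in> E \<Longrightarrow> 0 \<le> v e"
  using p_range[of e] by (simp add: v_def)

lemma v_le_quarter: "v e \<le> 1 / 4"
proof -
  have "0 \<le> (p e - 1/2)\<^sup>2" by simp
  then show ?thesis by (simp add: v_def power2_eq_square field_simps)
qed

lemma set_M: "A \<in> set_pmf M \<Longrightarrow> e \<notin> E \<Longrightarrow> \<not> A e"
  using set_Pi_pmf_subset[OF finite_E, of False] unfolding M_def by auto

lemma finite_set_M: "finite (set_pmf M)"
proof -
  have "set_pmf M \<subseteq> PiE_dflt E False (\<lambda>_. UNIV)"
    unfolding M_def using finite_E by (auto simp: set_Pi_pmf PiE_dflt_def)
  then show ?thesis
    by (rule finite_subset) (intro finite_PiE_dflt finite_E, simp)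
qed

lemma integrable_M [simp]: "integrable (measure_pmf M) (f :: _ \<Rightarrow> real)"
  by (rule integrable_measure_pmf_finite[OF finite_set_M])

lemma expec_add: "expec (\<lambda>A. f A + g A) = expec f + expec g"
  by (simp add: expec_def)
lemma expec_diff: "expec (\<lambda>A. f A - g A) = expec f - expec g"
  by (simp add: expec_def)
lemma expec_minus: "expec (\<lambda>A. - f A) = - expec f"
  by (simp add: expec_def)
lemma expec_cmult: "expec (\<lambda>A. c * f A) = c * expec f"
  by (simp add: expec_def)
lemma expec_cmult2: "expec (\<lambda>A. f A * c) = expec f * c"
  by (simp add: expec_def)
lemma expec_divide: "expec (\<lambda>A. f A / c) = expec f / c"
  by (simp add: expec_def)
lemma expec_const [simp]: "expec (\<lambda>A. c) = c"
  by (simp add: expec_def)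
lemma expec_sum: "expec (\<lambda>A. \<Sum>i\<in>I. f i A) = (\<Sum>i\<in>I. expec (f i))"
  by (simp add: expec_def)

lemmas expec_linear = expec_add expec_diff expec_minus expec_cmult expec_cmult2 expec_divide expec_const expec_sum

lemma expec_mono_set: "(\<And>A. A \<in> set_pmf M \<Longrightarrow> f A \<le> g A) \<Longrightarrow> expec f \<le> expec g"
  unfolding expec_def by (intro integral_mono_AE integrable_M) (simp add: AE_measure_pmf_iff)

lemma expec_mono: "(\<And>A. f A \<le> g A) \<Longrightarrow> expec f \<le> expec g"
  by (rule expec_mono_set)

lemma expec_cong_set: "(\<And>A. A \<in> set_pmf M \<Longrightarrow> f A = g A) \<Longrightarrow> expec f = expec g"
  by (intro antisym expec_mono_set) auto

lemma expec_nonneg: "(\<And>A. 0 \<le> f A) \<Longrightarrow> 0 \<le> expec f"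
  using expec_mono[of "\<lambda>_. 0" f] by simp

lemma abs_expec_le: "\<bar>expec f\<bar> \<le> expec (\<lambda>A. \<bar>f A\<bar>)"
  using integral_abs_bound[of "measure_pmf M" f] by (simp add: expec_def)

lemma expec_avg:
  assumes e: "e \<in> E"
  shows "expec (avg e f) = expec f"
proof -
  let ?P = "Pi_pmf (E - {e}) False (\<lambda>e. bernoulli_pmf (p e))"
  have M: "M = bernoulli_pmf (p e) \<bind> (\<lambda>y. map_pmf (\<lambda>f. f(e := y)) ?P)"
  proof -
    have "E = insert e (E - {e})" using e by auto
    then have "M = Pi_pmf (insert e (E - {e})) False (\<lambda>e. bernoulli_pmf (p e))"
      by (simp add: M_def)
    also have "\<dots> = bernoulli_pmf (p e) \<bind> (\<lambda>y. map_pmf (\<lambda>f. f(e := y)) ?P)"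
      using finite_E by (subst Pi_pmf_insert') (auto simp: map_pmf_def)
    finally show ?thesis .
  qed
  have fin: "finite (set_pmf ?P)"
  proof -
    have "set_pmf ?P \<subseteq> PiE_dflt (E - {e}) False (\<lambda>_. UNIV)"
      using finite_E by (auto simp: set_Pi_pmf PiE_dflt_def)
    then show ?thesis
      by (rule finite_subset) (intro finite_PiE_dflt, use finite_E in auto)
  qed
  have int: "integrable (measure_pmf ?P) (g :: _ \<Rightarrow> real)" for g
    by (rule integrable_measure_pmf_finite[OF fin])
  \<comment> \<open>Disintegration along coordinate \<open>e\<close>. Since \<open>avg e f\<close>
    ignores that coordinate, its two branches coincide and recombine to the formula for
    \<open>f\<close>.\<close>
  have key: "expec g = p e * measure_pmf.expectation ?P (\<lambda>A. g (A(e := True)))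
      + (1 - p e) * measure_pmf.expectation ?P (\<lambda>A. g (A(e := False)))" for g
  proof -
    have "expec g = measure_pmf.expectation (bernoulli_pmf (p e))
        (\<lambda>y. measure_pmf.expectation (map_pmf (\<lambda>f. f(e := y)) ?P) g)"
      unfolding expec_def M using fin
      by (subst pmf_expectation_bind[where A = UNIV]) (auto simp: integral_measure_pmf[where A = UNIV])
    then show ?thesis
      using p_range[OF e] by (simp add: integral_measure_pmf[where A = UNIV] UNIV_bool)
  qed
  have "measure_pmf.expectation ?P (\<lambda>A. avg e f A) = expec f"
    unfolding key[of f] by (simp add: avg_def int)
  moreover have "expec (avg e f) = p e * measure_pmf.expectation ?P (avg e f)
      + (1 - p e) * measure_pmf.expectation ?P (avg e f)"
    unfolding key[of "avg e f"] by (simp add: avg_def[abs_def])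
  ultimately show ?thesis by (simp add: algebra_simps)
qed

text \<open>Averaging \<open>eps e * f\<close> over the two values of coordinate \<open>e\<close>
  leaves p (1 - p) times the jump of \<open>f\<close>. This is the Bernoulli analogue of Stein's
  identity for the Gaussian.\<close>

lemma expec_eps_mult:
  assumes e: "e \<in> E"
  shows "expec (\<lambda>A. eps e A * f A) = v e * expec (D e f)"
proof -
  have "expec (\<lambda>A. eps e A * f A) = expec (avg e (\<lambda>A. eps e A * f A))"
    using expec_avg[OF e] by simp
  also have "avg e (\<lambda>A. eps e A * f A) = (\<lambda>A. v e * D e f A)"
    by (auto simp: fun_eq_iff avg_def eps_def v_def D_def algebra_simps)
  finally show ?thesis by (simp add: expec_cmult)
qed

lemma expec_eps [simp]: "e \<in> E \<Longrightarrow> expec (eps e) = 0"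
  using expec_eps_mult[of e "\<lambda>_. 1"] by (simp add: D_def[abs_def])

text \<open>A two-valued variable has second moment equal to its squared mean plus
  \<open>v e\<close> times its squared jump. This is the one-coordinate case of Efron-Stein.\<close>

lemma expec_square_avg:
  assumes e: "e \<in> E"
  shows "expec (\<lambda>A. (f A)\<^sup>2) = expec (\<lambda>A. (avg e f A)\<^sup>2) + v e * expec (\<lambda>A. (D e f A)\<^sup>2)"
proof -
  have "expec (\<lambda>A. (f A)\<^sup>2) = expec (avg e (\<lambda>A. (f A)\<^sup>2))"
    using expec_avg[OF e] by simp
  also have "avg e (\<lambda>A. (f A)\<^sup>2) = (\<lambda>A. (avg e f A)\<^sup>2 + v e * (D e f A)\<^sup>2)"
    by (auto simp: fun_eq_iff avg_def v_def D_def algebra_simps power2_eq_square)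
  finally show ?thesis by (simp add: expec_linear)
qed

lemma expec_square_avg_le: "e \<in> E \<Longrightarrow> expec (\<lambda>A. (avg e f A)\<^sup>2) \<le> expec (\<lambda>A. (f A)\<^sup>2)"
  using expec_square_avg[of e f] mult_nonneg_nonneg[OF v_nonneg expec_nonneg[of "\<lambda>A. (D e f A)\<^sup>2"], of e]
  by simp

lemma D_avg: "D e (avg e' f) = (if e = e' then (\<lambda>_. 0) else avg e' (D e f))"
  by (auto simp: fun_eq_iff D_def avg_def algebra_simps fun_upd_twist)

text \<open>The proof averages out one coordinate after another; averaging decreases every term
  on the right-hand side.\<close>
theorem efron_stein: "expec (\<lambda>A. (f A)\<^sup>2) \<le> (expec f)\<^sup>2 + (\<Sum>e\<in>E. v e * expec (\<lambda>A. (D e f A)\<^sup>2))"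
proof -
  \<comment> \<open>Invariant once the coordinates in \<open>F\<close> are averaged out:
    \<open>g\<close> does not see \<open>F\<close>, keeps the mean, and has jumps no larger in mean
    square than those of \<open>f\<close>. The last clause lets each later coordinate be charged to
    \<open>f\<close> itself.\<close>
  have "\<exists>g. (\<forall>A B. (\<forall>e. e \<notin> F \<longrightarrow> A e = B e) \<longrightarrow> g A = g B) \<and> expec g = expec f
      \<and> expec (\<lambda>A. (f A)\<^sup>2) \<le> expec (\<lambda>A. (g A)\<^sup>2) + (\<Sum>e\<in>F. v e * expec (\<lambda>A. (D e f A)\<^sup>2))
      \<and> (\<forall>e. expec (\<lambda>A. (D e g A)\<^sup>2) \<le> expec (\<lambda>A. (D e f A)\<^sup>2))" if "finite F" "F \<subseteq> E" for F
    using that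
  proof (induction F rule: finite_induct)
    case empty
    show ?case by (intro exI[of _ f]) (auto intro: arg_cong[where f = f])
  next
    case (insert e F)
    then obtain g where g: "\<And>A B. (\<forall>e. e \<notin> F \<longrightarrow> A e = B e) \<Longrightarrow> g A = g B" "expec g = expec f"
      "expec (\<lambda>A. (f A)\<^sup>2) \<le> expec (\<lambda>A. (g A)\<^sup>2) + (\<Sum>e\<in>F. v e * expec (\<lambda>A. (D e f A)\<^sup>2))"
      "\<And>e. expec (\<lambda>A. (D e g A)\<^sup>2) \<le> expec (\<lambda>A. (D e f A)\<^sup>2)"
      by auto
    have e: "e \<in> E" using insert.prems by simp
    have "avg e g A = avg e g B" if "\<forall>e'. e' \<notin> insert e F \<longrightarrow> A e' = B e'" for A B
    proof -
      have "g (A(e := b)) = g (B(e := b))" for b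
        by (rule g(1)) (use that in auto)
      then show ?thesis by (simp add: avg_def)
    qed
    moreover have "expec (avg e g) = expec f" using expec_avg[OF e] g(2) by simp
    moreover have "expec (\<lambda>A. (f A)\<^sup>2) \<le> expec (\<lambda>A. (avg e g A)\<^sup>2) + (\<Sum>e\<in>insert e F. v e * expec (\<lambda>A. (D e f A)\<^sup>2))"
      using g(3) expec_square_avg[OF e, of g] mult_left_mono[OF g(4)[of e] v_nonneg[OF e]] insert.hyps
      by simp
    moreover have "expec (\<lambda>A. (D e' (avg e g) A)\<^sup>2) \<le> expec (\<lambda>A. (D e' f A)\<^sup>2)" for e'
    proof (cases "e' = e")
      case True
      then show ?thesis by (simp add: D_avg expec_nonneg)
    next
      case False
      then show ?thesis using expec_square_avg_le[OF e, of "D e' g"] g(4)[of e'] by (simp add: D_avg)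
    qed
    ultimately show ?case by (intro exI[of _ "avg e g"]) auto
  qed
  from this[OF finite_E order_refl] obtain g
    where g: "\<And>A B. (\<forall>e. e \<notin> E \<longrightarrow> A e = B e) \<Longrightarrow> g A = g B" "expec g = expec f"
      "expec (\<lambda>A. (f A)\<^sup>2) \<le> expec (\<lambda>A. (g A)\<^sup>2) + (\<Sum>e\<in>E. v e * expec (\<lambda>A. (D e f A)\<^sup>2))"
    by auto
  \<comment> \<open>Samples are \<open>False\<close> off \<open>E\<close>, so a function blind to
    \<open>E\<close> is constant on the support and its second moment is its squared mean.\<close>
  have c: "g A = g (\<lambda>_. False)" if "A \<in> set_pmf M" for A
    by (rule g(1)) (use set_M[OF that] in auto)
  have "expec g = g (\<lambda>_. False)"
    using expec_cong_set[of g "\<lambda>_. g (\<lambda>_. False)"] c by simp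
  moreover have "expec (\<lambda>A. (g A)\<^sup>2) = (g (\<lambda>_. False))\<^sup>2"
    using expec_cong_set[of "\<lambda>A. (g A)\<^sup>2" "\<lambda>_. (g (\<lambda>_. False))\<^sup>2"] c by simp
  ultimately show ?thesis using g(2,3) by simp
qed

text \<open>AM-GM integrated, in place of Cauchy-Schwarz. The scale \<open>l\<close> is to be the
  anticipated size of \<open>f\<close>, later B^2 or sqrt r.\<close>

lemma expec_abs_le:
  assumes "l > 0"
  shows "expec (\<lambda>A. \<bar>f A\<bar>) \<le> expec (\<lambda>A. (f A)\<^sup>2) / (2 * l) + l / 2"
proof -
  have "\<bar>f A\<bar> \<le> (f A)\<^sup>2 / (2 * l) + l / 2" for A
  proof -
    have "0 \<le> (\<bar>f A\<bar> - l)\<^sup>2" by simp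
    then have "2 * l * \<bar>f A\<bar> \<le> (f A)\<^sup>2 + l\<^sup>2" by (simp add: power2_diff algebra_simps)
    then show ?thesis using assms by (simp add: field_simps power2_eq_square)
  qed
  then have "expec (\<lambda>A. \<bar>f A\<bar>) \<le> expec (\<lambda>A. (f A)\<^sup>2 / (2 * l) + l / 2)" by (rule expec_mono)
  then show ?thesis by (simp add: expec_linear)
qed

section \<open>Moments of linear forms in the centred coordinates\<close>

definition lin :: "('e \<Rightarrow> real) \<Rightarrow> ('e \<Rightarrow> bool) \<Rightarrow> real" where
  "lin \<alpha> A = (\<Sum>e\<in>E. \<alpha> e * eps e A)"

definition var :: "('e \<Rightarrow> real) \<Rightarrow> real" where
  "var \<alpha> = (\<Sum>e\<in>E. v e * (\<alpha> e)\<^sup>2)"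

lemma lin_upd:
  assumes "e \<in> E"
  shows "lin \<alpha> (A(e := b)) = lin \<alpha> A + (of_bool b - of_bool (A e)) * \<alpha> e"
proof -
  have "lin \<alpha> (A(e := b)) - lin \<alpha> A = (\<Sum>e'\<in>E. if e' = e then (of_bool b - of_bool (A e)) * \<alpha> e else 0)"
    unfolding lin_def sum_subtractf[symmetric]
    by (intro sum.cong) (auto simp: eps_def algebra_simps)
  then show ?thesis using assms finite_E by simp
qed

lemma D_lin: "e \<in> E \<Longrightarrow> D e (lin \<alpha>) = (\<lambda>_. \<alpha> e)"
  by (auto simp: D_def lin_upd fun_eq_iff algebra_simps)

lemma expec_lin [simp]: "expec (lin \<alpha>) = 0"
  by (simp add: lin_def[abs_def] expec_sum expec_cmult)

lemma expec_lin_mult: "expec (\<lambda>A. lin \<alpha> A * f A) = (\<Sum>e\<in>E. \<alpha> e * (v e * expec (D e f)))"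
proof -
  have "expec (\<lambda>A. lin \<alpha> A * f A) = (\<Sum>e\<in>E. expec (\<lambda>A. \<alpha> e * (eps e A * f A)))"
    by (simp add: lin_def sum_distrib_right expec_sum mult.assoc)
  also have "\<dots> = (\<Sum>e\<in>E. \<alpha> e * (v e * expec (D e f)))"
    by (intro sum.cong) (auto simp: expec_cmult expec_eps_mult)
  finally show ?thesis .
qed

lemma expec_lin_lin: "expec (\<lambda>A. lin \<alpha> A * lin \<beta> A) = (\<Sum>e\<in>E. v e * \<alpha> e * \<beta> e)"
  unfolding expec_lin_mult by (intro sum.cong) (auto simp: D_lin)

lemma expec_lin_square: "expec (\<lambda>A. (lin \<alpha> A)\<^sup>2) = var \<alpha>"
  unfolding power2_eq_square expec_lin_lin var_def by (simp add: mult.assoc)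

lemma var_nonneg: "0 \<le> var \<alpha>"
  unfolding var_def by (intro sum_nonneg mult_nonneg_nonneg v_nonneg) auto

text \<open>Integration by parts turns the third moment into the sum of the third cumulants v (1 -
  2p) \<alpha>^3. One factor \<alpha> is bounded by \<open>m\<close>, the rest is the
  variance.\<close>

lemma expec_lin_cube:
  assumes "\<And>e. e \<in> E \<Longrightarrow> \<bar>\<alpha> e\<bar> \<le> m"
  shows "\<bar>expec (\<lambda>A. (lin \<alpha> A) ^ 3)\<bar> \<le> m * var \<alpha>"
proof -
  have D: "expec (D e (\<lambda>A. (lin \<alpha> A)\<^sup>2)) = (\<alpha> e)\<^sup>2 * (1 - 2 * p e)" if e: "e \<in> E" for e
  proof -
    have "D e (\<lambda>A. (lin \<alpha> A)\<^sup>2) A = 2 * \<alpha> e * lin \<alpha> A - 2 * (\<alpha> e)\<^sup>2 * eps e A + (\<alpha> e)\<^sup>2 * (1 - 2 * p e)" for A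
      using e by (cases "A e") (simp_all add: D_def lin_upd eps_def power2_eq_square algebra_simps)
    then have "D e (\<lambda>A. (lin \<alpha> A)\<^sup>2) = (\<lambda>A. 2 * \<alpha> e * lin \<alpha> A - 2 * (\<alpha> e)\<^sup>2 * eps e A + (\<alpha> e)\<^sup>2 * (1 - 2 * p e))"
      by (rule ext)
    then show ?thesis using e by (simp add: expec_linear)
  qed
  have "expec (\<lambda>A. (lin \<alpha> A) ^ 3) = expec (\<lambda>A. lin \<alpha> A * (lin \<alpha> A)\<^sup>2)"
    by (simp add: power3_eq_cube power2_eq_square mult.assoc)
  also have "\<dots> = (\<Sum>e\<in>E. \<alpha> e * (v e * ((\<alpha> e)\<^sup>2 * (1 - 2 * p e))))"
    unfolding expec_lin_mult by (intro sum.cong) (auto simp: D)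
  finally have "\<bar>expec (\<lambda>A. (lin \<alpha> A) ^ 3)\<bar> \<le> (\<Sum>e\<in>E. \<bar>\<alpha> e * (v e * ((\<alpha> e)\<^sup>2 * (1 - 2 * p e)))\<bar>)"
    by simp
  also have "\<dots> \<le> (\<Sum>e\<in>E. m * (v e * (\<alpha> e)\<^sup>2))"
  proof (intro sum_mono)
    fix e assume e: "e \<in> E"
    have 1: "\<bar>1 - 2 * p e\<bar> \<le> 1" using p_range[OF e] by auto
    have 2: "0 \<le> v e * (\<alpha> e)\<^sup>2" using v_nonneg[OF e] by simp
    have "\<bar>\<alpha> e * (v e * ((\<alpha> e)\<^sup>2 * (1 - 2 * p e)))\<bar> = (\<bar>\<alpha> e\<bar> * \<bar>1 - 2 * p e\<bar>) * (v e * (\<alpha> e)\<^sup>2)"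
      using v_nonneg[OF e] by (simp add: abs_mult)
    also have "\<dots> \<le> (m * 1) * (v e * (\<alpha> e)\<^sup>2)"
      using assms[OF e] 1 by (intro mult_right_mono[OF _ 2] mult_mono) auto
    finally show "\<bar>\<alpha> e * (v e * ((\<alpha> e)\<^sup>2 * (1 - 2 * p e)))\<bar> \<le> m * (v e * (\<alpha> e)\<^sup>2)" by simp
  qed
  finally show ?thesis by (simp add: var_def sum_distrib_left)
qed

text \<open>Efron-Stein for the square of \<open>lin\<close>: its mean is \<open>var\<close>, and
  its jump at \<open>e\<close> is \<open>\<alpha> e\<close> times 2 lin plus or minus
  \<open>\<alpha> e\<close>, which brings the second moment in again. Here 9 = 1 + 8.\<close>

lemma expec_lin_fourth:
  assumes "\<And>e. e \<in> E \<Longrightarrow> \<bar>\<alpha> e\<bar> \<le> m"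
  shows "expec (\<lambda>A. (lin \<alpha> A) ^ 4) \<le> 9 * (var \<alpha>)\<^sup>2 + 2 * m\<^sup>2 * var \<alpha>"
proof -
  have "expec (\<lambda>A. (lin \<alpha> A) ^ 4) = expec (\<lambda>A. ((lin \<alpha> A)\<^sup>2)\<^sup>2)" by simp
  also have "\<dots> \<le> (var \<alpha>)\<^sup>2 + (\<Sum>e\<in>E. v e * expec (\<lambda>A. (D e (\<lambda>A. (lin \<alpha> A)\<^sup>2) A)\<^sup>2))"
    using efron_stein[of "\<lambda>A. (lin \<alpha> A)\<^sup>2"] by (simp add: expec_lin_square)
  also have "(\<Sum>e\<in>E. v e * expec (\<lambda>A. (D e (\<lambda>A. (lin \<alpha> A)\<^sup>2) A)\<^sup>2))
     \<le> (\<Sum>e\<in>E. v e * ((\<alpha> e)\<^sup>2 * (8 * var \<alpha> + 2 * m\<^sup>2)))"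
  proof (intro sum_mono mult_left_mono v_nonneg)
    fix e assume e: "e \<in> E"
    have "(D e (\<lambda>A. (lin \<alpha> A)\<^sup>2) A)\<^sup>2 \<le> (\<alpha> e)\<^sup>2 * (8 * (lin \<alpha> A)\<^sup>2 + 2 * m\<^sup>2)" for A
    proof -
      define s where "s = (if A e then - \<alpha> e else \<alpha> e)"
      have "D e (\<lambda>A. (lin \<alpha> A)\<^sup>2) A = \<alpha> e * (2 * lin \<alpha> A + s)"
        using e by (cases "A e") (simp_all add: D_def lin_upd s_def power2_eq_square algebra_simps)
      moreover have "(2 * lin \<alpha> A + s)\<^sup>2 \<le> 8 * (lin \<alpha> A)\<^sup>2 + 2 * s\<^sup>2"
        using zero_le_power2[of "2 * lin \<alpha> A - s"] by (simp add: power2_eq_square algebra_simps)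
      moreover have "s\<^sup>2 \<le> m\<^sup>2"
        using assms[OF e] by (auto simp: s_def intro!: power2_le_iff_abs_le[THEN iffD2])
      ultimately show ?thesis
        by (auto simp: power_mult_distrib intro!: mult_left_mono)
    qed
    then have "expec (\<lambda>A. (D e (\<lambda>A. (lin \<alpha> A)\<^sup>2) A)\<^sup>2) \<le> expec (\<lambda>A. (\<alpha> e)\<^sup>2 * (8 * (lin \<alpha> A)\<^sup>2 + 2 * m\<^sup>2))"
      by (rule expec_mono)
    then show "expec (\<lambda>A. (D e (\<lambda>A. (lin \<alpha> A)\<^sup>2) A)\<^sup>2) \<le> (\<alpha> e)\<^sup>2 * (8 * var \<alpha> + 2 * m\<^sup>2)"
      by (simp add: expec_linear expec_lin_square)
  qed
  also have "\<dots> = var \<alpha> * (8 * var \<alpha> + 2 * m\<^sup>2)"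
    by (simp add: var_def sum_distrib_right mult.assoc)
  finally show ?thesis by (simp add: power2_eq_square algebra_simps)
qed

end

section \<open>Row sums and linear forms of the degrees\<close>

text \<open>Edge arrays are indexed by i < j only. This reads one as a symmetric matrix with zero
  diagonal, so that node-wise sums run over all j < n.\<close>

definition sy :: "(nat \<times> nat \<Rightarrow> real) \<Rightarrow> nat \<Rightarrow> nat \<Rightarrow> real" where
  "sy w i j = (if i = j then 0 else w (min i j, max i j))"

definition row :: "nat \<Rightarrow> (nat \<times> nat \<Rightarrow> real) \<Rightarrow> nat \<Rightarrow> real" where
  "row n w i = (\<Sum>j<n. sy w i j)"

definition inc :: "nat \<times> nat \<Rightarrow> nat \<Rightarrow> real" where
  "inc e i = of_bool (i = fst e \<or> i = snd e)"

definition ends :: "(nat \<Rightarrow> real) \<Rightarrow> nat \<times> nat \<Rightarrow> real" where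
  "ends z e = z (fst e) + z (snd e)"

lemma sy_commute: "sy w i j = sy w j i"
  by (simp add: sy_def min.commute max.commute)

lemma node_pairs_Suc: "node_pairs (Suc n) = node_pairs n \<union> (\<lambda>i. (i, n)) ` {..<n}"
  by (auto simp: node_pairs_def less_Suc_eq)

lemma finite_node_pairs: "finite (node_pairs n)"
proof -
  have "node_pairs n \<subseteq> {..<n} \<times> {..<n}" by (auto simp: node_pairs_def)
  then show ?thesis by (rule finite_subset) simp
qed

lemma node_pairsD: "e \<in> node_pairs n \<Longrightarrow> fst e < snd e \<and> fst e < n \<and> snd e < n"
  by (auto simp: node_pairs_def)

lemma sum_node_pairs_Suc:
  "(\<Sum>e\<in>node_pairs (Suc n). f e) = (\<Sum>e\<in>node_pairs n. f e) + (\<Sum>i<n. f (i, n))"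
proof -
  have "(\<Sum>e\<in>node_pairs (Suc n). f e) = (\<Sum>e\<in>node_pairs n. f e) + sum f ((\<lambda>i. (i, n)) ` {..<n})"
    unfolding node_pairs_Suc
    by (rule sum.union_disjoint[OF finite_node_pairs]) (auto simp: node_pairs_def)
  then show ?thesis by (simp add: sum.reindex inj_on_def)
qed

lemma card_node_pairs: "2 * card (node_pairs n) + n = n\<^sup>2"
proof (induction n)
  case 0
  have "node_pairs 0 = {}" by (auto simp: node_pairs_def)
  then show ?case by simp
next
  case (Suc n)
  have "card (node_pairs (Suc n)) = card (node_pairs n) + n"
    using sum_node_pairs_Suc[of "\<lambda>_. 1::nat" n] by simp
  with Suc show ?case by (simp add: power2_eq_square)
qed

lemma card_node_pairs_le: "real (card (node_pairs n)) \<le> (real n)\<^sup>2 / 2"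
proof -
  have "real (2 * card (node_pairs n) + n) = (real n)\<^sup>2" unfolding card_node_pairs by simp
  then show ?thesis by simp
qed

lemma sum_sy_eq:
  "(\<Sum>i<n. \<Sum>j<n. sy w i j * g i j)
    = (\<Sum>e\<in>node_pairs n. w e * (g (fst e) (snd e) + g (snd e) (fst e)))"
proof (induction n)
  case 0
  have "node_pairs 0 = {}" by (auto simp: node_pairs_def)
  then show ?case by simp
next
  case (Suc n)
  have "sy w i n = w (i, n) \<and> sy w n i = w (i, n)" if "i < n" for i
    using that by (simp add: sy_def)
  then show ?case
    using Suc.IH by (simp add: sum.distrib sum_node_pairs_Suc distrib_left) (simp add: sy_def)
qed

text \<open>\<open>ends\<close> is the transpose of \<open>row\<close>, both coming from the
  incidence matrix. The identity moves sums between nodes and edges, and it is what justifies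
  replacing the data by an array with the same row sums.\<close>

lemma sum_mult_row: "(\<Sum>i<n. z i * row n w i) = (\<Sum>e\<in>node_pairs n. w e * ends z e)"
proof -
  have "(\<Sum>i<n. z i * row n w i) = (\<Sum>i<n. \<Sum>j<n. sy w i j * z i)"
    by (simp add: row_def sum_distrib_left mult.commute)
  then show ?thesis by (simp add: sum_sy_eq ends_def)
qed

lemma sum_row: "(\<Sum>i<n. row n w i) = 2 * (\<Sum>e\<in>node_pairs n. w e)"
  using sum_mult_row[of "\<lambda>_. 1" n w] by (simp add: ends_def sum_distrib_right[symmetric])

lemma row_eq_inc: "i < n \<Longrightarrow> row n w i = (\<Sum>e\<in>node_pairs n. w e * inc e i)"
proof -
  assume i: "i < n"
  \<comment> \<open>Pairing the rows with the unit vector at \<open>i\<close> makes the adjointness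
    identity applicable.\<close>
  have "row n w i = (\<Sum>j<n. of_bool (j = i) * row n w j)"
    using i by (simp add: of_bool_def if_distrib[of "\<lambda>x. x * _"] cong: if_cong)
  also have "\<dots> = (\<Sum>e\<in>node_pairs n. w e * inc e i)"
    unfolding sum_mult_row by (intro sum.cong) (auto simp: ends_def inc_def dest: node_pairsD)
  finally show ?thesis .
qed

lemma row_add: "row n (\<lambda>e. f e + g e) i = row n f i + row n g i"
proof -
  have "sy (\<lambda>e. f e + g e) i j = sy f i j + sy g i j" for j by (simp add: sy_def)
  then show ?thesis by (simp add: row_def sum.distrib)
qed

lemma inc_range: "0 \<le> inc e i" "inc e i \<le> 1"
  by (auto simp: inc_def)

lemma degree_eq_row: "real (degree n A i) = row n (\<lambda>e. of_bool (A e)) i"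
proof -
  have "real (degree n A i) = (\<Sum>j\<in>{..<n} \<inter> {j. adj A i j}. 1)"
    by (simp add: degree_def Int_def)
  also have "\<dots> = (\<Sum>j<n. if adj A i j then 1 else 0)"
    by (subst sum.inter_restrict) auto
  also have "\<dots> = row n (\<lambda>e. of_bool (A e)) i"
    unfolding row_def by (intro sum.cong) (auto simp: sy_def adj_def)
  finally show ?thesis .
qed

lemma loglik_eq:
  "loglik n A b = (\<Sum>e\<in>node_pairs n. of_bool (A e) * ends b e - ln (1 + exp (ends b e)))"
  by (simp add: loglik_def degree_eq_row sum_mult_row sum_subtractf ends_def case_prod_beta)

text \<open>Supplies the upper bound that makes the suprema in \<open>lrt\<close>
  meaningful.\<close>

lemma loglik_nonpos: "loglik n A b \<le> 0"
proof -
  have "of_bool (A e) * t - ln (1 + exp t) \<le> 0" for e and t :: real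
  proof -
    have "t = ln (exp t)" by simp
    also have "\<dots> \<le> ln (1 + exp t)" by (intro ln_mono) (auto simp: add_pos_pos)
    finally have "t \<le> ln (1 + exp t)" .
    moreover have "0 \<le> ln (1 + exp t)" by (intro ln_ge_zero) simp
    ultimately show ?thesis by (cases "A e") auto
  qed
  then show ?thesis unfolding loglik_eq by (intro sum_nonpos) auto
qed

lemma weighted_cauchy_schwarz:
  fixes w u :: "'a \<Rightarrow> real"
  assumes "\<And>i. i \<in> I \<Longrightarrow> 0 \<le> w i"
  shows "(\<Sum>i\<in>I. w i * u i)\<^sup>2 \<le> (\<Sum>i\<in>I. w i) * (\<Sum>i\<in>I. w i * (u i)\<^sup>2)"
proof -
  have "(\<Sum>i\<in>I. sqrt (w i) * (sqrt (w i) * u i))\<^sup>2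
      \<le> (\<Sum>i\<in>I. (sqrt (w i))\<^sup>2) * (\<Sum>i\<in>I. (sqrt (w i) * u i)\<^sup>2)"
    by (rule Cauchy_Schwarz_ineq_sum)
  moreover have "(\<Sum>i\<in>I. sqrt (w i) * (sqrt (w i) * u i)) = (\<Sum>i\<in>I. w i * u i)"
    by (intro sum.cong refl) (simp add: assms mult.assoc[symmetric])
  moreover have "(\<Sum>i\<in>I. (sqrt (w i))\<^sup>2) = (\<Sum>i\<in>I. w i)"
    by (intro sum.cong refl) (simp add: assms)
  moreover have "(\<Sum>i\<in>I. (sqrt (w i) * u i)\<^sup>2) = (\<Sum>i\<in>I. w i * (u i)\<^sup>2)"
    by (intro sum.cong refl) (simp add: assms power_mult_distrib)
  ultimately show ?thesis by simp
qed

section \<open>The \<beta>-model as a product measure, and bounds for the degree variances\<close>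

definition edge_weight :: "(nat \<Rightarrow> real) \<Rightarrow> nat \<times> nat \<Rightarrow> real" where
  "edge_weight beta e = edge_prob beta (fst e) (snd e)"

lemma edge_weight_bounds: "0 < edge_weight beta e" "edge_weight beta e < 1"
  by (simp_all add: edge_weight_def edge_prob_def add_pos_pos)

text \<open>\<open>b\<close> stands for \<open>bn n beta\<close>: the quantity (1 + e^t)^2 / e^t is
  the reciprocal of the edge variance, so the second assumption says that every edge variance is at
  least 1/b. Three nodes make n - 2 positive, a denominator in the dual construction.\<close>

locale beta_graph =
  fixes n :: nat and beta :: "nat \<Rightarrow> real" and b :: real
  assumes n_ge: "3 \<le> n"
    and b_bound: "\<And>e. e \<in> node_pairs n \<Longrightarrow> 1 \<le> b * (edge_weight beta e * (1 - edge_weight beta e))"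
begin

abbreviation "E \<equiv> node_pairs n"
abbreviation "pr \<equiv> edge_weight beta"

sublocale bernoulli_product E pr
  using edge_weight_bounds by unfold_locales (auto simp: finite_node_pairs less_imp_le)

lemma beta_model_eq: "beta_model n beta = M"
  by (simp add: beta_model_def M_def edge_weight_def case_prod_beta')

lemma v_bound: "e \<in> E \<Longrightarrow> 1 \<le> b * v e"
  using b_bound by (simp add: v_def)

lemma v_pos: "0 < v e"
  using edge_weight_bounds[of beta e] by (simp add: v_def)

lemma b_ge: "4 \<le> b"
proof -
  have e: "(0, 1) \<in> E" using n_ge by (simp add: node_pairs_def)
  have "b > 0" using v_bound[OF e] v_pos[of "(0,1)"]
    by (smt (verit) mult_nonpos_nonneg)
  then have "b * v (0, 1) \<le> b * (1/4)" by (intro mult_left_mono v_le_quarter) auto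
  then show ?thesis using v_bound[OF e] by simp
qed

definition V :: "nat \<Rightarrow> real" where "V i = row n v i"

text \<open>An upper bound for 1 / \<open>V i\<close>, since \<open>V i\<close> adds up n - 1 edge
  variances of at least 1/b.\<close>

definition eta :: real where "eta = b / (real n - 1)"

lemma eta_pos: "0 < eta"
  using b_ge n_ge by (simp add: eta_def)

lemma V_ge: "i < n \<Longrightarrow> 1 \<le> eta * V i"
proof -
  assume i: "i < n"
  have "(\<Sum>j<n. if i = j then 0 else 1 / b) \<le> V i"
    unfolding V_def row_def
  proof (intro sum_mono)
    fix j assume "j \<in> {..<n}"
    then have "i \<noteq> j \<Longrightarrow> 1 \<le> b * v (min i j, max i j)"
      using i by (intro v_bound) (auto simp: node_pairs_def)
    then show "(if i = j then 0 else 1 / b) \<le> sy v i j"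
      using b_ge by (simp add: sy_def divide_le_eq mult.commute)
  qed
  also have "(\<Sum>j<n. if i = j then 0 else 1 / b) = (\<Sum>j\<in>{..<n} - {i}. 1 / b)"
    by (intro sum.mono_neutral_cong_right) auto
  also have "\<dots> = (real n - 1) / b"
    using i n_ge by (simp add: of_nat_diff)
  finally show ?thesis
    using b_ge n_ge by (simp add: eta_def field_simps)
qed

lemma V_pos: "i < n \<Longrightarrow> 0 < V i"
  using V_ge[of i] eta_pos by (smt (verit) mult_nonneg_nonpos)

lemma sy_v_range: "0 \<le> sy v i j" "sy v i j \<le> 1 / 4"
  using v_pos v_le_quarter by (auto simp: sy_def less_imp_le)

lemma V_le: "V i \<le> real n / 4"
  using sum_bounded_above[of "{..<n}" "sy v i" "1/4"] sy_v_range by (simp add: V_def row_def)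

definition xi :: "nat \<Rightarrow> (nat \<times> nat \<Rightarrow> bool) \<Rightarrow> real" where
  "xi i A = row n (\<lambda>e. eps e A) i"

lemma sum_mult_xi: "(\<Sum>i<n. z i * xi i A) = lin (ends z) A"
  by (simp add: xi_def sum_mult_row lin_def mult.commute)

lemma xi_eq_lin: "i < n \<Longrightarrow> xi i A = lin (\<lambda>e. inc e i) A"
  by (simp add: xi_def row_eq_inc lin_def mult.commute)

lemma ends_square_le: "(ends z e)\<^sup>2 \<le> 2 * ends (\<lambda>i. (z i)\<^sup>2) e"
  using zero_le_power2[of "z (fst e) - z (snd e)"]
  by (simp add: ends_def power2_eq_square algebra_simps)

lemma sum_v_ends: "(\<Sum>e\<in>E. v e * ends z e) = (\<Sum>i<n. V i * z i)"
  using sum_mult_row[of z n v] by (simp add: V_def mult.commute)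

text \<open>In matrix terms: the covariance matrix of the degrees is at most twice its
  diagonal.\<close>

lemma var_ends_le: "var (ends z) \<le> 2 * (\<Sum>i<n. V i * (z i)\<^sup>2)"
proof -
  have "var (ends z) \<le> (\<Sum>e\<in>E. v e * (2 * ends (\<lambda>i. (z i)\<^sup>2) e))"
    unfolding var_def by (intro sum_mono mult_left_mono ends_square_le v_nonneg)
  also have "\<dots> = 2 * (\<Sum>i<n. V i * (z i)\<^sup>2)"
    by (simp add: sum_v_ends[symmetric] sum_distrib_left mult.left_commute)
  finally show ?thesis .
qed

lemma sum_E_le: "(\<And>e. e \<in> E \<Longrightarrow> f e \<le> m) \<Longrightarrow> 0 \<le> m \<Longrightarrow> sum f E \<le> (real n)\<^sup>2 / 2 * m"
  using sum_bounded_above[of E f m] mult_right_mono[OF card_node_pairs_le[of n], of m] by simp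

end

section \<open>Moment bounds\<close>

lemma power2_sum_le: "((s::real) + t)\<^sup>2 \<le> 2 * (s\<^sup>2 + t\<^sup>2)"
  using zero_le_power2[of "s - t"] by (simp add: power2_eq_square algebra_simps)

lemma cube_diff:
  fixes y y' d :: real
  assumes "0 \<le> d" "y' = y + d \<or> y' = y - d"
  shows "\<bar>y' ^ 3 - y ^ 3\<bar> \<le> 6 * d * (y\<^sup>2 + d\<^sup>2)"
proof -
  have 1: "2 * (y * d) \<le> y\<^sup>2 + d\<^sup>2" "- 2 * (y * d) \<le> y\<^sup>2 + d\<^sup>2"
    using zero_le_power2[of "y + d"] zero_le_power2[of "y - d"]
    by (simp_all add: power2_eq_square algebra_simps)
  have q: "\<bar>3 * y\<^sup>2 + 3 * (y * s) + s\<^sup>2\<bar> \<le> 6 * (y\<^sup>2 + d\<^sup>2)" if "s = d \<or> s = - d" for s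
  proof -
    have gen: "2 * r \<le> a + b \<Longrightarrow> - 2 * r \<le> a + b \<Longrightarrow> 0 \<le> a \<Longrightarrow> 0 \<le> b
        \<Longrightarrow> \<bar>3 * a + 3 * r + b\<bar> \<le> 6 * (a + b)" for a b r :: real
      by (rule abs_leI) simp_all
    have "\<bar>3 * y\<^sup>2 + 3 * (y * d) + d\<^sup>2\<bar> \<le> 6 * (y\<^sup>2 + d\<^sup>2)"
      "\<bar>3 * y\<^sup>2 + 3 * (- (y * d)) + d\<^sup>2\<bar> \<le> 6 * (y\<^sup>2 + d\<^sup>2)"
      by (rule gen; use 1 in \<open>simp only: zero_le_power2 mult_minus_right mult_minus_left minus_minus\<close>)+
    then show ?thesis using that by auto
  qed
  obtain s where s: "s = d \<or> s = - d" "y' = y + s" using assms(2) by auto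
  have "y' ^ 3 - y ^ 3 = s * (3 * y\<^sup>2 + 3 * (y * s) + s\<^sup>2)"
    unfolding s(2) by (simp add: power3_eq_cube power2_eq_square algebra_simps)
  then have "\<bar>y' ^ 3 - y ^ 3\<bar> = d * \<bar>3 * y\<^sup>2 + 3 * (y * s) + s\<^sup>2\<bar>"
    using s(1) assms(1) by (auto simp: abs_mult)
  also have "\<dots> \<le> d * (6 * (y\<^sup>2 + d\<^sup>2))"
    using assms(1) by (intro mult_left_mono q s(1))
  finally show ?thesis by (simp add: algebra_simps)
qed

locale beta_graph_sub = beta_graph +
  fixes S :: "nat set"
  assumes S_sub: "S \<subseteq> {..<n}" and eta_le: "b \<le> real n - 1"
begin

definition c :: "nat \<Rightarrow> real" where "c i = (if i \<in> S then 1 / V i else 0)"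
text \<open>The diagonal Newton step from \<open>beta\<close>; \<open>c\<close> is the inverse
  diagonal of the Fisher information on \<open>S\<close>.\<close>

definition x :: "nat \<Rightarrow> (nat \<times> nat \<Rightarrow> bool) \<Rightarrow> real" where "x i A = c i * xi i A"
definition X :: "nat \<times> nat \<Rightarrow> (nat \<times> nat \<Rightarrow> bool) \<Rightarrow> real" where "X e A = ends (\<lambda>i. x i A) e"
text \<open>The off-diagonal part of the Fisher information applied to \<open>x\<close>;
  \<open>Q\<close> is the corresponding quadratic form.\<close>

definition \<rho> :: "nat \<Rightarrow> (nat \<times> nat \<Rightarrow> bool) \<Rightarrow> real" where "\<rho> i A = (\<Sum>j<n. sy v i j * x j A)"
definition Q :: "(nat \<times> nat \<Rightarrow> bool) \<Rightarrow> real" where "Q A = (\<Sum>i<n. x i A * \<rho> i A)"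
definition K :: "(nat \<times> nat \<Rightarrow> bool) \<Rightarrow> real" where "K A = (\<Sum>e\<in>E. (X e A) ^ 4)"
text \<open>Equal to b n / (n - 1), hence between b and 2 b. It absorbs the factors n that come from
  summing \<open>eta\<close> over nodes.\<close>

definition B :: real where "B = real n * eta"

lemma eta_le_1: "eta \<le> 1"
  using eta_le n_ge by (simp add: eta_def)

lemma B_ge: "1 \<le> B"
proof -
  have "real n - 1 \<le> real n * b" using mult_mono[of 1 b "real n - 1" "real n"] b_ge n_ge by (simp add: mult.commute)
  then show ?thesis using n_ge by (simp add: B_def eta_def)
qed

lemma eta_le_B: "eta \<le> B"
  using eta_pos n_ge by (simp add: B_def)

lemma c_nonneg: "0 \<le> c i"
  using V_pos[of i] S_sub by (auto simp: c_def)

lemma c_le: "c i \<le> eta"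
  using V_ge[of i] V_pos[of i] S_sub eta_pos by (auto simp: c_def divide_le_eq mult.commute)

lemma V_c: "V i * c i = of_bool (i \<in> S)"
  using V_pos[of i] S_sub by (auto simp: c_def)

lemma V_c_square: "V i * (c i)\<^sup>2 = c i"
  using V_pos[of i] S_sub by (auto simp: c_def power2_eq_square)

lemma x_eq_lin: "i < n \<Longrightarrow> x i A = lin (\<lambda>e. c i * inc e i) A"
  by (simp add: x_def xi_eq_lin lin_def sum_distrib_left mult.assoc)

lemma sum_inc: "e \<in> E \<Longrightarrow> (\<Sum>i<n. inc e i * z i) = ends z e"
proof -
  assume e: "e \<in> E"
  have "(\<Sum>i<n. inc e i * z i) = (\<Sum>i\<in>{fst e, snd e}. z i)"
    using node_pairsD[OF e] by (intro sum.mono_neutral_cong_right) (auto simp: inc_def)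
  then show ?thesis using node_pairsD[OF e] by (simp add: ends_def)
qed

text \<open>The coefficient at an edge g is the sum of \<open>c\<close> over the nodes that g shares
  with \<open>e\<close>, so only edges meeting \<open>e\<close> contribute.\<close>

lemma X_eq_lin: "e \<in> E \<Longrightarrow> X e A = lin (ends (\<lambda>i. inc e i * c i)) A"
proof -
  assume e: "e \<in> E"
  have "X e A = (\<Sum>i<n. inc e i * (c i * xi i A))"
    unfolding sum_inc[OF e] by (simp add: X_def x_def)
  then show ?thesis by (simp add: sum_mult_xi[symmetric] mult.assoc)
qed

lemma var_X: "e \<in> E \<Longrightarrow> var (ends (\<lambda>i. inc e i * c i)) \<le> 4 * eta"
proof -
  assume e: "e \<in> E"
  have "var (ends (\<lambda>i. inc e i * c i)) \<le> 2 * (\<Sum>i<n. V i * (inc e i * c i)\<^sup>2)"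
    by (rule var_ends_le)
  also have "(\<Sum>i<n. V i * (inc e i * c i)\<^sup>2) = (\<Sum>i<n. inc e i * c i)"
  proof (intro sum.cong refl)
    fix i show "V i * (inc e i * c i)\<^sup>2 = inc e i * c i"
      using V_c_square[of i] by (cases "i = fst e \<or> i = snd e") (auto simp only: inc_def of_bool_def if_True if_False mult_1 mult_zero_left zero_power2 mult_zero_right)
  qed
  also have "\<dots> = c (fst e) + c (snd e)" by (simp add: sum_inc[OF e] ends_def)
  finally show ?thesis using c_le[of "fst e"] c_le[of "snd e"] by simp
qed

lemma ends_inc_c: "0 \<le> ends (\<lambda>i. inc e i * c i) g" "ends (\<lambda>i. inc e i * c i) g \<le> 2 * eta"
proof -
  have *: "0 \<le> inc e i * c i \<and> inc e i * c i \<le> eta" for i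
    using inc_range[of e i] c_nonneg[of i] c_le[of i] mult_mono[of "inc e i" 1 "c i" eta] by simp
  show "0 \<le> ends (\<lambda>i. inc e i * c i) g" "ends (\<lambda>i. inc e i * c i) g \<le> 2 * eta"
    using *[of "fst g"] *[of "snd g"] by (simp_all add: ends_def)
qed

text \<open>Absolute third moments would only give \<open>eta\<close> to the power 3/2. The extra
  half power keeps the mean of the cubic form at O(B^2).\<close>

lemma expec_X3: "e \<in> E \<Longrightarrow> \<bar>expec (\<lambda>A. (X e A) ^ 3)\<bar> \<le> 8 * eta\<^sup>2"
proof -
  assume e: "e \<in> E"
  have "\<bar>expec (\<lambda>A. (X e A) ^ 3)\<bar> \<le> 2 * eta * var (ends (\<lambda>i. inc e i * c i))"
    unfolding X_eq_lin[OF e] using ends_inc_c[of e] by (intro expec_lin_cube) (simp add: abs_le_iff)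
  also have "\<dots> \<le> 2 * eta * (4 * eta)"
    using var_X[OF e] eta_pos by (intro mult_left_mono) auto
  finally show ?thesis by (simp add: power2_eq_square)
qed

text \<open>The bound of \<open>expec_lin_fourth\<close> for variance \<open>s\<close> and
  coefficients up to \<open>2 * eta\<close>; 176 = 9 * 16 + 8 * 4, where \<open>eta <= 1\<close> is
  used once.\<close>

lemma fourth_moment_poly_le:
  assumes "0 \<le> s" "s \<le> 4 * eta"
  shows "9 * s\<^sup>2 + 2 * (2 * eta)\<^sup>2 * s \<le> 176 * eta\<^sup>2"
proof -
  have "s\<^sup>2 \<le> (4 * eta)\<^sup>2" using assms by (intro power_mono) auto
  moreover have "eta\<^sup>2 * s \<le> eta\<^sup>2 * 4"
    using assms eta_le_1 by (intro mult_left_mono) auto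
  ultimately show ?thesis by (simp add: power_mult_distrib)
qed

lemma expec_X4: "e \<in> E \<Longrightarrow> expec (\<lambda>A. (X e A) ^ 4) \<le> 176 * eta\<^sup>2"
proof -
  assume e: "e \<in> E"
  have "expec (\<lambda>A. (X e A) ^ 4)
      \<le> 9 * (var (ends (\<lambda>i. inc e i * c i)))\<^sup>2 + 2 * (2 * eta)\<^sup>2 * var (ends (\<lambda>i. inc e i * c i))"
    unfolding X_eq_lin[OF e] using ends_inc_c[of e] by (intro expec_lin_fourth) (simp add: abs_le_iff)
  also have "\<dots> \<le> 176 * eta\<^sup>2"
    using var_X[OF e] var_nonneg by (rule fourth_moment_poly_le[rotated])
  finally show ?thesis .
qed

lemma V_eq_inc: "i < n \<Longrightarrow> V i = (\<Sum>e\<in>E. v e * inc e i)"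
  by (simp add: V_def row_eq_inc)

lemma var_inc: "i < n \<Longrightarrow> var (\<lambda>e. r * inc e i) = r\<^sup>2 * V i"
proof -
  assume i: "i < n"
  have *: "v e * (r * inc e i)\<^sup>2 = r\<^sup>2 * (v e * inc e i)" for e
    by (simp add: inc_def)
  show ?thesis unfolding var_def V_eq_inc[OF i] sum_distrib_left * ..
qed

lemma expec_xi2: "i < n \<Longrightarrow> expec (\<lambda>A. (xi i A)\<^sup>2) = V i"
  using var_inc[of i 1] by (simp add: xi_eq_lin expec_lin_square)

lemma expec_x4: "i < n \<Longrightarrow> expec (\<lambda>A. (x i A) ^ 4) \<le> 176 * eta\<^sup>2"
proof -
  assume i: "i < n"
  have s: "var (\<lambda>e. c i * inc e i) = c i"
    unfolding var_inc[OF i] using V_c_square[of i] by (metis mult.commute)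
  have "expec (\<lambda>A. (x i A) ^ 4)
      \<le> 9 * (var (\<lambda>e. c i * inc e i))\<^sup>2 + 2 * (2 * eta)\<^sup>2 * var (\<lambda>e. c i * inc e i)"
    unfolding x_eq_lin[OF i]
  proof (rule expec_lin_fourth)
    fix e show "\<bar>c i * inc e i\<bar> \<le> 2 * eta"
      using c_nonneg[of i] c_le[of i] eta_pos by (auto simp: inc_def)
  qed
  also have "\<dots> \<le> 176 * eta\<^sup>2"
    unfolding s using c_nonneg[of i] c_le[of i] eta_pos by (intro fourth_moment_poly_le) auto
  finally show ?thesis .
qed

lemma expec_K: "expec K \<le> 88 * B\<^sup>2"
proof -
  have "expec K = (\<Sum>e\<in>E. expec (\<lambda>A. (X e A) ^ 4))"
    by (simp add: K_def[abs_def] expec_sum)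
  also have "\<dots> \<le> (real n)\<^sup>2 / 2 * (176 * eta\<^sup>2)"
    by (rule sum_E_le) (auto intro: expec_X4)
  finally show ?thesis by (simp add: B_def power_mult_distrib)
qed

lemma x_upd:
  assumes "e \<in> E" "i < n"
  shows "x i (A(e := y)) = x i A + (of_bool y - of_bool (A e)) * (c i * inc e i)"
  using assms by (simp add: x_eq_lin lin_upd)

lemma X_upd:
  assumes "e \<in> E" "f \<in> E"
  shows "X f (A(e := y)) = X f A + (of_bool y - of_bool (A e)) * ends (\<lambda>i. inc f i * c i) e"
  using assms by (simp add: X_eq_lin lin_upd)

section \<open>The off-diagonal quadratic form\<close>

lemma rho_eq_lin: "\<rho> i A = lin (ends (\<lambda>j. sy v i j * c j)) A"
  by (simp add: \<rho>_def x_def sum_mult_xi[symmetric] mult.assoc)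

lemma expec_rho2: "expec (\<lambda>A. (\<rho> i A)\<^sup>2) \<le> B"
proof -
  have "expec (\<lambda>A. (\<rho> i A)\<^sup>2) \<le> 2 * (\<Sum>j<n. V j * (sy v i j * c j)\<^sup>2)"
    unfolding rho_eq_lin expec_lin_square by (rule var_ends_le)
  also have "(\<Sum>j<n. V j * (sy v i j * c j)\<^sup>2) \<le> (\<Sum>j<n. (1/4)\<^sup>2 * eta)"
  proof (intro sum_mono)
    fix j
    have "V j * (sy v i j * c j)\<^sup>2 = (sy v i j)\<^sup>2 * c j"
      using V_c_square[of j] by (simp add: power_mult_distrib mult.left_commute)
    also have "\<dots> \<le> (1/4)\<^sup>2 * eta"
      using sy_v_range[of i j] c_nonneg[of j] c_le[of j] by (intro mult_mono power_mono) auto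
    finally show "V j * (sy v i j * c j)\<^sup>2 \<le> (1/4)\<^sup>2 * eta" .
  qed
  also have "2 * (\<Sum>j<n. (1/4)\<^sup>2 * eta) \<le> B" using eta_pos by (simp add: B_def power2_eq_square)
  finally show ?thesis by simp
qed

text \<open>By symmetry of the matrix, the difference of the form at two points factors as (x1 - x0)
  times (\<rho>1 + \<rho>0), and flipping \<open>e\<close> changes \<open>x\<close> only at the two
  ends of \<open>e\<close>.\<close>

lemma Q_diff:
  assumes e: "e \<in> E"
  shows "\<bar>D e Q A\<bar> \<le> ends (\<lambda>i. c i * (2 * \<bar>\<rho> i A\<bar> + eta / 2)) e"
proof -
  let ?A1 = "A(e := True)" and ?A0 = "A(e := False)"
  have sym: "(\<Sum>i<n. x i ?A1 * \<rho> i ?A0) = (\<Sum>i<n. x i ?A0 * \<rho> i ?A1)"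
  proof -
    have "(\<Sum>i<n. x i ?A1 * \<rho> i ?A0) = (\<Sum>i<n. \<Sum>j<n. sy v i j * x i ?A1 * x j ?A0)"
      by (simp add: \<rho>_def sum_distrib_left mult_ac)
    also have "\<dots> = (\<Sum>j<n. \<Sum>i<n. sy v i j * x i ?A1 * x j ?A0)" by (rule sum.swap)
    also have "\<dots> = (\<Sum>j<n. x j ?A0 * \<rho> j ?A1)"
      by (simp add: \<rho>_def sum_distrib_left mult_ac sy_commute)
    finally show ?thesis .
  qed
  have dx: "x i ?A1 - x i ?A0 = inc e i * c i" if "i < n" for i
    using e that by (simp add: x_upd)
  have "D e Q A = (\<Sum>i<n. (x i ?A1 - x i ?A0) * (\<rho> i ?A1 + \<rho> i ?A0))"
    using sym by (simp add: D_def Q_def algebra_simps sum.distrib sum_subtractf)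
  also have "\<dots> = (\<Sum>i<n. inc e i * (c i * (\<rho> i ?A1 + \<rho> i ?A0)))"
    by (intro sum.cong) (auto simp: dx)
  also have "\<dots> = ends (\<lambda>i. c i * (\<rho> i ?A1 + \<rho> i ?A0)) e"
    by (rule sum_inc[OF e])
  finally have D: "D e Q A = ends (\<lambda>i. c i * (\<rho> i ?A1 + \<rho> i ?A0)) e" .
  \<comment> \<open>One of the two configurations is \<open>A\<close> itself; in the other one
    \<open>\<rho> i\<close> has moved by at most \<open>eta / 2\<close>.\<close>
  have r: "\<bar>\<rho> i ?A1 + \<rho> i ?A0\<bar> \<le> 2 * \<bar>\<rho> i A\<bar> + eta / 2" for i
  proof -
    have *: "0 \<le> sy v i j * c j \<and> sy v i j * c j \<le> 1/4 * eta" for j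
      using mult_mono[of "sy v i j" "1/4" "c j" eta] sy_v_range[of i j] c_nonneg[of j] c_le[of j] eta_pos by simp
    have "0 \<le> ends (\<lambda>j. sy v i j * c j) e \<and> ends (\<lambda>j. sy v i j * c j) e \<le> eta / 2"
      using *[of "fst e"] *[of "snd e"] by (simp add: ends_def)
    then show ?thesis
      using e unfolding rho_eq_lin by (cases "A e") (auto simp: lin_upd)
  qed
  have "\<bar>D e Q A\<bar> \<le> \<bar>c (fst e) * (\<rho> (fst e) ?A1 + \<rho> (fst e) ?A0)\<bar> + \<bar>c (snd e) * (\<rho> (snd e) ?A1 + \<rho> (snd e) ?A0)\<bar>"
    unfolding D ends_def by (rule abs_triangle_ineq)
  also have "\<dots> \<le> ends (\<lambda>i. c i * (2 * \<bar>\<rho> i A\<bar> + eta / 2)) e"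
    unfolding ends_def abs_mult using c_nonneg
    by (intro add_mono mult_mono r) auto
  finally show ?thesis .
qed

lemma expec_abs_le_B:
  assumes "expec (\<lambda>A. (f A)\<^sup>2) \<le> k * B ^ 4"
  shows "expec (\<lambda>A. \<bar>f A\<bar>) \<le> (k + 1) / 2 * B\<^sup>2"
proof -
  have B: "0 < B\<^sup>2" using B_ge by simp
  have "expec (\<lambda>A. \<bar>f A\<bar>) \<le> expec (\<lambda>A. (f A)\<^sup>2) / (2 * B\<^sup>2) + B\<^sup>2 / 2"
    by (rule expec_abs_le[OF B])
  also have "\<dots> \<le> k * B ^ 4 / (2 * B\<^sup>2) + B\<^sup>2 / 2"
    using assms B by (intro add_mono divide_right_mono) auto
  also have "k * B ^ 4 / (2 * B\<^sup>2) = k / 2 * B\<^sup>2"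
    using B_ge by (simp add: field_simps power2_eq_square power4_eq_xxxx)
  finally show ?thesis by (simp add: algebra_simps)
qed

lemma B2_le_B4: "B\<^sup>2 \<le> B ^ 4"
  using B_ge by (intro power_increasing) auto

text \<open>The degrees of two nodes are correlated only through the edge joining them, so the mean
  is a sum of terms c c v^2 and at most B^2. The fluctuation is controlled by Efron-Stein, where
  \<open>Q_diff\<close> leads back to second moments of \<rho>.\<close>

lemma expec_Q: "expec (\<lambda>A. \<bar>Q A\<bar>) \<le> 18 * B\<^sup>2"
proof -
  have xx: "expec (\<lambda>A. x (fst e) A * x (snd e) A) = c (fst e) * c (snd e) * v e" if e: "e \<in> E" for e
  proof -
    have *: "g = e" if "g \<in> E" "inc g (fst e) * inc g (snd e) \<noteq> 0" for g
    proof -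
      have "fst e = fst g \<or> fst e = snd g" "snd e = fst g \<or> snd e = snd g"
        using that(2) unfolding inc_def of_bool_def by (auto split: if_splits)
      then show ?thesis
        using node_pairsD[OF e] node_pairsD[OF that(1)] by (auto simp: prod_eq_iff)
    qed
    have "expec (\<lambda>A. x (fst e) A * x (snd e) A)
        = (\<Sum>g\<in>E. v g * (c (fst e) * inc g (fst e)) * (c (snd e) * inc g (snd e)))"
      using node_pairsD[OF e] by (simp add: x_eq_lin expec_lin_lin)
    also have "\<dots> = (\<Sum>g\<in>{e}. v g * (c (fst e) * inc g (fst e)) * (c (snd e) * inc g (snd e)))"
      using e * by (intro sum.mono_neutral_right) (auto simp: finite_node_pairs)
    finally show ?thesis by (simp add: inc_def)
  qed
  have Q: "Q A = (\<Sum>e\<in>E. v e * (2 * (x (fst e) A * x (snd e) A)))" for A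
  proof -
    have "Q A = (\<Sum>i<n. \<Sum>j<n. sy v i j * (x i A * x j A))"
      by (simp add: Q_def \<rho>_def sum_distrib_left mult_ac)
    then show ?thesis unfolding sum_sy_eq by (simp add: mult.commute)
  qed
  have "expec Q = (\<Sum>e\<in>E. v e * (2 * (c (fst e) * c (snd e) * v e)))"
    unfolding Q[abs_def] by (simp add: expec_linear xx)
  moreover have "0 \<le> v e * (2 * (c (fst e) * c (snd e) * v e))" for e
    using v_pos[of e] c_nonneg by simp
  moreover have "v e * (2 * (c (fst e) * c (snd e) * v e)) \<le> 1/4 * (2 * (eta * eta * (1/4)))" for e
  proof -
    have cc: "c (fst e) * c (snd e) \<le> eta * eta"
      using c_nonneg c_le eta_pos by (intro mult_mono) auto
    have "c (fst e) * c (snd e) * v e \<le> eta * eta * (1/4)"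
      by (rule mult_mono[OF cc v_le_quarter]) (use v_pos[of e] eta_pos in auto)
    then show ?thesis
      using v_pos[of e] c_nonneg by (intro mult_mono[OF v_le_quarter]) auto
  qed
  ultimately have "0 \<le> expec Q" "expec Q \<le> (real n)\<^sup>2 / 2 * (1/4 * (2 * (eta * eta * (1/4))))"
    using eta_pos by (simp_all only: sum_nonneg) (rule sum_E_le, auto)
  moreover have "(real n)\<^sup>2 / 2 * (1/4 * (2 * (eta * eta * (1/4)))) \<le> B\<^sup>2"
    by (simp add: B_def power2_eq_square)
  ultimately have EQ: "(expec Q)\<^sup>2 \<le> B ^ 4"
    using power_mono[of "expec Q" "B\<^sup>2" 2] by simp
  have "(D e Q A)\<^sup>2 \<le> 4 * ends (\<lambda>i. (c i)\<^sup>2 * (8 * (\<rho> i A)\<^sup>2 + eta\<^sup>2 / 2)) e" if e: "e \<in> E" for e A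
  proof -
    have "(D e Q A)\<^sup>2 \<le> (ends (\<lambda>i. c i * (2 * \<bar>\<rho> i A\<bar> + eta / 2)) e)\<^sup>2"
      using Q_diff[OF e, of A] by (intro power2_le_iff_abs_le[THEN iffD2]) auto
    also have "\<dots> \<le> 2 * ends (\<lambda>i. (c i * (2 * \<bar>\<rho> i A\<bar> + eta / 2))\<^sup>2) e"
      by (rule ends_square_le)
    also have "\<dots> \<le> 4 * ends (\<lambda>i. (c i)\<^sup>2 * (8 * (\<rho> i A)\<^sup>2 + eta\<^sup>2 / 2)) e"
    proof -
      have "(c i * (2 * \<bar>\<rho> i A\<bar> + eta / 2))\<^sup>2 \<le> 2 * ((c i)\<^sup>2 * (8 * (\<rho> i A)\<^sup>2 + eta\<^sup>2 / 2))" for i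
      proof -
        have "(2 * \<bar>\<rho> i A\<bar> + eta / 2)\<^sup>2 \<le> 8 * (\<rho> i A)\<^sup>2 + eta\<^sup>2 / 2"
          using power2_sum_le[of "2 * \<bar>\<rho> i A\<bar>" "eta / 2"]
          by (simp add: power_mult_distrib power_divide)
        also have "\<dots> \<le> 2 * (8 * (\<rho> i A)\<^sup>2 + eta\<^sup>2 / 2)" by simp
        finally have "(2 * \<bar>\<rho> i A\<bar> + eta / 2)\<^sup>2 \<le> 2 * (8 * (\<rho> i A)\<^sup>2 + eta\<^sup>2 / 2)" .
        from mult_left_mono[OF this, of "(c i)\<^sup>2"] show ?thesis
          unfolding power_mult_distrib by (simp add: distrib_left)
      qed
      from this[of "fst e"] this[of "snd e"] show ?thesis by (simp add: ends_def)
    qed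
    finally show ?thesis .
  qed
  note DQ = this
  have "expec (\<lambda>A. (D e Q A)\<^sup>2) \<le> 4 * ends (\<lambda>i. (c i)\<^sup>2 * (8 * B + eta\<^sup>2 / 2)) e" if e: "e \<in> E" for e
  proof -
    have "expec (\<lambda>A. (D e Q A)\<^sup>2) \<le> expec (\<lambda>A. 4 * ends (\<lambda>i. (c i)\<^sup>2 * (8 * (\<rho> i A)\<^sup>2 + eta\<^sup>2 / 2)) e)"
      by (intro expec_mono DQ e)
    also have "\<dots> = 4 * ends (\<lambda>i. (c i)\<^sup>2 * (8 * expec (\<lambda>A. (\<rho> i A)\<^sup>2) + eta\<^sup>2 / 2)) e"
      by (simp add: ends_def expec_linear)
    also have "\<dots> \<le> 4 * ends (\<lambda>i. (c i)\<^sup>2 * (8 * B + eta\<^sup>2 / 2)) e"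
      unfolding ends_def by (intro mult_left_mono add_mono expec_rho2) auto
    finally show ?thesis .
  qed
  then have "(\<Sum>e\<in>E. v e * expec (\<lambda>A. (D e Q A)\<^sup>2))
      \<le> (\<Sum>e\<in>E. v e * (4 * ends (\<lambda>i. (c i)\<^sup>2 * (8 * B + eta\<^sup>2 / 2)) e))"
    by (intro sum_mono mult_left_mono v_nonneg) auto
  also have "\<dots> = 4 * (\<Sum>e\<in>E. v e * ends (\<lambda>i. (c i)\<^sup>2 * (8 * B + eta\<^sup>2 / 2)) e)"
    by (simp add: sum_distrib_left mult.left_commute)
  \<comment> \<open>Since \<open>V i\<close> times the square of \<open>c i\<close> is
    \<open>c i\<close>, the node variance uses up one factor \<open>c\<close>. The sum of the
    remaining one over n nodes is at most n \<open>eta\<close>, that is \<open>B\<close>.\<close>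
  also have "\<dots> = 4 * (\<Sum>i<n. c i * (8 * B + eta\<^sup>2 / 2))"
    unfolding sum_v_ends by (simp add: mult.assoc[symmetric] V_c_square)
  also have "\<dots> \<le> 4 * (\<Sum>i<n. eta * (8 * B + eta\<^sup>2 / 2))"
    using B_ge by (intro mult_left_mono sum_mono mult_right_mono c_le) auto
  also have "\<dots> = 4 * (B * (8 * B + eta\<^sup>2 / 2))"
    by (simp add: B_def)
  also have "\<dots> \<le> 34 * B\<^sup>2"
  proof -
    have "eta\<^sup>2 \<le> 1 * B" unfolding power2_eq_square
      using eta_pos eta_le_1 eta_le_B by (intro mult_mono) auto
    then have "B * (8 * B + eta\<^sup>2 / 2) \<le> B * (8 * B + B / 2)"
      using B_ge by (intro mult_left_mono) auto
    then show ?thesis by (simp add: power2_eq_square)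
  qed
  \<comment> \<open>34 from the variance and 1 from the squared mean; then (35 + 1) / 2 =
    18.\<close>
  finally have "expec (\<lambda>A. (Q A)\<^sup>2) \<le> 35 * B ^ 4"
    using efron_stein[of Q] EQ B2_le_B4 by simp
  from expec_abs_le_B[OF this] show ?thesis by simp
qed

section \<open>The cubic form\<close>

definition C :: "(nat \<times> nat \<Rightarrow> real) \<Rightarrow> (nat \<times> nat \<Rightarrow> bool) \<Rightarrow> real" where
  "C w A = (\<Sum>e\<in>E. w e * (X e A) ^ 3)"

text \<open>The sensitivity of the cubic form at node \<open>i\<close>. The term
  \<open>4 * eta^2\<close> is the square of the largest possible jump of some
  \<open>X f\<close>.\<close>

definition R :: "nat \<Rightarrow> (nat \<times> nat \<Rightarrow> bool) \<Rightarrow> real" where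
  "R i A = (\<Sum>f\<in>E. v f * inc f i * ((X f A)\<^sup>2 + 4 * eta\<^sup>2))"

text \<open>Flipping \<open>e\<close> changes \<open>X f\<close> only when f meets \<open>e\<close>,
  by the sum of \<open>c\<close> over the shared nodes. Grouping the edges f by shared node produces
  \<open>R\<close> at the two ends of \<open>e\<close>.\<close>

lemma C_diff:
  assumes e: "e \<in> E" and w: "\<And>f. f \<in> E \<Longrightarrow> \<bar>w f\<bar> \<le> v f"
  shows "\<bar>D e (C w) A\<bar> \<le> 6 * ends (\<lambda>i. c i * R i A) e"
proof -
  define d where "d f = ends (\<lambda>i. inc f i * c i) e" for f
  have d: "0 \<le> d f" "d f \<le> 2 * eta" for f
    using ends_inc_c[of f e] by (simp_all add: d_def)
  have "D e (C w) A = (\<Sum>f\<in>E. w f * ((X f (A(e := True))) ^ 3 - (X f (A(e := False))) ^ 3))"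
    by (simp add: D_def C_def sum_subtractf algebra_simps)
  also have "\<bar>\<dots>\<bar> \<le> (\<Sum>f\<in>E. v f * (6 * d f * ((X f A)\<^sup>2 + 4 * eta\<^sup>2)))"
  proof (rule order_trans[OF sum_abs sum_mono])
    fix f assume f: "f \<in> E"
    have "\<bar>(X f (A(e := True))) ^ 3 - (X f (A(e := False))) ^ 3\<bar> \<le> 6 * d f * ((X f A)\<^sup>2 + (d f)\<^sup>2)"
    proof (cases "A e")
      case True
      then have "A(e := True) = A" by (simp add: fun_upd_idem)
      moreover have "X f (A(e := False)) = X f A - d f"
        using e f True by (simp add: X_upd d_def)
      ultimately show ?thesis
        using cube_diff[OF d(1), of "X f (A(e := False))" "X f A" f] by (simp add: abs_minus_commute)
    next
      case False
      then have "A(e := False) = A" by (simp add: fun_upd_idem)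
      moreover have "X f (A(e := True)) = X f A + d f"
        using e f False by (simp add: X_upd d_def)
      ultimately show ?thesis
        using cube_diff[OF d(1), of "X f (A(e := True))" "X f A" f] by simp
    qed
    also have "\<dots> \<le> 6 * d f * ((X f A)\<^sup>2 + 4 * eta\<^sup>2)"
      using d[of f] power_mono[OF d(2) d(1), of f 2] by (intro mult_left_mono add_mono) auto
    finally show "\<bar>w f * ((X f (A(e := True))) ^ 3 - (X f (A(e := False))) ^ 3)\<bar>
        \<le> v f * (6 * d f * ((X f A)\<^sup>2 + 4 * eta\<^sup>2))"
      unfolding abs_mult using w[OF f] by (intro mult_mono) auto
  qed
  also have "\<dots> = (\<Sum>f\<in>E. 6 * (c (fst e) * (v f * inc f (fst e) * ((X f A)\<^sup>2 + 4 * eta\<^sup>2))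
      + c (snd e) * (v f * inc f (snd e) * ((X f A)\<^sup>2 + 4 * eta\<^sup>2))))"
    by (intro sum.cong) (simp_all add: d_def ends_def algebra_simps)
  also have "\<dots> = 6 * ends (\<lambda>i. c i * R i A) e"
    by (simp add: ends_def R_def sum_distrib_left sum.distrib distrib_left)
  finally show ?thesis .
qed

text \<open>Cauchy-Schwarz with weights \<open>v f * inc f i\<close>: their total is
  \<open>V i\<close>, which cancels \<open>c i\<close>. Summing over nodes then counts each edge
  twice and leaves the quartic sum \<open>K\<close>.\<close>

lemma sum_c_R_le: "(\<Sum>i<n. c i * (R i A)\<^sup>2) \<le> K A + 8 * B\<^sup>2"
proof -
  have "c i * (R i A)\<^sup>2 \<le> row n (\<lambda>f. v f * ((X f A)\<^sup>2 + 4 * eta\<^sup>2)\<^sup>2) i" (is "_ \<le> ?r") if i: "i < n" for i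
  proof -
    have r: "?r = (\<Sum>f\<in>E. v f * inc f i * ((X f A)\<^sup>2 + 4 * eta\<^sup>2)\<^sup>2)"
      using i by (simp add: row_eq_inc mult_ac)
    have r0: "0 \<le> ?r" unfolding r using inc_range v_nonneg by (intro sum_nonneg mult_nonneg_nonneg) auto
    have "(R i A)\<^sup>2 \<le> (\<Sum>f\<in>E. v f * inc f i) * (\<Sum>f\<in>E. v f * inc f i * ((X f A)\<^sup>2 + 4 * eta\<^sup>2)\<^sup>2)"
      unfolding R_def using inc_range v_nonneg by (intro weighted_cauchy_schwarz mult_nonneg_nonneg) auto
    then have "(R i A)\<^sup>2 \<le> V i * ?r"
      unfolding r by (simp add: V_eq_inc[OF i])
    then have "c i * (R i A)\<^sup>2 \<le> c i * (V i * ?r)"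
      by (intro mult_left_mono c_nonneg)
    also have "\<dots> = of_bool (i \<in> S) * ?r" using V_c[of i] by (simp add: mult_ac)
    also have "\<dots> \<le> ?r" using r0 by simp
    finally show ?thesis .
  qed
  then have "(\<Sum>i<n. c i * (R i A)\<^sup>2) \<le> (\<Sum>i<n. row n (\<lambda>f. v f * ((X f A)\<^sup>2 + 4 * eta\<^sup>2)\<^sup>2) i)"
    by (intro sum_mono) auto
  also have "\<dots> = 2 * (\<Sum>f\<in>E. v f * ((X f A)\<^sup>2 + 4 * eta\<^sup>2)\<^sup>2)" by (rule sum_row)
  also have "\<dots> \<le> 2 * (\<Sum>f\<in>E. (1/4) * (2 * ((X f A) ^ 4 + 16 * eta\<^sup>2)))"
  proof (intro mult_left_mono sum_mono mult_mono v_le_quarter)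
    fix f
    have "eta ^ 4 \<le> eta\<^sup>2" using eta_pos eta_le_1 by (intro power_decreasing) auto
    then have "(4 * eta\<^sup>2)\<^sup>2 \<le> 16 * eta\<^sup>2" by (simp add: power_mult_distrib)
    then show "((X f A)\<^sup>2 + 4 * eta\<^sup>2)\<^sup>2 \<le> 2 * ((X f A) ^ 4 + 16 * eta\<^sup>2)"
      using power2_sum_le[of "(X f A)\<^sup>2" "4 * eta\<^sup>2"] by simp
  qed auto
  also have "\<dots> = K A + real (card E) * (16 * eta\<^sup>2)"
    by (simp add: K_def sum.distrib add_divide_distrib sum_divide_distrib[symmetric] sum_distrib_left[symmetric])
  also have "real (card E) * (16 * eta\<^sup>2) \<le> (real n)\<^sup>2 / 2 * (16 * eta\<^sup>2)"
    by (intro mult_right_mono card_node_pairs_le) auto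
  finally show ?thesis by (simp add: B_def power_mult_distrib)
qed

text \<open>As for \<open>Q\<close>: third moments bound the mean, while \<open>C_diff\<close> and
  \<open>sum_c_R_le\<close> reduce the variance to the mean of \<open>K\<close>. Here 72 = 2 * 6^2
  and 6912 = 72 * (88 + 8).\<close>

lemma expec_C:
  assumes w: "\<And>f. f \<in> E \<Longrightarrow> \<bar>w f\<bar> \<le> v f"
  shows "expec (\<lambda>A. \<bar>C w A\<bar>) \<le> 3500 * B\<^sup>2"
proof -
  have "\<bar>expec (C w)\<bar> = \<bar>\<Sum>e\<in>E. w e * expec (\<lambda>A. (X e A) ^ 3)\<bar>"
    by (simp add: C_def[abs_def] expec_linear)
  also have "\<dots> \<le> (\<Sum>e\<in>E. \<bar>w e * expec (\<lambda>A. (X e A) ^ 3)\<bar>)" by (rule sum_abs)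
  also have "\<dots> \<le> (real n)\<^sup>2 / 2 * (1/4 * (8 * eta\<^sup>2))"
  proof (rule sum_E_le)
    fix e assume e: "e \<in> E"
    have "\<bar>w e\<bar> \<le> 1/4" using w[OF e] v_le_quarter[of e] by simp
    then show "\<bar>w e * expec (\<lambda>A. (X e A) ^ 3)\<bar> \<le> 1/4 * (8 * eta\<^sup>2)"
      unfolding abs_mult using expec_X3[OF e] by (intro mult_mono) auto
  qed simp
  also have "\<dots> = B\<^sup>2" by (simp add: B_def power_mult_distrib)
  finally have EC: "(expec (C w))\<^sup>2 \<le> B ^ 4"
    using power_mono[of "\<bar>expec (C w)\<bar>" "B\<^sup>2" 2] by simp
  have DC: "(D e (C w) A)\<^sup>2 \<le> 72 * ends (\<lambda>i. (c i * R i A)\<^sup>2) e" if e: "e \<in> E" for e A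
  proof -
    have "(D e (C w) A)\<^sup>2 \<le> (6 * ends (\<lambda>i. c i * R i A) e)\<^sup>2"
      using C_diff[OF e w, of A] by (intro power2_le_iff_abs_le[THEN iffD2]) auto
    then show ?thesis using ends_square_le[of "\<lambda>i. c i * R i A" e] by (simp add: power_mult_distrib)
  qed
  have "(\<Sum>e\<in>E. v e * expec (\<lambda>A. (D e (C w) A)\<^sup>2)) = expec (\<lambda>A. \<Sum>e\<in>E. v e * (D e (C w) A)\<^sup>2)"
    by (simp add: expec_linear)
  also have "\<dots> \<le> expec (\<lambda>A. 72 * (K A + 8 * B\<^sup>2))"
  proof (rule expec_mono)
    fix A
    have "(\<Sum>e\<in>E. v e * (D e (C w) A)\<^sup>2) \<le> (\<Sum>e\<in>E. v e * (72 * ends (\<lambda>i. (c i * R i A)\<^sup>2) e))"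
      by (intro sum_mono mult_left_mono DC v_nonneg)
    also have "\<dots> = 72 * (\<Sum>e\<in>E. v e * ends (\<lambda>i. (c i * R i A)\<^sup>2) e)"
      by (simp add: sum_distrib_left mult.left_commute)
    also have "\<dots> = 72 * (\<Sum>i<n. c i * (R i A)\<^sup>2)"
      unfolding sum_v_ends by (simp add: power_mult_distrib mult.assoc[symmetric] V_c_square)
    also have "\<dots> \<le> 72 * (K A + 8 * B\<^sup>2)" using sum_c_R_le[of A] by simp
    finally show "(\<Sum>e\<in>E. v e * (D e (C w) A)\<^sup>2) \<le> 72 * (K A + 8 * B\<^sup>2)" .
  qed
  also have "\<dots> \<le> 6912 * B\<^sup>2" using expec_K by (simp add: expec_linear)
  finally have "expec (\<lambda>A. (C w A)\<^sup>2) \<le> 6913 * B ^ 4"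
    using efron_stein[of "C w"] EC B2_le_B4 by simp
  from expec_abs_le_B[OF this] have "expec (\<lambda>A. \<bar>C w A\<bar>) \<le> (6913 + 1) / 2 * B\<^sup>2" .
  also have "\<dots> \<le> 3500 * B\<^sup>2" by (intro mult_right_mono) auto
  finally show ?thesis .
qed

definition N :: "(nat \<times> nat \<Rightarrow> bool) \<Rightarrow> real" where "N A = (\<Sum>i<n. c i * (xi i A)\<^sup>2)"

lemma sum_V_x_square: "(\<Sum>i<n. V i * (x i A)\<^sup>2) = N A"
  by (simp add: x_def power_mult_distrib mult.assoc[symmetric] V_c_square N_def)

text \<open>The origin of the dual array: on \<open>S\<close> one has
  \<open>V i * x i A = xi i A\<close>, so the row sums of v X are those of the data up to the error
  \<open>\<rho> i A\<close>.\<close>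

lemma row_v_X: "row n (\<lambda>e. v e * X e A) i = V i * x i A + \<rho> i A"
proof -
  have "sy (\<lambda>e. v e * X e A) i j = sy v i j * x i A + sy v i j * x j A" for j
    by (auto simp: sy_def X_def ends_def min_def max_def algebra_simps)
  then show ?thesis by (simp add: row_def V_def \<rho>_def sum.distrib sum_distrib_right)
qed

text \<open>The full Fisher information evaluated at \<open>x\<close>, split into its diagonal and
  off-diagonal parts.\<close>

lemma sum_v_X_square: "(\<Sum>e\<in>E. v e * (X e A)\<^sup>2) = N A + Q A"
proof -
  have "(\<Sum>e\<in>E. v e * (X e A)\<^sup>2) = (\<Sum>e\<in>E. (v e * X e A) * ends (\<lambda>i. x i A) e)"
    by (simp add: X_def power2_eq_square mult.assoc)
  also have "\<dots> = (\<Sum>i<n. x i A * row n (\<lambda>e. v e * X e A) i)"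
    by (rule sum_mult_row[symmetric])
  also have "\<dots> = (\<Sum>i<n. V i * (x i A)\<^sup>2) + Q A"
    by (simp add: row_v_X Q_def sum.distrib[symmetric] power2_eq_square algebra_simps)
  finally show ?thesis by (simp add: sum_V_x_square)
qed

end

section \<open>The cumulant generating function of a Bernoulli variable and its conjugate\<close>

definition cgf :: "real \<Rightarrow> real \<Rightarrow> real" where
  "cgf p t = ln (1 - p + p * exp t) - p * t"

lemma cgf_taylor:
  assumes p: "0 < p" "p < 1"
  shows "\<bar>cgf p t - p * (1 - p) * (t\<^sup>2 / 2 + (1 - 2 * p) * t ^ 3 / 6)\<bar> \<le> t ^ 4"
proof -
  \<comment> \<open>The success probability after exponential tilting by \<open>t\<close>. As s' = s
    (1 - s), all higher derivatives of the cumulant generating function are polynomials in it,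
    bounded for every \<open>t\<close>.\<close>
  define s where "s t = p * exp t / (1 - p + p * exp t)" for t
  have pos: "0 < 1 - p + p * exp t" for t
    using p by (simp add: add_pos_pos)
  have s: "0 < s t" "s t < 1" for t
    using p pos[of t] by (simp_all add: s_def)
  have s0: "s 0 = p" by (simp add: s_def)
  have ds: "(s has_real_derivative s t * (1 - s t)) (at t)" for t
    unfolding s_def[abs_def] using pos[of t]
    by (auto intro!: derivative_eq_intros simp: divide_simps power2_eq_square) (simp add: algebra_simps)
  define diff where "diff m = (if m = 0 then cgf p else if m = 1 then (\<lambda>t. s t - p)
      else if m = 2 then (\<lambda>t. s t * (1 - s t)) else if m = 3 then (\<lambda>t. s t * (1 - s t) * (1 - 2 * s t))
      else (\<lambda>t. s t * (1 - s t) * (1 - 6 * s t + 6 * (s t)\<^sup>2)))" for m :: nat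
  have d0: "(cgf p has_real_derivative s t - p) (at t)" for t
    unfolding cgf_def[abs_def] s_def using pos[of t] by (auto intro!: derivative_eq_intros)
  have d1: "((\<lambda>t. s t - p) has_real_derivative s t * (1 - s t)) (at t)" for t
    by (auto intro!: derivative_eq_intros ds)
  have d2: "((\<lambda>t. s t * (1 - s t)) has_real_derivative s t * (1 - s t) * (1 - 2 * s t)) (at t)" for t
    by (auto intro!: derivative_eq_intros ds simp: algebra_simps)
  have d3: "((\<lambda>t. s t * (1 - s t) * (1 - 2 * s t)) has_real_derivative
      s t * (1 - s t) * (1 - 6 * s t + 6 * (s t)\<^sup>2)) (at t)" for t
    by (auto intro!: derivative_eq_intros ds simp: algebra_simps power2_eq_square)
  have "\<forall>m u. m < 4 \<and> \<bar>u\<bar> \<le> \<bar>t\<bar> \<longrightarrow> (diff m has_real_derivative diff (Suc m) u) (at u)"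
  proof (intro allI impI)
    fix m :: nat and u assume "m < 4 \<and> \<bar>u\<bar> \<le> \<bar>t\<bar>"
    then consider "m = 0" | "m = 1" | "m = 2" | "m = 3" by linarith
    then show "(diff m has_real_derivative diff (Suc m) u) (at u)"
      using d0 d1 d2 d3 by cases (simp_all add: diff_def)
  qed
  from Maclaurin_bi_le[OF _ this, of "cgf p"] obtain u where
    "cgf p t = (\<Sum>m<4. diff m 0 / fact m * t ^ m) + diff 4 u / fact 4 * t ^ 4"
    by (auto simp: diff_def)
  moreover have "(\<Sum>m<4. diff m 0 / fact m * t ^ m) = p * (1 - p) * (t\<^sup>2 / 2 + (1 - 2 * p) * t ^ 3 / 6)"
    by (simp add: numeral_eq_Suc diff_def cgf_def s0) (simp add: algebra_simps)
  ultimately have eq: "cgf p t - p * (1 - p) * (t\<^sup>2 / 2 + (1 - 2 * p) * t ^ 3 / 6) = diff 4 u / 24 * t ^ 4"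
    by (simp add: fact_numeral)
  have "\<bar>diff 4 u\<bar> \<le> 1"
  proof -
    have "\<bar>s u * (1 - s u)\<bar> \<le> 1"
      using s[of u] mult_mono[of "s u" 1 "1 - s u" 1] by (simp add: abs_mult)
    moreover have "0 \<le> s u * (1 - s u)" "s u * (1 - s u) \<le> 1/4"
      using s[of u] zero_le_power2[of "s u - 1/2"] by (simp_all add: power2_eq_square algebra_simps)
    then have "\<bar>1 - 6 * s u + 6 * (s u)\<^sup>2\<bar> \<le> 1"
      by (simp add: abs_le_iff power2_eq_square algebra_simps)
    ultimately show ?thesis
      unfolding diff_def abs_mult[of "s u * (1 - s u)"] by (simp add: mult_le_one abs_mult)
  qed
  then have "\<bar>diff 4 u / 24 * t ^ 4\<bar> \<le> 1 * t ^ 4"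
    unfolding abs_mult by (intro mult_mono) auto
  then show ?thesis unfolding eq by simp
qed

text \<open>The difference of the two sides has derivative y^3 / (1 + y), which has the sign of y,
  so its minimum is at 0.\<close>

lemma ln_add_one_le_cubic:
  fixes u :: real
  assumes "- 1 < u"
  shows "ln (1 + u) \<le> u - u\<^sup>2 / 2 + u ^ 3 / 3"
proof -
  define f where "f u = u - u\<^sup>2 / 2 + u ^ 3 / 3 - ln (1 + u)" for u :: real
  have df: "(f has_real_derivative y ^ 3 / (1 + y)) (at y)" if "- 1 < y" for y
    unfolding f_def[abs_def] using that
    by (auto intro!: derivative_eq_intros simp: field_simps power2_eq_square power3_eq_cube)
  have "f 0 \<le> f u"
  proof (cases "0 \<le> u")
    case True
    show ?thesis
    proof (rule DERIV_nonneg_imp_nondecreasing[OF True])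
      fix y assume "0 \<le> y" "y \<le> u"
      then show "\<exists>d. (f has_real_derivative d) (at y) \<and> 0 \<le> d"
        using df[of y] by (intro exI[of _ "y ^ 3 / (1 + y)"]) auto
    qed
  next
    case False
    show ?thesis
    proof (rule DERIV_nonpos_imp_nonincreasing[of u 0])
      fix y assume "u \<le> y" "y \<le> 0"
      then show "\<exists>d. (f has_real_derivative d) (at y) \<and> d \<le> 0"
        using assms df[of y]
        by (intro exI[of _ "y ^ 3 / (1 + y)"])
          (auto intro!: divide_nonpos_pos simp: power3_eq_cube mult_nonneg_nonpos zero_le_square)
    qed (use False in auto)
  qed
  then show ?thesis by (simp add: f_def)
qed

text \<open>Fenchel's inequality for the cumulant generating function, whose conjugate at \<open>v w\<close> is the
  Kullback-Leibler divergence of the Bernoulli distribution with parameter \<open>p + v w\<close>.\<close>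
lemma cgf_dual_le:
  assumes p: "0 < p" "p < 1" and w: "\<bar>w\<bar> \<le> 1"
  defines "v \<equiv> p * (1 - p)"
  shows "v * w * t - cgf p t \<le> v * (w\<^sup>2 / 2 - (1 - 2 * p) * w ^ 3 / 6 + w ^ 4 / 3)"
proof -
  define q where "q = 1 - p"
  have q: "0 < q" "q < 1" "p + q = 1" using p by (auto simp: q_def)
  define Z where "Z = q + p * exp t"
  have Z: "0 < Z" using p q by (simp add: Z_def add_pos_pos)
  have qw: "\<bar>q * w\<bar> < 1" "\<bar>p * w\<bar> < 1"
    using p q w order_le_less_trans[OF mult_left_mono[of "\<bar>w\<bar>" 1 q], of 1]
      order_le_less_trans[OF mult_left_mono[of "\<bar>w\<bar>" 1 p], of 1] by (simp_all add: abs_mult)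
  have pos: "0 < 1 + q * w" "0 < 1 - p * w" using qw by auto
  have th: "p + v * w = p * (1 + q * w)" "1 - (p + v * w) = q * (1 - p * w)"
    by (simp_all add: v_def q_def algebra_simps)
  have th0: "0 \<le> p + v * w" unfolding th(1) using p pos by simp
  have th1: "0 \<le> 1 - (p + v * w)" unfolding th(2) using q pos by simp
  \<comment> \<open>Gibbs' inequality: ln z <= z - 1 is applied, at both outcomes, to the ratio of
    the tilted probability to the one with parameter p + v w. The weighted right-hand sides add up
    to zero because the tilted probabilities add up to one.\<close>
  have "t - ln (1 + q * w) - ln Z = ln (exp t / ((1 + q * w) * Z))"
    using pos Z by (simp add: ln_div ln_mult)
  also have "\<dots> \<le> exp t / ((1 + q * w) * Z) - 1"
    using pos Z by (intro ln_le_minus_one) auto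
  finally have "t - ln (1 + q * w) - ln Z \<le> exp t / ((1 + q * w) * Z) - 1" .
  moreover have "- ln (1 - p * w) - ln Z = ln (1 / ((1 - p * w) * Z))"
    using pos Z by (simp add: ln_div ln_mult)
  moreover have "\<dots> \<le> 1 / ((1 - p * w) * Z) - 1"
    using pos Z by (intro ln_le_minus_one) auto
  ultimately have "(p + v * w) * (t - ln (1 + q * w) - ln Z) + (1 - (p + v * w)) * (- ln (1 - p * w) - ln Z)
     \<le> (p + v * w) * (exp t / ((1 + q * w) * Z) - 1) + (1 - (p + v * w)) * (1 / ((1 - p * w) * Z) - 1)"
    using th0 th1 by (intro add_mono mult_left_mono) auto
  also have "\<dots> = (p + v * w) * (exp t / ((1 + q * w) * Z)) + (1 - (p + v * w)) * (1 / ((1 - p * w) * Z)) - 1"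
    by (simp add: algebra_simps)
  also have "\<dots> = p * exp t / Z + q / Z - 1"
  proof -
    have "(p + v * w) * (exp t / ((1 + q * w) * Z)) = p * exp t / Z" unfolding th(1) using pos by simp
    moreover have "(1 - (p + v * w)) * (1 / ((1 - p * w) * Z)) = q / Z" unfolding th(2) using pos by simp
    ultimately show ?thesis by simp
  qed
  also have "\<dots> = 0" using Z by (simp add: Z_def add_divide_distrib[symmetric] add.commute)
  finally have "(p + v * w) * t - ln Z \<le> (p + v * w) * ln (1 + q * w) + (1 - (p + v * w)) * ln (1 + - (p * w))"
    by (simp add: algebra_simps)
  \<comment> \<open>What remains is the Kullback-Leibler divergence. The cubic upper bound for both
    logarithms reproduces its expansion up to w^3 and leaves a single quartic term.\<close>
  also have "\<dots> \<le> (p + v * w) * (q * w - (q * w)\<^sup>2 / 2 + (q * w) ^ 3 / 3)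
      + (1 - (p + v * w)) * (- (p * w) - (- (p * w))\<^sup>2 / 2 + (- (p * w)) ^ 3 / 3)"
    using th0 th1 qw by (intro add_mono mult_left_mono ln_add_one_le_cubic) auto
  also have "\<dots> = v * (w\<^sup>2 / 2 - (1 - 2 * p) * w ^ 3 / 6 + w ^ 4 * (q ^ 3 + p ^ 3) / 3)"
    unfolding th(2) unfolding th(1)
    by (simp add: v_def q_def field_simps power2_eq_square power3_eq_cube power4_eq_xxxx)
  also have "\<dots> \<le> v * (w\<^sup>2 / 2 - (1 - 2 * p) * w ^ 3 / 6 + w ^ 4 * 1 / 3)"
  proof -
    have "q ^ 3 \<le> q" "p ^ 3 \<le> p"
      using p q power_decreasing[of 1 3 q] power_decreasing[of 1 3 p] by simp_all
    then have "q ^ 3 + p ^ 3 \<le> 1" using q by simp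
    then show ?thesis
      using p by (intro mult_left_mono add_mono divide_right_mono) (auto simp: v_def)
  qed
  finally show ?thesis by (simp add: cgf_def Z_def q_def algebra_simps)
qed

text \<open>To be read with y = \<open>X e A\<close>, d = \<open>corr A e / v e\<close> and k = 1 -
  2p. The terms y^2, y d and y^3 are kept exactly since they must cancel after summation; AM-GM puts
  everything else into y^4 and d^2.\<close>

lemma dual_polynomial_le:
  fixes y d k :: real
  assumes "\<bar>y\<bar> \<le> 1/2" "\<bar>d\<bar> \<le> 1/2" "\<bar>k\<bar> \<le> 1"
  shows "(y + d)\<^sup>2 / 2 - k * (y + d) ^ 3 / 6 + (y + d) ^ 4 / 3
    \<le> y\<^sup>2 / 2 + y * d - k * y ^ 3 / 6 + 4 * y ^ 4 + 2 * d\<^sup>2"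
proof -
  have y2: "y\<^sup>2 \<le> 1/4" and d2: "d\<^sup>2 \<le> 1/4"
    using power_mono[OF assms(1), of 2] power_mono[OF assms(2), of 2] by (simp_all add: power_divide)
  have a: "\<bar>3 * (y\<^sup>2 * d)\<bar> \<le> 3/2 * (y ^ 4 + d\<^sup>2)"
    using zero_le_power2[of "y\<^sup>2 + d"] zero_le_power2[of "y\<^sup>2 - d"]
    by (simp add: abs_le_iff power2_eq_square power4_eq_xxxx algebra_simps)
  have b: "\<bar>3 * (y * d\<^sup>2)\<bar> \<le> 3/2 * d\<^sup>2"
    using mult_right_mono[OF assms(1), of "d\<^sup>2"] by (simp add: abs_mult)
  have c: "\<bar>d ^ 3\<bar> \<le> 1/2 * d\<^sup>2"
    using mult_right_mono[OF assms(2), of "d\<^sup>2"] by (simp add: power3_eq_cube power2_eq_square abs_mult)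
  have "(y + d) ^ 3 - y ^ 3 = 3 * (y\<^sup>2 * d) + 3 * (y * d\<^sup>2) + d ^ 3"
    by (simp add: power3_eq_cube power2_eq_square algebra_simps)
  then have "\<bar>(y + d) ^ 3 - y ^ 3\<bar> \<le> 3/2 * (y ^ 4 + d\<^sup>2) + 3/2 * d\<^sup>2 + 1/2 * d\<^sup>2"
    by (simp only:) (rule order_trans[OF abs_triangle_ineq add_mono[OF order_trans[OF abs_triangle_ineq add_mono[OF a b]] c]])
  then have "\<bar>(y + d) ^ 3 - y ^ 3\<bar> \<le> 3/2 * y ^ 4 + 7/2 * d\<^sup>2" by (simp add: algebra_simps)
  then have "\<bar>k\<bar> * \<bar>(y + d) ^ 3 - y ^ 3\<bar> \<le> 1 * (3/2 * y ^ 4 + 7/2 * d\<^sup>2)"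
    using assms(3) by (intro mult_mono) auto
  then have 3: "- (k * (y + d) ^ 3) + k * y ^ 3 \<le> 3/2 * y ^ 4 + 7/2 * d\<^sup>2"
    by (simp add: abs_mult[symmetric] abs_le_iff algebra_simps)
  have "(y + d)\<^sup>2 \<le> 2 * (y\<^sup>2 + d\<^sup>2)"
    using zero_le_power2[of "y - d"] by (simp add: power2_eq_square algebra_simps)
  then have "((y + d)\<^sup>2)\<^sup>2 \<le> (2 * (y\<^sup>2 + d\<^sup>2))\<^sup>2" by (intro power_mono) auto
  also have "\<dots> \<le> 8 * (y ^ 4 + d ^ 4)"
    using zero_le_power2[of "y\<^sup>2 - d\<^sup>2"] by (simp add: power2_eq_square power4_eq_xxxx algebra_simps)
  finally have 4: "(y + d) ^ 4 \<le> 8 * (y ^ 4 + d ^ 4)" by simp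
  have "d ^ 4 \<le> 1/4 * d\<^sup>2"
    using mult_right_mono[OF d2, of "d\<^sup>2"] by (simp add: power4_eq_xxxx power2_eq_square mult.assoc)
  moreover have "(y + d)\<^sup>2 = y\<^sup>2 + 2 * (y * d) + d\<^sup>2" by (simp add: power2_eq_square algebra_simps)
  moreover have "0 \<le> y ^ 4" "0 \<le> d\<^sup>2" by auto
  \<comment> \<open>The totals are 1/4 + 8/3 <= 4 for y^4 and 1/2 + 7/12 + 2/3 <= 2 for d^2.\<close>
  ultimately show ?thesis using 3 4 by argo
qed

section \<open>Two-sided bounds for the maximized log-likelihood\<close>

text \<open>The first \<open>k\<close> nodes are constrained. The case k = 0 is the unrestricted
  maximum, so both terms of the likelihood ratio are treated at once.\<close>

locale beta_graph_null = beta_graph +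
  fixes k :: nat
  assumes k_le: "k \<le> n" and b_le: "b \<le> real n - 1"
begin

sublocale beta_graph_sub n beta b "{k..<n}"
  using b_le by unfold_locales auto

definition Xi :: "(nat \<times> nat \<Rightarrow> bool) \<Rightarrow> real" where "Xi A = (\<Sum>i<k. xi i A)"
text \<open>The row sums still missing from v X. On a free node the target is \<open>xi i A\<close>,
  which leaves minus \<rho>. On the constrained block, where \<open>x\<close> vanishes, only the
  total \<open>Xi A\<close> is prescribed and it is spread evenly.\<close>

definition u :: "(nat \<times> nat \<Rightarrow> bool) \<Rightarrow> nat \<Rightarrow> real" where
  "u A i = (if i < k then Xi A / real k else 0) - \<rho> i A"
definition U :: "(nat \<times> nat \<Rightarrow> bool) \<Rightarrow> real" where "U A = (\<Sum>i<n. (u A i)\<^sup>2)"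
definition corr :: "(nat \<times> nat \<Rightarrow> bool) \<Rightarrow> nat \<times> nat \<Rightarrow> real" where
  "corr A e = ends (u A) e / (real n - 2) - (\<Sum>i<n. u A i) / ((real n - 1) * (real n - 2))"
text \<open>The third cumulant of an edge indicator.\<close>

definition kv :: "nat \<times> nat \<Rightarrow> real" where "kv e = (1 - 2 * pr e) * v e"
definition stat :: "(nat \<times> nat \<Rightarrow> bool) \<Rightarrow> real" where "stat A = (\<Sum>i\<in>{k..<n}. (xi i A)\<^sup>2 / V i)"
definition err :: "(nat \<times> nat \<Rightarrow> bool) \<Rightarrow> real" where
  "err A = \<bar>Q A\<bar> / 2 + \<bar>C kv A\<bar> / 6 + K A + 2 * b * U A / (real n - 2)"
text \<open>A value below 1 certifies that the dual array is admissible in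
  \<open>cgf_dual_le\<close>: 256 = 4^4 forces \<open>\<bar>x i A\<bar> <= 1/4\<close>, and 36 = 4 *
  9 forces \<open>\<bar>corr A e / v e\<bar> <= 1/2\<close>. Being an expectation-friendly
  polynomial, it serves as a Markov bound.\<close>

definition bad :: "(nat \<times> nat \<Rightarrow> bool) \<Rightarrow> real" where
  "bad A = 256 * (\<Sum>i<n. (x i A) ^ 4) + 36 * b\<^sup>2 * U A / (real n - 2)\<^sup>2"

lemma U_nonneg: "0 \<le> U A"
  by (simp add: U_def sum_nonneg)

lemma n2: "0 < real n - 2" "0 < real n - 1"
  using n_ge by auto

text \<open>The correction is the symmetric matrix of the form \<open>s i + s j\<close> off the diagonal that has
  row sums \<open>u\<close>.\<close>
lemma row_corr: "i < n \<Longrightarrow> row n (corr A) i = u A i"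
proof -
  assume i: "i < n"
  let ?P = "\<Sum>i<n. u A i"
  have "row n (corr A) i = (\<Sum>j\<in>{..<n} - {i}. (u A i + u A j) / (real n - 2) - ?P / ((real n - 1) * (real n - 2)))"
    unfolding row_def
    by (rule sum.mono_neutral_cong_right) (auto simp: sy_def corr_def ends_def min_def max_def add.commute)
  also have "\<dots> = ((real n - 1) * u A i + (?P - u A i)) / (real n - 2)
      - (real n - 1) * (?P / ((real n - 1) * (real n - 2)))"
    using i n_ge
    by (simp add: sum_subtractf sum.distrib sum_divide_distrib[symmetric] sum_diff1 of_nat_diff)
  also have "(real n - 1) * (?P / ((real n - 1) * (real n - 2))) = ?P / (real n - 2)"
    using n2 by simp
  also have "((real n - 1) * u A i + (?P - u A i)) / (real n - 2) - ?P / (real n - 2)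
      = ((real n - 2) * u A i) / (real n - 2)"
    unfolding diff_divide_distrib[symmetric] by (simp add: algebra_simps)
  also have "\<dots> = u A i" using n2 by simp
  finally show ?thesis .
qed

text \<open>One factor \<open>corr\<close> is expanded by its definition. Its \<open>ends\<close>
  part pairs with the row sums \<open>u\<close> and gives \<open>U A / (real n - 2)\<close>; its
  constant part contributes a non-positive square.\<close>

lemma sum_corr_square: "(\<Sum>e\<in>E. (corr A e)\<^sup>2) \<le> U A / (real n - 2)"
proof -
  let ?P = "\<Sum>i<n. u A i"
  have 1: "(\<Sum>e\<in>E. corr A e * ends (u A) e) = U A"
    by (simp add: sum_mult_row[symmetric] row_corr U_def power2_eq_square)
  have 2: "(\<Sum>e\<in>E. corr A e) = ?P / 2"
    using sum_row[of n "corr A"] by (simp add: row_corr)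
  have sq: "(corr A e)\<^sup>2 = corr A e * ends (u A) e / (real n - 2)
      - corr A e * (?P / ((real n - 1) * (real n - 2)))" for e
  proof -
    have "corr A e * corr A e = corr A e * (ends (u A) e / (real n - 2) - ?P / ((real n - 1) * (real n - 2)))"
      by (rule arg_cong[where f = "(*) (corr A e)"], rule corr_def)
    then show ?thesis by (simp add: power2_eq_square right_diff_distrib)
  qed
  have "(\<Sum>e\<in>E. (corr A e)\<^sup>2)
      = (\<Sum>e\<in>E. corr A e * ends (u A) e) / (real n - 2) - (\<Sum>e\<in>E. corr A e) * (?P / ((real n - 1) * (real n - 2)))"
    unfolding sq sum_subtractf sum_divide_distrib sum_distrib_right ..
  also have "\<dots> = U A / (real n - 2) - ?P\<^sup>2 / (2 * ((real n - 1) * (real n - 2)))"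
    unfolding 1 2 by (simp add: power2_eq_square)
  also have "\<dots> \<le> U A / (real n - 2)" using n2 by simp
  finally show ?thesis .
qed

lemma corr_square_le: "e \<in> E \<Longrightarrow> (corr A e)\<^sup>2 \<le> 9 * U A / (real n - 2)\<^sup>2"
proof -
  assume e: "e \<in> E"
  let ?P = "\<Sum>i<n. u A i" and ?r = "sqrt (U A)"
  have u: "\<bar>u A i\<bar> \<le> ?r" if "i < n" for i
  proof -
    have "(u A i)\<^sup>2 \<le> U A"
      unfolding U_def using that by (intro member_le_sum) auto
    then show ?thesis by (intro real_le_rsqrt) simp
  qed
  have "?P\<^sup>2 \<le> real n * U A"
    unfolding U_def using weighted_cauchy_schwarz[of "{..<n}" "\<lambda>_. 1" "u A"] by simp
  also have "\<dots> \<le> (real n - 1)\<^sup>2 * U A"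
  proof (rule mult_right_mono[OF _ U_nonneg])
    have "3 * real n \<le> real n * real n" using n_ge by (intro mult_right_mono) auto
    then show "real n \<le> (real n - 1)\<^sup>2" by (simp add: power2_eq_square algebra_simps)
  qed
  finally have "\<bar>?P\<bar> \<le> sqrt ((real n - 1)\<^sup>2 * U A)" by (intro real_le_rsqrt) simp
  then have P: "\<bar>?P\<bar> \<le> (real n - 1) * ?r" using n2 by (simp add: real_sqrt_mult)
  have "\<bar>corr A e\<bar> \<le> \<bar>ends (u A) e / (real n - 2)\<bar> + \<bar>?P / ((real n - 1) * (real n - 2))\<bar>"
    unfolding corr_def by (rule abs_triangle_ineq4)
  also have "\<dots> \<le> 2 * ?r / (real n - 2) + ((real n - 1) * ?r) / ((real n - 1) * (real n - 2))"
  proof (rule add_mono)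
    have "\<bar>ends (u A) e\<bar> \<le> 2 * ?r"
      using u[of "fst e"] u[of "snd e"] node_pairsD[OF e] by (simp add: ends_def)
    then show "\<bar>ends (u A) e / (real n - 2)\<bar> \<le> 2 * ?r / (real n - 2)"
      using n2 by (simp add: divide_right_mono)
    have P_abs: "\<bar>?P / ((real n - 1) * (real n - 2))\<bar> = \<bar>?P\<bar> / ((real n - 1) * (real n - 2))"
      using n2 by (simp add: abs_mult)
    show "\<bar>?P / ((real n - 1) * (real n - 2))\<bar> \<le> ((real n - 1) * ?r) / ((real n - 1) * (real n - 2))"
      unfolding P_abs by (rule divide_right_mono[OF P]) (use n2 in simp)
  qed
  also have "\<dots> = 3 * ?r / (real n - 2)" using n2 by (simp add: add_divide_distrib[symmetric])
  finally have "\<bar>corr A e\<bar>\<^sup>2 \<le> (3 * ?r / (real n - 2))\<^sup>2" by (intro power_mono) auto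
  then show ?thesis using U_nonneg by (simp add: power_divide power_mult_distrib)
qed

lemma V_x: "V i * x i A = of_bool (i \<in> {k..<n}) * xi i A"
  using V_c[of i] by (simp add: x_def mult.assoc[symmetric])

lemma N_eq_stat: "N A = stat A"
  unfolding N_def stat_def by (rule sum.mono_neutral_cong_right) (auto simp: c_def)

lemma sum_x_xi: "(\<Sum>i<n. x i A * xi i A) = stat A"
  by (simp add: N_eq_stat[symmetric] N_def x_def power2_eq_square mult.assoc)

lemma sum_v_X2: "(\<Sum>e\<in>E. v e * (X e A)\<^sup>2) = stat A + Q A"
  by (simp add: sum_v_X_square N_eq_stat)

text \<open>The exponential family identity: the log-partition function of an edge, shifted from the
  true parameter, is its mean times the shift plus the centred cumulant generating function.\<close>

lemma loglik_increment:
  "loglik n A (\<lambda>i. beta i + y i) - loglik n A beta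
    = (\<Sum>e\<in>E. eps e A * ends y e - cgf (pr e) (ends y e))"
proof -
  have "of_bool (A e) * ends (\<lambda>i. beta i + y i) e - ln (1 + exp (ends (\<lambda>i. beta i + y i) e))
      - (of_bool (A e) * ends beta e - ln (1 + exp (ends beta e)))
    = eps e A * ends y e - cgf (pr e) (ends y e)" for e
  proof -
    define s where "s = ends beta e"
    have s: "ends (\<lambda>i. beta i + y i) e = s + ends y e" by (simp add: ends_def s_def)
    have p: "pr e = exp s / (1 + exp s)" by (simp add: edge_weight_def edge_prob_def ends_def s_def)
    have pos: "0 < 1 + exp t" for t :: real by (simp add: add_pos_pos)
    have "1 - pr e + pr e * exp (ends y e) = (1 + exp (s + ends y e)) / (1 + exp s)"
      using pos[of s] by (simp add: p exp_add field_simps)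
    then have "cgf (pr e) (ends y e) = ln (1 + exp (s + ends y e)) - ln (1 + exp s) - pr e * ends y e"
      using pos[of s] pos[of "s + ends y e"] less_imp_neq[OF pos[of s]] less_imp_neq[OF pos[of "s + ends y e"]]
      by (simp add: cgf_def ln_div)
    then show ?thesis unfolding s by (simp add: s_def[symmetric] eps_def algebra_simps)
  qed
  then show ?thesis
    unfolding loglik_eq sum_subtractf[symmetric] by (intro sum.cong refl)
qed

text \<open>At the Newton step the linear term equals \<open>stat\<close>, and the quadratic Taylor
  term takes half of it back. The Taylor bound is global, so this holds for every graph
  \<open>A\<close>.\<close>

lemma loglik_lower:
  "stat A / 2 - err A \<le> loglik n A (\<lambda>i. beta i + x i A) - loglik n A beta"
proof -
  have lin: "(\<Sum>e\<in>E. eps e A * X e A) = stat A"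
    by (simp add: X_def sum_mult_row[symmetric] xi_def[symmetric] sum_x_xi)
  have "stat A - (stat A + Q A) / 2 - C kv A / 6 - K A
      = (\<Sum>e\<in>E. eps e A * X e A) - (\<Sum>e\<in>E. v e * (X e A)\<^sup>2) / 2 - C kv A / 6 - K A"
    by (simp add: sum_v_X2 lin)
  also have "\<dots> = (\<Sum>e\<in>E. eps e A * X e A - v e * (X e A)\<^sup>2 / 2 - kv e * (X e A) ^ 3 / 6 - (X e A) ^ 4)"
    by (simp add: C_def K_def sum_subtractf sum_divide_distrib)
  also have "\<dots> \<le> (\<Sum>e\<in>E. eps e A * X e A - cgf (pr e) (X e A))"
  proof (rule sum_mono)
    fix e
    have "\<bar>cgf (pr e) (X e A) - v e * ((X e A)\<^sup>2 / 2 + (1 - 2 * pr e) * (X e A) ^ 3 / 6)\<bar> \<le> (X e A) ^ 4"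
      unfolding v_def by (intro cgf_taylor edge_weight_bounds)
    moreover have "v e * ((X e A)\<^sup>2 / 2 + (1 - 2 * pr e) * (X e A) ^ 3 / 6)
        = v e * (X e A)\<^sup>2 / 2 + kv e * (X e A) ^ 3 / 6"
      by (simp add: kv_def algebra_simps)
    ultimately show "eps e A * X e A - v e * (X e A)\<^sup>2 / 2 - kv e * (X e A) ^ 3 / 6 - (X e A) ^ 4
        \<le> eps e A * X e A - cgf (pr e) (X e A)"
      by (simp add: abs_le_iff)
  qed
  also have "\<dots> = loglik n A (\<lambda>i. beta i + x i A) - loglik n A beta"
    by (simp add: loglik_increment X_def)
  finally have "stat A - (stat A + Q A) / 2 - C kv A / 6 - K A
      \<le> loglik n A (\<lambda>i. beta i + x i A) - loglik n A beta" .
  moreover have "0 \<le> 2 * b * U A / (real n - 2)" using U_nonneg b_ge n2 by simp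
  ultimately show ?thesis unfolding err_def using abs_ge_self[of "Q A"] abs_ge_self[of "C kv A"]
    by (simp add: add_divide_distrib)
qed

lemma bad_bounds:
  assumes bad: "bad A < 1" and e: "e \<in> E"
  shows "\<bar>X e A\<bar> \<le> 1 / 2" "\<bar>corr A e / v e\<bar> \<le> 1 / 2"
proof -
  have nn: "0 \<le> (\<Sum>i<n. (x i A) ^ 4)" "0 \<le> 36 * b\<^sup>2 * U A / (real n - 2)\<^sup>2"
    using U_nonneg by (auto intro!: sum_nonneg)
  have x: "\<bar>x i A\<bar> \<le> 1 / 4" if "i < n" for i
  proof (rule ccontr)
    assume "\<not> \<bar>x i A\<bar> \<le> 1 / 4"
    then have "(1/4) ^ 4 \<le> \<bar>x i A\<bar> ^ 4" by (intro power_mono) auto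
    moreover have "(x i A) ^ 4 \<le> (\<Sum>i<n. (x i A) ^ 4)"
      using that by (intro member_le_sum) auto
    ultimately have "1 \<le> 256 * (\<Sum>i<n. (x i A) ^ 4)" by (simp add: power_divide)
    then show False using bad nn by (simp add: bad_def)
  qed
  show "\<bar>X e A\<bar> \<le> 1 / 2"
    using x[of "fst e"] x[of "snd e"] node_pairsD[OF e] abs_triangle_ineq[of "x (fst e) A" "x (snd e) A"]
    by (simp add: X_def ends_def)
  have "\<bar>corr A e / v e\<bar> = \<bar>corr A e\<bar> * (1 / v e)" using v_pos[of e] by simp
  also have "\<dots> \<le> \<bar>corr A e\<bar> * b"
    using v_pos[of e] v_bound[OF e] by (intro mult_left_mono) (auto simp: divide_le_eq)
  finally have "\<bar>corr A e / v e\<bar>\<^sup>2 \<le> (\<bar>corr A e\<bar> * b)\<^sup>2" by (intro power_mono) auto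
  also have "\<dots> = b\<^sup>2 * (corr A e)\<^sup>2" by (simp add: power_mult_distrib mult.commute)
  also have "\<dots> \<le> b\<^sup>2 * (9 * U A / (real n - 2)\<^sup>2)"
    by (intro mult_left_mono corr_square_le e) auto
  also have "\<dots> = (36 * b\<^sup>2 * U A / (real n - 2)\<^sup>2) / 4" by simp
  also have "\<dots> \<le> (1 / 2)\<^sup>2"
  proof -
    have "36 * b\<^sup>2 * U A / (real n - 2)\<^sup>2 \<le> 1" using bad nn unfolding bad_def by linarith
    then show ?thesis by (simp add: power_divide mult_ac)
  qed
  finally show "\<bar>corr A e / v e\<bar> \<le> 1 / 2" by (rule power2_le_imp_le) simp
qed

text \<open>Constancy of \<open>y\<close> on the constrained block covers both nulls: the shift is
  zero there in the first and a common value in the second. The bound is uniform in \<open>y\<close>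
  because Fenchel's inequality removes it edge by edge.\<close>

lemma loglik_upper:
  assumes bad: "bad A < 1" and y: "\<And>i j. i < k \<Longrightarrow> j < k \<Longrightarrow> y i = y j"
  shows "loglik n A (\<lambda>i. beta i + y i) - loglik n A beta \<le> stat A / 2 + err A"
proof -
  have "(\<Sum>e\<in>E. eps e A * ends y e) = (\<Sum>i<n. y i * xi i A)"
    by (simp add: sum_mult_row[symmetric] xi_def)
  \<comment> \<open>The data are replaced by v X + \<open>corr\<close>: the row sums agree exactly
    on the free nodes, and on the block only the total matters because \<open>y\<close> is constant
    there.\<close>
  also have "\<dots> = (\<Sum>i<n. y i * row n (\<lambda>e. v e * X e A + corr A e) i)"
  proof -
    have r: "row n (\<lambda>e. v e * X e A + corr A e) i = (if i < k then Xi A / real k else xi i A)" if "i < n" for i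
      using that by (simp add: row_add row_v_X row_corr V_x u_def)
    have split: "{..<n} = {..<k} \<union> {k..<n}" using k_le by auto
    have dis: "(\<Sum>i<n. f i) = (\<Sum>i<k. f i) + (\<Sum>i\<in>{k..<n}. f i)" for f :: "nat \<Rightarrow> real"
      unfolding split by (rule sum.union_disjoint) auto
    have "(\<Sum>i<k. y i * xi i A) = (\<Sum>i<k. y i * (Xi A / real k))"
    proof (cases "k = 0")
      case False
      then have y0: "y i = y 0" if "i \<in> {..<k}" for i using y[of i 0] that by simp
      have "(\<Sum>i<k. y i * xi i A) = (\<Sum>i<k. y 0 * xi i A)"
        by (intro sum.cong refl arg_cong2[where f = "(*)"]) (rule y0)
      also have "\<dots> = y 0 * Xi A" by (simp add: Xi_def sum_distrib_left)
      also have "\<dots> = (\<Sum>i<k. y 0 * (Xi A / real k))" using False by simp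
      also have "\<dots> = (\<Sum>i<k. y i * (Xi A / real k))"
        by (intro sum.cong refl arg_cong2[where f = "(*)"]) (rule y0[symmetric])
      finally show ?thesis .
    qed simp
    moreover have "(\<Sum>i<k. y i * row n (\<lambda>e. v e * X e A + corr A e) i) = (\<Sum>i<k. y i * (Xi A / real k))"
      using k_le by (intro sum.cong refl) (simp add: r)
    moreover have "(\<Sum>i\<in>{k..<n}. y i * row n (\<lambda>e. v e * X e A + corr A e) i) = (\<Sum>i\<in>{k..<n}. y i * xi i A)"
      by (intro sum.cong refl) (simp add: r)
    ultimately show ?thesis unfolding dis by simp
  qed
  also have "\<dots> = (\<Sum>e\<in>E. (v e * X e A + corr A e) * ends y e)" by (rule sum_mult_row)
  finally have "loglik n A (\<lambda>i. beta i + y i) - loglik n A beta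
      = (\<Sum>e\<in>E. (v e * X e A + corr A e) * ends y e - cgf (pr e) (ends y e))"
    by (simp add: loglik_increment sum_subtractf)
  also have "\<dots> \<le> (\<Sum>e\<in>E. v e * (X e A)\<^sup>2 / 2 + X e A * corr A e - kv e * (X e A) ^ 3 / 6
      + (X e A) ^ 4 + 2 * b * (corr A e)\<^sup>2)"
  proof (rule sum_mono)
    fix e assume e: "e \<in> E"
    define d where "d = corr A e / v e"
    have vd: "v e * d = corr A e" using v_pos[of e] by (simp add: d_def)
    note bb = bad_bounds[OF bad e, folded d_def]
    have kap: "\<bar>1 - 2 * pr e\<bar> \<le> 1" using edge_weight_bounds[of beta e] by (simp add: abs_le_iff)
    have lt: "\<bar>X e A + d\<bar> \<le> 1" using bb abs_triangle_ineq[of "X e A" d] by simp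
    \<comment> \<open>Fenchel's inequality with w = X + d, for which v w is the replacing array at
      \<open>e\<close>.\<close>
    have "v e * (X e A + d) * ends y e - cgf (pr e) (ends y e)
        \<le> v e * ((X e A + d)\<^sup>2 / 2 - (1 - 2 * pr e) * (X e A + d) ^ 3 / 6 + (X e A + d) ^ 4 / 3)"
      unfolding v_def by (intro cgf_dual_le edge_weight_bounds lt)
    also have "\<dots> \<le> v e * ((X e A)\<^sup>2 / 2 + X e A * d - (1 - 2 * pr e) * (X e A) ^ 3 / 6 + 4 * (X e A) ^ 4 + 2 * d\<^sup>2)"
      using v_pos[of e] by (intro mult_left_mono dual_polynomial_le bb kap) auto
    also have "\<dots> = v e * (X e A)\<^sup>2 / 2 + X e A * (v e * d) - kv e * (X e A) ^ 3 / 6 + (4 * v e) * (X e A) ^ 4 + 2 * d * (v e * d)"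
      by (simp add: kv_def power2_eq_square algebra_simps)
    finally have 1: "(v e * X e A + corr A e) * ends y e - cgf (pr e) (ends y e)
      \<le> v e * (X e A)\<^sup>2 / 2 + X e A * corr A e - kv e * (X e A) ^ 3 / 6 + (4 * v e) * (X e A) ^ 4 + 2 * (d * corr A e)"
      by (simp add: distrib_left vd mult.assoc)
    have 2: "(4 * v e) * (X e A) ^ 4 \<le> 1 * (X e A) ^ 4"
      using v_le_quarter[of e] by (intro mult_right_mono) auto
    have "d * corr A e = (corr A e)\<^sup>2 * (1 / v e)" by (simp add: d_def power2_eq_square)
    also have "\<dots> \<le> (corr A e)\<^sup>2 * b"
      using v_pos[of e] v_bound[OF e] by (intro mult_left_mono) (auto simp: divide_le_eq)
    finally have 3: "2 * (d * corr A e) \<le> 2 * b * (corr A e)\<^sup>2" by (simp add: mult_ac)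
    show "(v e * X e A + corr A e) * ends y e - cgf (pr e) (ends y e)
      \<le> v e * (X e A)\<^sup>2 / 2 + X e A * corr A e - kv e * (X e A) ^ 3 / 6 + (X e A) ^ 4 + 2 * b * (corr A e)\<^sup>2"
      using 1 2 3 by simp
  qed
  also have "\<dots> = (stat A + Q A) / 2 + (\<Sum>e\<in>E. corr A e * ends (\<lambda>i. x i A) e) - C kv A / 6 + K A
      + 2 * b * (\<Sum>e\<in>E. (corr A e)\<^sup>2)"
  proof -
    have "(\<Sum>e\<in>E. v e * (X e A)\<^sup>2 / 2) = (stat A + Q A) / 2"
      unfolding sum_divide_distrib[symmetric] sum_v_X2 ..
    moreover have "(\<Sum>e\<in>E. X e A * corr A e) = (\<Sum>e\<in>E. corr A e * ends (\<lambda>i. x i A) e)"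
      by (simp add: X_def mult.commute)
    moreover have "(\<Sum>e\<in>E. kv e * (X e A) ^ 3 / 6) = C kv A / 6"
      unfolding sum_divide_distrib[symmetric] C_def ..
    ultimately show ?thesis
      by (simp only: sum.distrib sum_subtractf K_def sum_distrib_left)
  qed
  also have "(\<Sum>e\<in>E. corr A e * ends (\<lambda>i. x i A) e) = (\<Sum>i<n. x i A * u A i)"
    by (simp add: sum_mult_row[symmetric] row_corr)
  \<comment> \<open>\<open>x\<close> vanishes on the constrained block, so only the part of
    \<open>u\<close> equal to minus \<rho> is seen. Together with the half of \<open>Q\<close>
    above, this leaves minus half of \<open>Q\<close>, as in the lower bound.\<close>
  also have "\<dots> = - Q A"
  proof -
    have "x i A * u A i = - (x i A * \<rho> i A)" for i
      by (simp add: u_def x_def c_def algebra_simps)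
    then show ?thesis by (simp add: Q_def sum_negf)
  qed
  finally have "loglik n A (\<lambda>i. beta i + y i) - loglik n A beta
      \<le> (stat A + Q A) / 2 + - Q A - C kv A / 6 + K A + 2 * b * (\<Sum>e\<in>E. (corr A e)\<^sup>2)" .
  moreover have "2 * b * (\<Sum>e\<in>E. (corr A e)\<^sup>2) \<le> 2 * b * (U A / (real n - 2))"
    using b_ge by (intro mult_left_mono sum_corr_square) auto
  ultimately show ?thesis
    unfolding err_def using abs_ge_minus_self[of "Q A"] abs_ge_minus_self[of "C kv A"]
    by (simp add: add_divide_distrib)
qed

end

section \<open>Means of the error terms, and the bound for the supremum\<close>

context beta_graph_null
begin

text \<open>Spread evenly, the block total contributes k (Xi / k)^2, of mean at most n/2 because Xi
  has variance at most k n / 2. The rest is a sum of n second moments of \<rho>.\<close>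

lemma expec_U: "expec U \<le> 3 * real n * B"
proof -
  have Xi2: "expec (\<lambda>A. (Xi A)\<^sup>2) \<le> real k * real n / 2"
  proof -
    have "Xi A = lin (ends (\<lambda>i. of_bool (i < k))) A" for A
    proof -
      have "Xi A = (\<Sum>i<n. of_bool (i < k) * xi i A)"
        unfolding Xi_def using k_le by (intro sum.mono_neutral_cong_left) auto
      then show ?thesis by (simp only: sum_mult_xi)
    qed
    then have "expec (\<lambda>A. (Xi A)\<^sup>2) \<le> 2 * (\<Sum>i<n. V i * (of_bool (i < k))\<^sup>2)"
      using var_ends_le by (simp add: expec_lin_square)
    also have "(\<Sum>i<n. V i * (of_bool (i < k))\<^sup>2) = (\<Sum>i<k. V i)"
      using k_le by (intro sum.mono_neutral_cong_right) auto
    also have "2 * (\<Sum>i<k. V i) \<le> 2 * (\<Sum>i<k. real n / 4)"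
      by (intro mult_left_mono sum_mono V_le) simp
    finally show ?thesis by simp
  qed
  have "U A \<le> 2 * (real k * (Xi A / real k)\<^sup>2) + 2 * (\<Sum>i<n. (\<rho> i A)\<^sup>2)" for A
  proof -
    have "U A \<le> (\<Sum>i<n. 2 * (of_bool (i < k) * (Xi A / real k)\<^sup>2) + 2 * (\<rho> i A)\<^sup>2)"
      unfolding U_def
    proof (rule sum_mono)
      fix i
      show "(u A i)\<^sup>2 \<le> 2 * (of_bool (i < k) * (Xi A / real k)\<^sup>2) + 2 * (\<rho> i A)\<^sup>2"
        using power2_sum_le[of "Xi A / real k" "- \<rho> i A"] by (simp add: u_def)
    qed
    also have "\<dots> = 2 * (\<Sum>i<n. of_bool (i < k) * (Xi A / real k)\<^sup>2) + 2 * (\<Sum>i<n. (\<rho> i A)\<^sup>2)"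
      by (simp only: sum.distrib sum_distrib_left)
    also have "(\<Sum>i<n. of_bool (i < k) * (Xi A / real k)\<^sup>2) = (\<Sum>i<k. (Xi A / real k)\<^sup>2)"
      using k_le by (intro sum.mono_neutral_cong_right) auto
    finally show ?thesis by simp
  qed
  then have "expec U \<le> expec (\<lambda>A. 2 * (real k * (Xi A / real k)\<^sup>2) + 2 * (\<Sum>i<n. (\<rho> i A)\<^sup>2))"
    by (rule expec_mono)
  also have "\<dots> = 2 * (real k * (expec (\<lambda>A. (Xi A)\<^sup>2) / (real k)\<^sup>2)) + 2 * (\<Sum>i<n. expec (\<lambda>A. (\<rho> i A)\<^sup>2))"
    by (simp only: power_divide expec_linear)
  also have "\<dots> \<le> real n + 2 * (\<Sum>i<n. B)"
  proof (rule add_mono)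
    show "2 * (real k * (expec (\<lambda>A. (Xi A)\<^sup>2) / (real k)\<^sup>2)) \<le> real n"
    proof (cases "k = 0")
      case False
      have "2 * (real k * (expec (\<lambda>A. (Xi A)\<^sup>2) / (real k)\<^sup>2)) = 2 / real k * expec (\<lambda>A. (Xi A)\<^sup>2)"
        using False by (simp add: power2_eq_square)
      also have "\<dots> \<le> 2 / real k * (real k * real n / 2)"
        by (intro mult_left_mono Xi2) simp
      finally show ?thesis using False by simp
    qed simp
    show "2 * (\<Sum>i<n. expec (\<lambda>A. (\<rho> i A)\<^sup>2)) \<le> 2 * (\<Sum>i<n. B)"
      by (intro mult_left_mono sum_mono expec_rho2) simp
  qed
  also have "\<dots> \<le> real n * B + 2 * (real n * B)"
    using mult_left_mono[OF B_ge, of "real n"] by simp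
  finally show ?thesis by simp
qed

lemma b_le_B: "b \<le> B"
proof -
  have "b = (real n - 1) * eta" using n2 by (simp add: eta_def)
  also have "\<dots> \<le> B" unfolding B_def using eta_pos by (intro mult_right_mono) auto
  finally show ?thesis .
qed

lemma n_div: "real n / (real n - 2) \<le> 3"
  using n_ge by (simp add: divide_le_eq)

lemma kv_le: "\<bar>kv e\<bar> \<le> v e"
proof -
  have "\<bar>1 - 2 * pr e\<bar> * v e \<le> 1 * v e"
    using edge_weight_bounds[of beta e] v_pos[of e] by (intro mult_right_mono) auto
  then show ?thesis using v_pos[of e] by (simp add: kv_def abs_mult)
qed

lemma expec_err: "expec err \<le> 800 * B\<^sup>2"
proof -
  have "2 * b * expec U / (real n - 2) \<le> 2 * B * (3 * real n * B) / (real n - 2)"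
    using b_le_B expec_U b_ge n2 B_ge expec_nonneg[of U] U_nonneg
    by (intro divide_right_mono mult_mono) auto
  also have "\<dots> = 6 * B\<^sup>2 * (real n / (real n - 2))" by (simp add: power2_eq_square)
  also have "\<dots> \<le> 6 * B\<^sup>2 * 3" by (intro mult_left_mono n_div) auto
  finally have 1: "2 * b * expec U / (real n - 2) \<le> 18 * B\<^sup>2" by simp
  have "expec err = expec (\<lambda>A. \<bar>Q A\<bar>) / 2 + expec (\<lambda>A. \<bar>C kv A\<bar>) / 6 + expec K
      + 2 * b * expec U / (real n - 2)"
    unfolding err_def[abs_def] by (simp only: expec_linear)
  \<comment> \<open>The four terms add up to 9 + 3500/6 + 88 + 18, below 800.\<close>
  then show ?thesis
    using expec_Q expec_C[of kv, OF kv_le] expec_K 1 zero_le_power2[of B] by linarith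
qed

lemma expec_bad: "expec bad \<le> 50000 * B ^ 3 / real n"
proof -
  have n0: "0 < real n" using n_ge by simp
  have "(\<Sum>i<n. expec (\<lambda>A. (x i A) ^ 4)) \<le> (\<Sum>i<n. 176 * eta\<^sup>2)"
    by (intro sum_mono expec_x4) simp
  also have "\<dots> = 176 * B\<^sup>2 / real n" using n0 by (simp add: B_def power2_eq_square)
  also have "\<dots> \<le> 176 * B ^ 3 / real n"
    using B_ge n0 by (intro divide_right_mono mult_left_mono power_increasing) auto
  finally have 1: "256 * (\<Sum>i<n. expec (\<lambda>A. (x i A) ^ 4)) \<le> 45056 * B ^ 3 / real n" by simp
  have "36 * b\<^sup>2 * expec U / (real n - 2)\<^sup>2 \<le> 36 * B\<^sup>2 * (3 * real n * B) / (real n - 2)\<^sup>2"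
    using b_le_B expec_U b_ge n2 B_ge expec_nonneg[of U] U_nonneg
    by (intro divide_right_mono mult_mono power_mono) auto
  also have "\<dots> = 108 * B ^ 3 / real n * (real n / (real n - 2))\<^sup>2"
    using n0 by (simp add: power2_eq_square power3_eq_cube)
  also have "\<dots> \<le> 108 * B ^ 3 / real n * 3\<^sup>2"
    using B_ge n0 n2 by (intro mult_left_mono power_mono n_div) auto
  finally have 2: "36 * b\<^sup>2 * expec U / (real n - 2)\<^sup>2 \<le> 972 * B ^ 3 / real n" by simp
  have "expec bad = 256 * (\<Sum>i<n. expec (\<lambda>A. (x i A) ^ 4)) + 36 * b\<^sup>2 * expec U / (real n - 2)\<^sup>2"
    unfolding bad_def[abs_def] by (simp only: expec_linear)
  also have "\<dots> \<le> 45056 * B ^ 3 / real n + 972 * B ^ 3 / real n" using 1 2 by simp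
  also have "\<dots> \<le> 50000 * B ^ 3 / real n"
    unfolding add_divide_distrib[symmetric] using n0 B_ge by (intro divide_right_mono) auto
  finally show ?thesis .
qed

text \<open>The null set enters through two properties: it contains every shift of
  \<open>beta\<close> supported on the free nodes, and its members differ from \<open>beta\<close>
  by a constant on the block.\<close>

lemma sup_loglik_bound:
  assumes bad: "bad A < 1"
    and lower: "\<And>y. (\<And>i. i < k \<Longrightarrow> y i = 0) \<Longrightarrow> \<Theta> (\<lambda>i. beta i + y i)"
    and upper: "\<And>b' i j. \<Theta> b' \<Longrightarrow> i < k \<Longrightarrow> j < k \<Longrightarrow> b' i - beta i = b' j - beta j"
  shows "\<bar>(SUP b'\<in>{b'. \<Theta> b'}. loglik n A b') - loglik n A beta - stat A / 2\<bar> \<le> err A"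
proof -
  have "\<Theta> (\<lambda>i. beta i + x i A)" by (rule lower) (simp add: x_def c_def)
  moreover have "bdd_above ((\<lambda>b'. loglik n A b') ` {b'. \<Theta> b'})"
    using loglik_nonpos by (intro bdd_aboveI[of _ 0]) auto
  ultimately have "loglik n A (\<lambda>i. beta i + x i A) \<le> (SUP b'\<in>{b'. \<Theta> b'}. loglik n A b')"
    by (intro cSUP_upper) auto
  moreover have "(SUP b'\<in>{b'. \<Theta> b'}. loglik n A b') \<le> loglik n A beta + stat A / 2 + err A"
  proof (rule cSUP_least)
    show "{b'. \<Theta> b'} \<noteq> {}" using \<open>\<Theta> (\<lambda>i. beta i + x i A)\<close> by auto
    fix b' assume "b' \<in> {b'. \<Theta> b'}"
    then have "loglik n A (\<lambda>i. beta i + (b' i - beta i)) - loglik n A beta \<le> stat A / 2 + err A"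
      by (intro loglik_upper bad upper) auto
    then show "loglik n A b' \<le> loglik n A beta + stat A / 2 + err A" by simp
  qed
  ultimately show ?thesis using loglik_lower[of A] by (simp add: abs_le_iff)
qed

end

section \<open>Central limit theorem for the sum of squared standardized degrees\<close>

context beta_graph_sub
begin

definition r :: real where "r = real (card S)"
definition s :: real where "s = sqrt (2 * r)"

lemma sum_V_c: "(\<Sum>i<n. V i * c i) = r"
proof -
  have "(\<Sum>i<n. V i * c i) = (\<Sum>i\<in>S. 1)"
    unfolding V_c using S_sub by (intro sum.mono_neutral_cong_right) auto
  then show ?thesis by (simp add: r_def)
qed

lemma sum_c_le: "(\<Sum>i<n. c i) \<le> r * eta"
proof -
  have "(\<Sum>i<n. c i) = (\<Sum>i\<in>S. c i)"
    using S_sub by (intro sum.mono_neutral_right) (auto simp: c_def)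
  also have "\<dots> \<le> (\<Sum>i\<in>S. eta)" by (intro sum_mono c_le)
  finally show ?thesis by (simp add: r_def)
qed

text \<open>Brings \<open>N\<close> into the form to which integration by parts applies edge by
  edge.\<close>

lemma N_eq: "N A = (\<Sum>e\<in>E. eps e A * X e A)"
proof -
  have "N A = (\<Sum>i<n. x i A * row n (\<lambda>e. eps e A) i)"
    by (simp add: N_def x_def xi_def power2_eq_square mult.assoc)
  then show ?thesis by (simp add: sum_mult_row X_def)
qed

lemma expec_N: "expec N = r"
proof -
  have "expec N = (\<Sum>i<n. c i * expec (\<lambda>A. (xi i A)\<^sup>2))"
    unfolding N_def[abs_def] by (simp only: expec_linear)
  also have "\<dots> = (\<Sum>i<n. V i * c i)"
    by (intro sum.cong refl) (simp add: expec_xi2)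
  finally show ?thesis by (simp add: sum_V_c)
qed

lemma ends_c: "0 \<le> ends c e" "ends c e \<le> 2 * eta" "(ends c e)\<^sup>2 \<le> 2 * ends (\<lambda>i. (c i)\<^sup>2) e"
  using c_nonneg[of "fst e"] c_nonneg[of "snd e"] c_le[of "fst e"] c_le[of "snd e"] ends_square_le[of c e]
  by (simp_all add: ends_def)

lemma sum_v_ends_c_square: "(\<Sum>e\<in>E. v e * (ends c e)\<^sup>2) \<le> 2 * (r * eta)"
proof -
  have "(\<Sum>e\<in>E. v e * (ends c e)\<^sup>2) \<le> (\<Sum>e\<in>E. v e * (2 * ends (\<lambda>i. (c i)\<^sup>2) e))"
    by (intro sum_mono mult_left_mono ends_c v_nonneg)
  also have "\<dots> = 2 * (\<Sum>e\<in>E. v e * ends (\<lambda>i. (c i)\<^sup>2) e)"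
    by (simp add: sum_distrib_left mult.left_commute)
  also have "\<dots> = 2 * (\<Sum>i<n. c i)" unfolding sum_v_ends by (simp add: V_c_square)
  finally show ?thesis using sum_c_le by simp
qed

lemma sum_v_expec_X2: "(\<Sum>e\<in>E. v e * expec (\<lambda>A. (X e A)\<^sup>2)) \<le> 2 * r"
proof -
  have "(\<Sum>e\<in>E. v e * expec (\<lambda>A. (X e A)\<^sup>2)) = expec (\<lambda>A. \<Sum>e\<in>E. v e * (X e A)\<^sup>2)"
    by (simp only: expec_linear)
  also have "\<dots> \<le> expec (\<lambda>A. 2 * N A)"
  proof (rule expec_mono)
    fix A
    have "(\<Sum>e\<in>E. v e * (X e A)\<^sup>2) \<le> (\<Sum>e\<in>E. v e * (2 * ends (\<lambda>i. (x i A)\<^sup>2) e))"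
      unfolding X_def by (intro sum_mono mult_left_mono ends_square_le v_nonneg)
    also have "\<dots> = 2 * (\<Sum>e\<in>E. v e * ends (\<lambda>i. (x i A)\<^sup>2) e)"
      by (simp add: sum_distrib_left mult.left_commute)
    finally show "(\<Sum>e\<in>E. v e * (X e A)\<^sup>2) \<le> 2 * N A"
      unfolding sum_v_ends sum_V_x_square .
  qed
  finally show ?thesis by (simp add: expec_cmult expec_N)
qed

text \<open>Order r is small enough: in the differential equation this quantity is divided by
  s^3.\<close>

lemma sum_v_expec_X4: "(\<Sum>e\<in>E. v e * expec (\<lambda>A. (X e A) ^ 4)) \<le> 136 * r"
proof -
  have X4: "(X e A) ^ 4 \<le> 8 * ends (\<lambda>i. (x i A) ^ 4) e" for e A
  proof -
    have "((X e A)\<^sup>2)\<^sup>2 \<le> (2 * ends (\<lambda>i. (x i A)\<^sup>2) e)\<^sup>2"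
      unfolding X_def by (intro power_mono ends_square_le) auto
    also have "\<dots> \<le> 8 * ends (\<lambda>i. ((x i A)\<^sup>2)\<^sup>2) e"
      using ends_square_le[of "\<lambda>i. (x i A)\<^sup>2" e] by (simp add: power_mult_distrib)
    finally show ?thesis by simp
  qed
  have x4: "V i * expec (\<lambda>A. (x i A) ^ 4) \<le> 17 * (V i * c i)" if i: "i < n" for i
  proof -
    have V0: "0 \<le> V i" using V_pos[OF i] by simp
    have sv: "var (\<lambda>e. c i * inc e i) = c i"
      unfolding var_inc[OF i] using V_c_square[of i] by (metis mult.commute)
    have "expec (\<lambda>A. (x i A) ^ 4) \<le> 9 * (var (\<lambda>e. c i * inc e i))\<^sup>2 + 2 * 1\<^sup>2 * var (\<lambda>e. c i * inc e i)"
      unfolding x_eq_lin[OF i]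
    proof (rule expec_lin_fourth)
      fix e show "\<bar>c i * inc e i\<bar> \<le> 1"
        using c_nonneg[of i] c_le[of i] eta_le_1 by (auto simp: inc_def)
    qed
    then have "expec (\<lambda>A. (x i A) ^ 4) \<le> 9 * (c i)\<^sup>2 + 2 * c i" unfolding sv by simp
    also have "\<dots> \<le> 17 * c i"
    proof -
      have "c i * c i \<le> 1 * c i"
        using c_nonneg[of i] c_le[of i] eta_le_1 by (intro mult_right_mono) auto
      then show ?thesis using c_nonneg[of i] by (simp add: power2_eq_square)
    qed
    finally show ?thesis using mult_left_mono[OF _ V0] by (metis mult.left_commute)
  qed
  have "(\<Sum>e\<in>E. v e * expec (\<lambda>A. (X e A) ^ 4)) \<le> (\<Sum>e\<in>E. v e * expec (\<lambda>A. 8 * ends (\<lambda>i. (x i A) ^ 4) e))"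
    by (intro sum_mono mult_left_mono expec_mono X4 v_nonneg)
  also have "\<dots> = 8 * (\<Sum>e\<in>E. v e * ends (\<lambda>i. expec (\<lambda>A. (x i A) ^ 4)) e)"
    by (simp add: ends_def expec_linear sum_distrib_left mult.left_commute)
  also have "\<dots> \<le> 8 * (\<Sum>i<n. 17 * (V i * c i))"
    unfolding sum_v_ends by (intro mult_left_mono sum_mono x4) auto
  finally show ?thesis by (simp add: sum_distrib_left[symmetric] sum_V_c)
qed

text \<open>A flip moves the centred degrees at the two ends of \<open>e\<close> by one unit, so the
  jump of a sum of squares is its derivative up to the squared unit steps, weighted by
  \<open>c\<close>.\<close>

lemma D_N: "e \<in> E \<Longrightarrow> \<bar>D e N A - 2 * X e A\<bar> \<le> ends c e"
proof -
  assume e: "e \<in> E"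
  let ?A1 = "A(e := True)" and ?A0 = "A(e := False)"
  have xi_upd: "xi i (A(e := y)) = xi i A + (of_bool y - of_bool (A e)) * inc e i" if "i < n" for i y
    using e that by (simp add: xi_eq_lin lin_upd)
  define sg :: real where "sg = (if A e then - 1 else 1)"
  have "D e N A = (\<Sum>i<n. c i * ((xi i ?A1)\<^sup>2 - (xi i ?A0)\<^sup>2))"
    by (simp add: D_def N_def sum_subtractf right_diff_distrib)
  also have "\<dots> = (\<Sum>i<n. inc e i * (2 * x i A + sg * c i))"
  proof (intro sum.cong refl)
    fix i assume "i \<in> {..<n}"
    then have i: "i < n" by simp
    have "inc e i * inc e i = inc e i" by (simp add: inc_def)
    then have "(xi i ?A1)\<^sup>2 - (xi i ?A0)\<^sup>2 = inc e i * (2 * xi i A + sg)"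
      unfolding xi_upd[OF i] by (cases "A e") (simp_all add: sg_def power2_eq_square algebra_simps)
    then show "c i * ((xi i ?A1)\<^sup>2 - (xi i ?A0)\<^sup>2) = inc e i * (2 * x i A + sg * c i)"
      by (simp add: x_def algebra_simps)
  qed
  also have "\<dots> = 2 * X e A + sg * ends c e"
    unfolding sum_inc[OF e] by (simp add: X_def ends_def algebra_simps)
  finally have "D e N A - 2 * X e A = sg * ends c e" by simp
  then show ?thesis using ends_c(1)[of e] by (simp add: sg_def)
qed

lemma abs_D_N: "e \<in> E \<Longrightarrow> \<bar>D e N A\<bar> \<le> 2 * \<bar>X e A\<bar> + ends c e"
  using D_N[of e A] by (simp add: abs_le_iff) linarith

lemma D_N_square: "e \<in> E \<Longrightarrow> (D e N A)\<^sup>2 \<le> 8 * (X e A)\<^sup>2 + 2 * (ends c e)\<^sup>2"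
proof -
  assume e: "e \<in> E"
  have "\<bar>D e N A\<bar>\<^sup>2 \<le> (2 * \<bar>X e A\<bar> + ends c e)\<^sup>2"
    by (intro power_mono abs_D_N e) auto
  also have "\<dots> \<le> 2 * ((2 * \<bar>X e A\<bar>)\<^sup>2 + (ends c e)\<^sup>2)" by (rule power2_sum_le)
  finally show ?thesis by (simp add: power_mult_distrib)
qed

text \<open>A law of large numbers: it lets \<open>N\<close> be replaced by \<open>r\<close> in the
  main term produced by the integration by parts.\<close>

lemma expec_abs_N:
  assumes r: "0 < r"
  shows "expec (\<lambda>A. \<bar>N A - r\<bar>) \<le> 11 * sqrt r"
proof -
  have D: "D e (\<lambda>A. N A - r) = D e N" for e by (simp add: D_def fun_eq_iff)
  have E0: "expec (\<lambda>A. N A - r) = 0" by (simp add: expec_linear expec_N)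
  have "expec (\<lambda>A. (N A - r)\<^sup>2) \<le> (\<Sum>e\<in>E. v e * expec (\<lambda>A. (D e N A)\<^sup>2))"
    using efron_stein[of "\<lambda>A. N A - r"] unfolding D E0 by simp
  also have "\<dots> \<le> (\<Sum>e\<in>E. v e * expec (\<lambda>A. 8 * (X e A)\<^sup>2 + 2 * (ends c e)\<^sup>2))"
    by (intro sum_mono mult_left_mono expec_mono D_N_square v_nonneg)
  also have "\<dots> = 8 * (\<Sum>e\<in>E. v e * expec (\<lambda>A. (X e A)\<^sup>2)) + 2 * (\<Sum>e\<in>E. v e * (ends c e)\<^sup>2)"
    by (simp add: expec_linear sum.distrib sum_distrib_left algebra_simps)
  also have "\<dots> \<le> 8 * (2 * r) + 2 * (2 * (r * eta))"
    using sum_v_expec_X2 sum_v_ends_c_square by (intro add_mono mult_left_mono) auto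
  also have "\<dots> \<le> 20 * r" using eta_le_1 r mult_left_mono[of eta 1 r] by simp
  finally have "expec (\<lambda>A. (N A - r)\<^sup>2) / (2 * sqrt r) \<le> 20 * r / (2 * sqrt r)"
    using r by (intro divide_right_mono) auto
  also have "\<dots> = 10 * sqrt r" using r by (simp add: field_simps)
  finally have "expec (\<lambda>A. (N A - r)\<^sup>2) / (2 * sqrt r) \<le> 10 * sqrt r" .
  moreover have "0 < sqrt r" using r by simp
  ultimately show ?thesis
    using expec_abs_le[of "sqrt r" "\<lambda>A. N A - r"] by linarith
qed

end

section \<open>Elementary estimates for the product rule\<close>

lemma sin_diff_bound:
  fixes a h :: real
  shows "\<bar>sin (a + h) - sin a - h * cos a\<bar> \<le> h\<^sup>2 / 2"
proof -
  \<comment> \<open>The second-order remainder of the complex exponential; the claim concerns the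
    imaginary part of its rotation by \<open>a\<close>.\<close>
  define w where "w = cis h - (1 + \<i> * complex_of_real h)"
  have "cmod w \<le> h\<^sup>2 / 2"
    using iexp_approx1[of h 1] by (simp add: w_def cis_conv_exp power2_eq_square)
  moreover have "sin (a + h) - sin a - h * cos a = Im (cis a * w)"
    by (simp add: w_def sin_add algebra_simps)
  moreover have "\<bar>Im (cis a * w)\<bar> \<le> cmod w"
    using abs_Im_le_cmod[of "cis a * w"] by (simp add: norm_mult)
  ultimately show ?thesis by simp
qed

lemma abs_sin_diff_le:
  fixes x y :: real
  shows "\<bar>sin x - sin y\<bar> \<le> \<bar>x - y\<bar>"
proof -
  have "\<bar>sin x - sin y\<bar> = 2 * \<bar>sin ((x - y) / 2)\<bar> * \<bar>cos ((x + y) / 2)\<bar>"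
    by (simp add: sin_diff_sin abs_mult)
  also have "\<dots> \<le> 2 * \<bar>(x - y) / 2\<bar> * 1"
    by (intro mult_mono abs_sin_x_le_abs_x) auto
  finally show ?thesis by simp
qed

text \<open>\<open>y\<close>, \<open>sn\<close>, \<open>co\<close> are the values of \<open>X e\<close>, of the sine and of the cosine at the current configuration,
  \<open>ds\<close> and \<open>dn\<close> are the differences of the sine and of the statistic along the edge.\<close>
lemma product_difference_bound:
  fixes y a ds dn sn co k g sg :: real
  assumes a: "0 \<le> a" and ds: "\<bar>ds - k * dn * co\<bar> \<le> (k * dn)\<^sup>2 / 2" "\<bar>ds\<bar> \<le> \<bar>k * dn\<bar>"
    and co: "\<bar>co\<bar> \<le> 1" and dn: "\<bar>dn - 2 * y\<bar> \<le> a" and sg: "\<bar>sg\<bar> \<le> 1"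
    and g: "g = a * sn + y * ds + sg * a * ds"
  shows "\<bar>g - a * sn - k * (2 * y\<^sup>2 * co)\<bar> \<le> \<bar>k\<bar> * (3 * a * \<bar>y\<bar> + a\<^sup>2) + k\<^sup>2 / 2 * (\<bar>y\<bar> * (2 * \<bar>y\<bar> + a)\<^sup>2)"
proof -
  have dn': "\<bar>dn\<bar> \<le> 2 * \<bar>y\<bar> + a" using dn by (simp add: abs_le_iff) linarith
  have 1: "\<bar>y * (ds - k * dn * co)\<bar> \<le> k\<^sup>2 / 2 * (\<bar>y\<bar> * (2 * \<bar>y\<bar> + a)\<^sup>2)"
  proof -
    have "dn\<^sup>2 \<le> (2 * \<bar>y\<bar> + a)\<^sup>2" using power_mono[OF dn', of 2] by simp
    then have "(k * dn)\<^sup>2 / 2 \<le> k\<^sup>2 / 2 * (2 * \<bar>y\<bar> + a)\<^sup>2"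
      by (simp add: power_mult_distrib mult_left_mono)
    then have "\<bar>y\<bar> * \<bar>ds - k * dn * co\<bar> \<le> \<bar>y\<bar> * (k\<^sup>2 / 2 * (2 * \<bar>y\<bar> + a)\<^sup>2)"
      using ds(1) by (intro mult_left_mono) auto
    then show ?thesis by (simp add: abs_mult mult_ac)
  qed
  have 2: "\<bar>k * y * co * (dn - 2 * y)\<bar> \<le> \<bar>k\<bar> * (a * \<bar>y\<bar>)"
  proof -
    have "\<bar>k\<bar> * \<bar>y\<bar> * \<bar>co\<bar> * \<bar>dn - 2 * y\<bar> \<le> \<bar>k\<bar> * \<bar>y\<bar> * 1 * a"
      using co dn a by (intro mult_mono) auto
    then show ?thesis by (simp add: abs_mult mult_ac)
  qed
  have 3: "\<bar>sg * a * ds\<bar> \<le> \<bar>k\<bar> * (a * (2 * \<bar>y\<bar> + a))"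
  proof -
    have "\<bar>ds\<bar> \<le> \<bar>k\<bar> * (2 * \<bar>y\<bar> + a)"
      using ds(2) mult_left_mono[OF dn', of "\<bar>k\<bar>"] by (simp add: abs_mult)
    then have "\<bar>sg\<bar> * a * \<bar>ds\<bar> \<le> 1 * a * (\<bar>k\<bar> * (2 * \<bar>y\<bar> + a))"
      using sg a by (intro mult_mono) auto
    then show ?thesis using a by (simp add: abs_mult mult_ac)
  qed
  have "g - a * sn - k * (2 * y\<^sup>2 * co) = y * (ds - k * dn * co) + k * y * co * (dn - 2 * y) + sg * a * ds"
    unfolding g by (simp add: power2_eq_square algebra_simps)
  also have "\<bar>\<dots>\<bar> \<le> k\<^sup>2 / 2 * (\<bar>y\<bar> * (2 * \<bar>y\<bar> + a)\<^sup>2) + \<bar>k\<bar> * (a * \<bar>y\<bar>) + \<bar>k\<bar> * (a * (2 * \<bar>y\<bar> + a))"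
    by (rule order_trans[OF abs_triangle_ineq add_mono[OF order_trans[OF abs_triangle_ineq add_mono[OF 1 2]] 3]])
  also have "\<dots> = \<bar>k\<bar> * (3 * a * \<bar>y\<bar> + a\<^sup>2) + k\<^sup>2 / 2 * (\<bar>y\<bar> * (2 * \<bar>y\<bar> + a)\<^sup>2)"
    by (simp add: power2_eq_square algebra_simps)
  finally show ?thesis .
qed

text \<open>Separates \<open>a\<close> from \<open>y\<close>, so that only second and fourth moments
  remain. The AM-GM weight \<open>l\<close> is later sqrt eta.\<close>

lemma product_difference_bound':
  fixes y a l k :: real
  assumes a: "0 \<le> a" "a \<le> 2" and l: "0 < l"
  shows "\<bar>k\<bar> * (3 * a * \<bar>y\<bar> + a\<^sup>2) + k\<^sup>2 / 2 * (\<bar>y\<bar> * (2 * \<bar>y\<bar> + a)\<^sup>2)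
    \<le> \<bar>k\<bar> * (2 * l * y\<^sup>2 + 2 * a\<^sup>2 / l + a\<^sup>2) + k\<^sup>2 * (4 * y\<^sup>2 + 2 * y ^ 4 + a\<^sup>2)"
proof (intro add_mono mult_left_mono)
  have "0 \<le> (l * \<bar>y\<bar> - a)\<^sup>2" by simp
  then have "2 * l * (a * \<bar>y\<bar>) \<le> l\<^sup>2 * y\<^sup>2 + a\<^sup>2" by (simp add: power2_diff power_mult_distrib algebra_simps)
  then have "2 * (a * \<bar>y\<bar>) \<le> l * y\<^sup>2 + a\<^sup>2 / l" using l by (simp add: field_simps power2_eq_square)
  moreover have "0 \<le> l * y\<^sup>2 + a\<^sup>2 / l" using l by simp
  moreover have "2 * p \<le> z \<Longrightarrow> 0 \<le> z \<Longrightarrow> 3 * p \<le> 2 * z" for p z :: real by linarith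
  ultimately have "3 * (a * \<bar>y\<bar>) \<le> 2 * (l * y\<^sup>2 + a\<^sup>2 / l)" by blast
  then show "3 * a * \<bar>y\<bar> \<le> 2 * l * y\<^sup>2 + 2 * a\<^sup>2 / l" by (simp add: algebra_simps)
  have "\<bar>y\<bar> * (2 * \<bar>y\<bar> + a)\<^sup>2 \<le> \<bar>y\<bar> * (2 * ((2 * \<bar>y\<bar>)\<^sup>2 + a\<^sup>2))"
    using zero_le_power2[of "2 * \<bar>y\<bar> - a"]
    by (intro mult_left_mono) (auto simp: power2_eq_square algebra_simps)
  also have "\<dots> = 8 * (\<bar>y\<bar> * y\<^sup>2) + 2 * (\<bar>y\<bar> * a\<^sup>2)" by (simp add: power_mult_distrib algebra_simps)
  also have "\<dots> \<le> 8 * ((y\<^sup>2 + y ^ 4) / 2) + 2 * (2 * y\<^sup>2 + a\<^sup>2 / 2)"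
  proof (intro add_mono mult_left_mono)
    have "0 \<le> (\<bar>y\<bar> - 1)\<^sup>2" by simp
    then have y1: "2 * \<bar>y\<bar> \<le> y\<^sup>2 + 1" by (simp add: power2_diff)
    from mult_right_mono[OF y1, of "y\<^sup>2"] show "\<bar>y\<bar> * y\<^sup>2 \<le> (y\<^sup>2 + y ^ 4) / 2"
      by (simp add: algebra_simps power2_eq_square power4_eq_xxxx)
    have "a\<^sup>2 * y\<^sup>2 \<le> 4 * y\<^sup>2" using power_mono[OF a(2,1), of 2] by (intro mult_right_mono) auto
    then show "\<bar>y\<bar> * a\<^sup>2 \<le> 2 * y\<^sup>2 + a\<^sup>2 / 2"
      using mult_right_mono[OF y1, of "a\<^sup>2"] by (simp add: algebra_simps)
  qed auto
  finally have "\<bar>y\<bar> * (2 * \<bar>y\<bar> + a)\<^sup>2 \<le> 2 * (4 * y\<^sup>2 + 2 * y ^ 4 + a\<^sup>2)"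
    by (rule order_trans) simp
  from mult_left_mono[OF this, of "k\<^sup>2 / 2"]
  show "k\<^sup>2 / 2 * (\<bar>y\<bar> * (2 * \<bar>y\<bar> + a)\<^sup>2) \<le> k\<^sup>2 * (4 * y\<^sup>2 + 2 * y ^ 4 + a\<^sup>2)"
    by (simp add: distrib_left distrib_right)
qed simp_all

lemma (in bernoulli_product) expec_has_derivative:
  assumes "\<And>A. ((\<lambda>t. f t A) has_real_derivative f' A) (at t)"
  shows "((\<lambda>t. expec (f t)) has_real_derivative expec f') (at t)"
proof -
  have eq: "expec g = (\<Sum>A\<in>set_pmf M. pmf M A * g A)" for g
    unfolding expec_def by (subst integral_measure_pmf[of "set_pmf M"]) (auto simp: finite_set_M)
  show ?thesis unfolding eq by (intro DERIV_sum DERIV_cmult assms)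
qed

section \<open>The approximate differential equation for the characteristic function\<close>

context beta_graph_sub
begin

text \<open>The shift \<open>\<theta>\<close> keeps the argument real: the cosine at \<theta> = 0
  and \<theta> = -pi/2 gives the real and imaginary parts of the characteristic function.\<close>

definition phase :: "real \<Rightarrow> real \<Rightarrow> (nat \<times> nat \<Rightarrow> bool) \<Rightarrow> real" where
  "phase \<theta> t A = t * ((N A - r) / s) + \<theta>"

definition \<phi> :: "real \<Rightarrow> real \<Rightarrow> real" where "\<phi> \<theta> t = expec (\<lambda>A. cos (phase \<theta> t A))"

definition \<delta> :: real where "\<delta> = 4 * sqrt eta + 152 / sqrt r + 18 * B\<^sup>2 / r"

lemma phi_deriv:
  "(\<phi> \<theta> has_real_derivative - (1 / s) * expec (\<lambda>A. (N A - r) * sin (phase \<theta> t A))) (at t)"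
proof -
  have cos': "((\<lambda>t. cos (t * w + \<theta>)) has_real_derivative - (w * sin (t * w + \<theta>))) (at t)" for w
    by (auto intro!: derivative_eq_intros)
  have "(\<phi> \<theta> has_real_derivative expec (\<lambda>A. - ((N A - r) / s * sin (phase \<theta> t A)))) (at t)"
    unfolding \<phi>_def[abs_def] phase_def by (rule expec_has_derivative) (rule cos')
  moreover have "- ((N A - r) / s * sin (phase \<theta> t A)) = - (1 / s) * ((N A - r) * sin (phase \<theta> t A))" for A
    by simp
  ultimately show ?thesis by (simp only: expec_cmult)
qed

lemma ends_inc_self: "ends (\<lambda>i. inc e i * c i) e = ends c e"
  by (simp add: ends_def inc_def)

text \<open>A discrete product rule. The main terms are the jump of \<open>X e\<close> times the
  sine, and \<open>X e\<close> times the derivative of the sine, in which the jump of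
  \<open>N\<close> is replaced by \<open>2 * X e A\<close>.\<close>

lemma D_X_sin:
  assumes e: "e \<in> E"
  shows "\<bar>D e (\<lambda>A. X e A * sin (phase \<theta> t A)) A - ends c e * sin (phase \<theta> t A)
      - t / s * (2 * (X e A)\<^sup>2 * cos (phase \<theta> t A))\<bar>
    \<le> \<bar>t / s\<bar> * (3 * ends c e * \<bar>X e A\<bar> + (ends c e)\<^sup>2)
      + (t / s)\<^sup>2 / 2 * (\<bar>X e A\<bar> * (2 * \<bar>X e A\<bar> + ends c e)\<^sup>2)"
proof -
  let ?A1 = "A(e := True)" and ?A0 = "A(e := False)"
  define sg :: real where "sg = (if A e then - 1 else 1)"
  define ds where "ds = sin (phase \<theta> t ?A1) - sin (phase \<theta> t ?A0)"
  have ph: "phase \<theta> t ?A1 - phase \<theta> t ?A0 = t / s * D e N A"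
  proof -
    have "t * ((a - r) / s) + \<theta> - (t * ((a' - r) / s) + \<theta>) = t / s * (a - a')" for a a'
      by (cases "s = 0") (simp_all add: field_simps)
    then show ?thesis by (simp only: phase_def D_def)
  qed
  have ds1: "\<bar>ds\<bar> \<le> \<bar>t / s * D e N A\<bar>"
    unfolding ds_def ph[symmetric] by (rule abs_sin_diff_le)
  \<comment> \<open>One endpoint of the flip is the current configuration. Expanding there, and not
    at a fixed endpoint, keeps sine and cosine evaluated at \<open>A\<close>.\<close>
  have cases: "?A1 = A \<and> sg = - 1 \<and> X e ?A0 = X e A - ends c e
      \<or> ?A0 = A \<and> sg = 1 \<and> X e ?A1 = X e A + ends c e"
    using e by (cases "A e") (simp_all add: sg_def fun_upd_idem X_upd ends_inc_self)
  have ds2: "\<bar>ds - t / s * D e N A * cos (phase \<theta> t A)\<bar> \<le> (t / s * D e N A)\<^sup>2 / 2"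
    using cases
  proof (elim disjE conjE)
    assume A1: "?A1 = A"
    have "phase \<theta> t ?A0 = phase \<theta> t A + - (t / s * D e N A)" using ph unfolding A1 by simp
    then have "ds - t / s * D e N A * cos (phase \<theta> t A)
        = - (sin (phase \<theta> t A + - (t / s * D e N A)) - sin (phase \<theta> t A)
          - - (t / s * D e N A) * cos (phase \<theta> t A))"
      unfolding ds_def A1 by simp
    then show ?thesis
      using sin_diff_bound[of "phase \<theta> t A" "- (t / s * D e N A)"] by (simp only: abs_minus power2_minus)
  next
    assume A0: "?A0 = A"
    have "phase \<theta> t ?A1 = phase \<theta> t A + t / s * D e N A" using ph unfolding A0 by simp
    then show ?thesis
      using sin_diff_bound[of "phase \<theta> t A" "t / s * D e N A"]
      unfolding ds_def A0 by simp
  qed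
  have g: "D e (\<lambda>A. X e A * sin (phase \<theta> t A)) A
      = ends c e * sin (phase \<theta> t A) + X e A * ds + sg * ends c e * ds"
  proof -
    have Dg: "D e (\<lambda>A. X e A * sin (phase \<theta> t A)) A
        = X e ?A1 * sin (phase \<theta> t ?A1) - X e ?A0 * sin (phase \<theta> t ?A0)"
      by (simp add: D_def)
    show ?thesis
      using cases
    proof (elim disjE conjE)
      assume A: "?A1 = A" and sg: "sg = - 1" and X0: "X e ?A0 = X e A - ends c e"
      show ?thesis unfolding Dg ds_def X0 sg A by (simp only: algebra_simps)
    next
      assume A: "?A0 = A" and sg: "sg = 1" and X1: "X e ?A1 = X e A + ends c e"
      show ?thesis unfolding Dg ds_def X1 sg A by (simp only: algebra_simps)
    qed
  qed
  show ?thesis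
    by (rule product_difference_bound[OF ends_c(1) ds2 ds1 _ D_N[OF e] _ g]) (auto simp: sg_def)
qed

text \<open>Integration by parts applied to N sin. The first main term of \<open>D_X_sin\<close>
  sums to \<open>r\<close> times the sine, since \<open>v e * ends c e\<close> sums to
  \<open>r\<close>; the second sums to the cosine times \<open>N + Q\<close>.\<close>

lemma expec_N_sin:
  assumes r: "0 < r"
  shows "\<bar>expec (\<lambda>A. N A * sin (phase \<theta> t A)) - r * expec (\<lambda>A. sin (phase \<theta> t A))
      - 2 * (t / s) * expec (\<lambda>A. cos (phase \<theta> t A) * (N A + Q A))\<bar>
    \<le> \<bar>t / s\<bar> * (10 * r * sqrt eta) + (t / s)\<^sup>2 * (282 * r)" (is "\<bar>?lhs\<bar> \<le> _")
proof -
  let ?sn = "\<lambda>A. sin (phase \<theta> t A)" and ?co = "\<lambda>A. cos (phase \<theta> t A)"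
  let ?l = "sqrt eta"
  have l: "0 < ?l" "eta \<le> ?l"
    using eta_pos eta_le_1 real_sqrt_le_1_iff[of eta] mult_left_mono[of "sqrt eta" 1 "sqrt eta"] by auto
  have 1: "expec (\<lambda>A. N A * ?sn A) = (\<Sum>e\<in>E. v e * expec (D e (\<lambda>A. X e A * ?sn A)))"
  proof -
    have "expec (\<lambda>A. N A * ?sn A) = (\<Sum>e\<in>E. expec (\<lambda>A. eps e A * (X e A * ?sn A)))"
      by (simp add: N_eq sum_distrib_right mult.assoc expec_sum)
    then show ?thesis by (simp add: expec_eps_mult)
  qed
  have 2: "r * expec ?sn = (\<Sum>e\<in>E. v e * expec (\<lambda>A. ends c e * ?sn A))"
  proof -
    have "(\<Sum>e\<in>E. v e * expec (\<lambda>A. ends c e * ?sn A)) = (\<Sum>e\<in>E. v e * ends c e) * expec ?sn"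
      by (simp add: expec_cmult sum_distrib_right mult.assoc)
    then show ?thesis by (simp add: sum_v_ends sum_V_c)
  qed
  have 3: "2 * (t / s) * expec (\<lambda>A. ?co A * (N A + Q A))
      = (\<Sum>e\<in>E. v e * expec (\<lambda>A. t / s * (2 * (X e A)\<^sup>2 * ?co A)))"
  proof -
    have "(\<Sum>e\<in>E. v e * expec (\<lambda>A. t / s * (2 * (X e A)\<^sup>2 * ?co A)))
        = expec (\<lambda>A. \<Sum>e\<in>E. v e * (t / s * (2 * (X e A)\<^sup>2 * ?co A)))"
      by (simp only: expec_linear)
    also have "\<dots> = expec (\<lambda>A. 2 * (t / s) * (?co A * (\<Sum>e\<in>E. v e * (X e A)\<^sup>2)))"
      by (simp add: sum_distrib_left mult_ac)
    finally show ?thesis by (simp only: sum_v_X_square expec_cmult)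
  qed
  have L: "?lhs = (\<Sum>e\<in>E. v e * expec (\<lambda>A. D e (\<lambda>A. X e A * ?sn A) A - ends c e * ?sn A
      - t / s * (2 * (X e A)\<^sup>2 * ?co A)))"
    unfolding 1 2 3 expec_diff right_diff_distrib sum_subtractf ..
  have "\<bar>?lhs\<bar> \<le> (\<Sum>e\<in>E. v e * expec (\<lambda>A. \<bar>t / s\<bar> * (2 * ?l * (X e A)\<^sup>2 + 2 * (ends c e)\<^sup>2 / ?l + (ends c e)\<^sup>2)
      + (t / s)\<^sup>2 * (4 * (X e A)\<^sup>2 + 2 * (X e A) ^ 4 + (ends c e)\<^sup>2)))"
    unfolding L
  proof (rule order_trans[OF sum_abs sum_mono])
    fix e assume e: "e \<in> E"
    have a: "0 \<le> ends c e" "ends c e \<le> 2" using ends_c[of e] eta_le_1 by auto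
    have "\<bar>expec (\<lambda>A. D e (\<lambda>A. X e A * ?sn A) A - ends c e * ?sn A - t / s * (2 * (X e A)\<^sup>2 * ?co A))\<bar>
      \<le> expec (\<lambda>A. \<bar>t / s\<bar> * (2 * ?l * (X e A)\<^sup>2 + 2 * (ends c e)\<^sup>2 / ?l + (ends c e)\<^sup>2)
      + (t / s)\<^sup>2 * (4 * (X e A)\<^sup>2 + 2 * (X e A) ^ 4 + (ends c e)\<^sup>2))"
      by (rule order_trans[OF abs_expec_le], rule expec_mono,
          rule order_trans[OF D_X_sin[OF e] product_difference_bound'[OF a l(1)]])
    then show "\<bar>v e * expec (\<lambda>A. D e (\<lambda>A. X e A * ?sn A) A - ends c e * ?sn A - t / s * (2 * (X e A)\<^sup>2 * ?co A))\<bar>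
      \<le> v e * expec (\<lambda>A. \<bar>t / s\<bar> * (2 * ?l * (X e A)\<^sup>2 + 2 * (ends c e)\<^sup>2 / ?l + (ends c e)\<^sup>2)
      + (t / s)\<^sup>2 * (4 * (X e A)\<^sup>2 + 2 * (X e A) ^ 4 + (ends c e)\<^sup>2))"
      unfolding abs_mult abs_of_pos[OF v_pos] by (rule mult_left_mono) (rule less_imp_le[OF v_pos])
  qed
  also have "\<dots> = (\<Sum>e\<in>E. \<bar>t / s\<bar> * (2 * ?l * (v e * expec (\<lambda>A. (X e A)\<^sup>2)) + 2 / ?l * (v e * (ends c e)\<^sup>2) + v e * (ends c e)\<^sup>2)
      + (t / s)\<^sup>2 * (4 * (v e * expec (\<lambda>A. (X e A)\<^sup>2)) + 2 * (v e * expec (\<lambda>A. (X e A) ^ 4)) + v e * (ends c e)\<^sup>2))"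
    by (intro sum.cong refl, simp only: expec_linear) (simp add: algebra_simps)
  also have "\<dots> = \<bar>t / s\<bar> * (2 * ?l * (\<Sum>e\<in>E. v e * expec (\<lambda>A. (X e A)\<^sup>2))
        + 2 / ?l * (\<Sum>e\<in>E. v e * (ends c e)\<^sup>2) + (\<Sum>e\<in>E. v e * (ends c e)\<^sup>2))
      + (t / s)\<^sup>2 * (4 * (\<Sum>e\<in>E. v e * expec (\<lambda>A. (X e A)\<^sup>2)) + 2 * (\<Sum>e\<in>E. v e * expec (\<lambda>A. (X e A) ^ 4))
        + (\<Sum>e\<in>E. v e * (ends c e)\<^sup>2))"
    by (simp only: sum.distrib sum_distrib_left[symmetric])
  also have "\<dots> \<le> \<bar>t / s\<bar> * (2 * ?l * (2 * r) + 2 / ?l * (2 * (r * eta)) + 2 * (r * eta))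
      + (t / s)\<^sup>2 * (4 * (2 * r) + 2 * (136 * r) + 2 * (r * eta))"
    using sum_v_expec_X2 sum_v_expec_X4 sum_v_ends_c_square l
    by (intro add_mono mult_left_mono) auto
  also have "\<dots> \<le> \<bar>t / s\<bar> * (10 * r * ?l) + (t / s)\<^sup>2 * (282 * r)"
  proof (intro add_mono mult_left_mono)
    \<comment> \<open>The weight sqrt eta balances the AM-GM split: both halves are of order r sqrt
      eta.\<close>
    have "2 / ?l * (2 * (r * eta)) = 4 * r * ?l" using eta_pos by (simp add: real_div_sqrt field_simps)
    moreover have "r * eta \<le> r * ?l" using r l by (intro mult_left_mono) auto
    ultimately show "2 * ?l * (2 * r) + 2 / ?l * (2 * (r * eta)) + 2 * (r * eta) \<le> 10 * r * ?l" by simp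
    show "4 * (2 * r) + 2 * (136 * r) + 2 * (r * eta) \<le> 282 * r"
      using mult_left_mono[OF eta_le_1, of r] r by simp
  qed auto
  finally show ?thesis .
qed

lemma phi_ode:
  assumes r: "0 < r"
  shows "\<exists>d. (\<phi> \<theta> has_real_derivative d) (at t) \<and> \<bar>d + t * \<phi> \<theta> t\<bar> \<le> (\<bar>t\<bar> + t\<^sup>2) * (2 * \<delta>)"
proof -
  let ?sn = "\<lambda>A. sin (phase \<theta> t A)" and ?co = "\<lambda>A. cos (phase \<theta> t A)"
  define L where "L = expec (\<lambda>A. N A * ?sn A) - r * expec ?sn - 2 * (t / s) * expec (\<lambda>A. ?co A * (N A + Q A))"
  define G where "G = expec (\<lambda>A. ?co A * ((N A - r) + Q A))"
  have s: "0 < s" "s\<^sup>2 = 2 * r" using r by (simp_all add: s_def)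
  have ss: "s * s = 2 * r" using s(2) by (simp add: power2_eq_square)
  have G: "expec (\<lambda>A. ?co A * (N A + Q A)) = r * \<phi> \<theta> t + G"
  proof -
    have "?co A * (N A + Q A) = r * ?co A + ?co A * ((N A - r) + Q A)" for A by (simp add: algebra_simps)
    then show ?thesis unfolding G_def \<phi>_def by (simp only: expec_add expec_cmult)
  qed
  have G_le: "\<bar>G\<bar> \<le> 11 * sqrt r + 18 * B\<^sup>2"
  proof -
    have "\<bar>G\<bar> \<le> expec (\<lambda>A. \<bar>?co A * ((N A - r) + Q A)\<bar>)" unfolding G_def by (rule abs_expec_le)
    also have "\<dots> \<le> expec (\<lambda>A. \<bar>N A - r\<bar> + \<bar>Q A\<bar>)"
    proof (rule expec_mono)
      fix A
      have "\<bar>?co A\<bar> * \<bar>(N A - r) + Q A\<bar> \<le> 1 * (\<bar>N A - r\<bar> + \<bar>Q A\<bar>)"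
        by (intro mult_mono abs_triangle_ineq) auto
      then show "\<bar>?co A * ((N A - r) + Q A)\<bar> \<le> \<bar>N A - r\<bar> + \<bar>Q A\<bar>" by (simp add: abs_mult)
    qed
    finally show ?thesis using expec_abs_N[OF r] expec_Q by (simp add: expec_add)
  qed
  \<comment> \<open>As s^2 = 2 r, the factor 2 t r / s^2 is \<open>t\<close>, and the main term
    cancels against \<open>t * \<phi> \<theta> t\<close>.\<close>
  have "- (1 / s) * expec (\<lambda>A. (N A - r) * ?sn A) + t * \<phi> \<theta> t = - (1 / s) * L - t / r * G"
  proof -
    have "expec (\<lambda>A. (N A - r) * ?sn A) = expec (\<lambda>A. N A * ?sn A) - r * expec ?sn"
      by (simp add: left_diff_distrib expec_linear)
    also have "\<dots> = L + 2 * (t / s) * (r * \<phi> \<theta> t + G)" unfolding L_def G by simp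
    finally have e: "expec (\<lambda>A. (N A - r) * ?sn A) = L + 2 * (t / s) * (r * \<phi> \<theta> t + G)" .
    have "- (1 / s) * (L + 2 * (t / s) * y) = - (1 / s) * L - 2 * t / (s * s) * y" for y
      using s by (simp add: field_simps)
    then have "- (1 / s) * expec (\<lambda>A. (N A - r) * ?sn A) = - (1 / s) * L - 2 * t / (s * s) * (r * \<phi> \<theta> t + G)"
      unfolding e .
    then show ?thesis unfolding ss using r by (simp add: field_simps)
  qed
  also have "\<bar>\<dots>\<bar> \<le> 1 / s * \<bar>L\<bar> + \<bar>t\<bar> / r * \<bar>G\<bar>"
    using abs_triangle_ineq4[of "- (1 / s) * L" "t / r * G"] s r by (simp add: abs_mult)
  also have "\<dots> \<le> 1 / s * (\<bar>t / s\<bar> * (10 * r * sqrt eta) + (t / s)\<^sup>2 * (282 * r)) + \<bar>t\<bar> / r * (11 * sqrt r + 18 * B\<^sup>2)"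
    using expec_N_sin[OF r, of \<theta> t] G_le s r unfolding L_def by (intro add_mono mult_left_mono) auto
  also have "\<dots> = \<bar>t\<bar> * (5 * sqrt eta) + t\<^sup>2 * (141 / s) + \<bar>t\<bar> * (11 / sqrt r + 18 * B\<^sup>2 / r)"
  proof -
    have "1 / s * (\<bar>t / s\<bar> * (10 * r * sqrt eta)) = \<bar>t\<bar> * (10 * r * sqrt eta) / (s * s)"
      using s by (simp add: abs_divide)
    also have "\<dots> = \<bar>t\<bar> * (5 * sqrt eta)" unfolding ss using r by simp
    finally have 1: "1 / s * (\<bar>t / s\<bar> * (10 * r * sqrt eta)) = \<bar>t\<bar> * (5 * sqrt eta)" .
    have "1 / s * ((t / s)\<^sup>2 * (282 * r)) = t\<^sup>2 * (282 * r) / (s * s) / s"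
      by (simp add: power_divide power2_eq_square)
    also have "\<dots> = t\<^sup>2 * (141 / s)" unfolding ss using r by simp
    finally have 2: "1 / s * ((t / s)\<^sup>2 * (282 * r)) = t\<^sup>2 * (141 / s)" .
    have sr: "sqrt r / r = 1 / sqrt r" using r by (simp add: field_simps)
    have "\<bar>t\<bar> / r * (11 * sqrt r + 18 * B\<^sup>2) = \<bar>t\<bar> * (11 * (sqrt r / r) + 18 * B\<^sup>2 / r)"
      by (simp add: distrib_left add_divide_distrib)
    then have 3: "\<bar>t\<bar> / r * (11 * sqrt r + 18 * B\<^sup>2) = \<bar>t\<bar> * (11 / sqrt r + 18 * B\<^sup>2 / r)"
      unfolding sr by simp
    show ?thesis unfolding distrib_left[of "1 / s"] 1 2 3 ..
  qed
  also have "\<dots> \<le> (\<bar>t\<bar> + t\<^sup>2) * (2 * \<delta>)"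
  proof -
    have "1 / s \<le> 1 / sqrt r" using r by (intro divide_left_mono) (auto simp: s_def)
    moreover have "0 \<le> sqrt eta" "0 \<le> 1 / sqrt r" "0 \<le> B\<^sup>2 / r" using eta_pos r by auto
    moreover have "y \<le> z \<Longrightarrow> 0 \<le> x \<Longrightarrow> 0 \<le> z \<Longrightarrow> 0 \<le> w \<Longrightarrow> 141 * y \<le> 2 * (4 * x + 152 * z + 18 * w)"
      for x y z w :: real by simp
    ultimately have "141 * (1 / s) \<le> 2 * (4 * sqrt eta + 152 * (1 / sqrt r) + 18 * (B\<^sup>2 / r))" by blast
    then have "141 / s \<le> 2 * \<delta>" unfolding \<delta>_def by simp
    then have "t\<^sup>2 * (141 / s) \<le> t\<^sup>2 * (2 * \<delta>)"
      by (intro mult_left_mono) auto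
    moreover have "5 * sqrt eta + (11 / sqrt r + 18 * B\<^sup>2 / r) \<le> 2 * \<delta>"
    proof -
      have "0 \<le> sqrt eta" "0 \<le> 1 / sqrt r" "0 \<le> B\<^sup>2 / r" using eta_pos r by auto
      moreover have "0 \<le> x \<Longrightarrow> 0 \<le> z \<Longrightarrow> 0 \<le> w \<Longrightarrow> 5 * x + (11 * z + 18 * w) \<le> 2 * (4 * x + 152 * z + 18 * w)"
        for x z w :: real by simp
      ultimately have "5 * sqrt eta + (11 * (1 / sqrt r) + 18 * (B\<^sup>2 / r))
          \<le> 2 * (4 * sqrt eta + 152 * (1 / sqrt r) + 18 * (B\<^sup>2 / r))" by blast
      then show ?thesis unfolding \<delta>_def by simp
    qed
    then have "\<bar>t\<bar> * (5 * sqrt eta + (11 / sqrt r + 18 * B\<^sup>2 / r)) \<le> \<bar>t\<bar> * (2 * \<delta>)"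
      by (intro mult_left_mono) auto
    ultimately show ?thesis by (simp add: algebra_simps)
  qed
  finally show ?thesis using phi_deriv by blast
qed

text \<open>With the integrating factor exp(t^2 / 2) the approximate equation says that a function
  has small derivative, and the mean value inequality compares it with its value at 0.\<close>

lemma phi_approx:
  assumes r: "0 < r"
  shows "\<bar>\<phi> \<theta> t - cos \<theta> * exp (- t\<^sup>2 / 2)\<bar> \<le> \<bar>t\<bar> * (exp (t\<^sup>2 / 2) * ((\<bar>t\<bar> + t\<^sup>2) * (2 * \<delta>)))"
proof -
  define K where "K = exp (t\<^sup>2 / 2) * ((\<bar>t\<bar> + t\<^sup>2) * (2 * \<delta>))"
  define g where "g y = \<phi> \<theta> y * exp (y\<^sup>2 / 2)" for y
  have d0: "0 \<le> \<delta>" using r eta_pos by (simp add: \<delta>_def)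
  obtain d where d: "\<And>y. (\<phi> \<theta> has_real_derivative d y) (at y)"
      "\<And>y. \<bar>d y + y * \<phi> \<theta> y\<bar> \<le> (\<bar>y\<bar> + y\<^sup>2) * (2 * \<delta>)"
    using phi_ode[OF r, of \<theta>] by metis
  have g': "(g has_real_derivative exp (y\<^sup>2 / 2) * (d y + y * \<phi> \<theta> y)) (at y)" for y
    unfolding g_def[abs_def] by (auto intro!: derivative_eq_intros d(1) simp: algebra_simps)
  have bound: "\<bar>exp (y\<^sup>2 / 2) * (d y + y * \<phi> \<theta> y)\<bar> \<le> K" if "\<bar>y\<bar> \<le> \<bar>t\<bar>" for y
  proof -
    have y2: "y\<^sup>2 \<le> t\<^sup>2" using power_mono[OF that, of 2] by simp
    have "(\<bar>y\<bar> + y\<^sup>2) * (2 * \<delta>) \<le> (\<bar>t\<bar> + t\<^sup>2) * (2 * \<delta>)"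
      using that y2 d0 by (intro mult_right_mono add_mono) auto
    then have "\<bar>d y + y * \<phi> \<theta> y\<bar> \<le> (\<bar>t\<bar> + t\<^sup>2) * (2 * \<delta>)" using d(2)[of y] by simp
    then show ?thesis unfolding K_def abs_mult using y2 by (intro mult_mono) auto
  qed
  have "\<bar>g t - g 0\<bar> \<le> K * \<bar>t - 0\<bar>"
  proof -
    have "norm (g t - g 0) \<le> K * norm (t - 0)"
    proof (rule field_differentiable_bound[of "{- \<bar>t\<bar>..\<bar>t\<bar>}"])
      fix y assume "y \<in> {- \<bar>t\<bar>..\<bar>t\<bar>}"
      then show "norm (exp (y\<^sup>2 / 2) * (d y + y * \<phi> \<theta> y)) \<le> K" using bound[of y] by (auto simp: abs_le_iff)
      show "(g has_field_derivative exp (y\<^sup>2 / 2) * (d y + y * \<phi> \<theta> y)) (at y within {- \<bar>t\<bar>..\<bar>t\<bar>})"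
        using g' by (rule has_field_derivative_at_within)
    qed auto
    then show ?thesis by simp
  qed
  moreover have "g 0 = cos \<theta>" by (simp add: g_def \<phi>_def phase_def)
  ultimately have "exp (- t\<^sup>2 / 2) * \<bar>g t - cos \<theta>\<bar> \<le> 1 * (K * \<bar>t\<bar>)"
    by (intro mult_mono) auto
  moreover have "exp (- t\<^sup>2 / 2) * g t = \<phi> \<theta> t"
    unfolding g_def by (simp add: mult.left_commute mult_exp_exp)
  then have "exp (- t\<^sup>2 / 2) * \<bar>g t - cos \<theta>\<bar> = \<bar>\<phi> \<theta> t - cos \<theta> * exp (- t\<^sup>2 / 2)\<bar>"
    unfolding abs_mult_pos[OF less_imp_le[OF exp_gt_zero], symmetric] mult.commute[of "exp _"]
    by (metis (no_types, opaque_lifting) abs_mult abs_exp_cancel left_diff_distrib mult.commute)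
  ultimately show ?thesis unfolding K_def by (simp add: mult_ac)
qed

end

section \<open>Convergence of the likelihood ratio statistic\<close>

lemma abs_cos_diff_le:
  fixes x y :: real
  shows "\<bar>cos x - cos y\<bar> \<le> \<bar>x - y\<bar>"
  using abs_sin_diff_le[of "pi / 2 - x" "pi / 2 - y"] by (simp add: cos_sin_eq abs_minus_commute)

text \<open>Everything is expressed through q = b^3 / sqrt r. The constants come from 2 * 100000 * 8
  for \<open>bad\<close>, 3200 * 4 for \<open>err\<close> and 2 * 232 for
  \<open>H.\<delta>\<close>.\<close>

lemma lrt_norm_cos_bound:
  fixes n r :: nat and beta :: "nat \<Rightarrow> real" and b t \<theta> :: real
  assumes "beta_graph n beta b" and b_le: "b \<le> real n - 1" and r: "0 < r" "r \<le> n"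
    and lower: "\<And>y. (\<And>i. i < r \<Longrightarrow> y i = 0) \<Longrightarrow> \<Theta> (\<lambda>i. beta i + y i)"
    and upper: "\<And>b' i j. \<Theta> b' \<Longrightarrow> i < r \<Longrightarrow> j < r \<Longrightarrow> b' i - beta i = b' j - beta j"
  shows "\<bar>measure_pmf.expectation (beta_model n beta) (\<lambda>A. cos (t * lrt_norm n r \<Theta> A + \<theta>)) - cos \<theta> * exp (- t\<^sup>2 / 2)\<bar>
    \<le> (1600000 + 12800 * \<bar>t\<bar> + 464 * (\<bar>t\<bar> * (exp (t\<^sup>2 / 2) * (\<bar>t\<bar> + t\<^sup>2)))) * (b ^ 3 / sqrt (real r))"
proof -
  interpret beta_graph n beta b by fact
  interpret G0: beta_graph_null n beta b 0 by unfold_locales (use b_le in auto)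
  interpret Gr: beta_graph_null n beta b r by unfold_locales (use b_le r in auto)
  interpret H: beta_graph_sub n beta b "{..<r}" by unfold_locales (use b_le r in auto)
  have Hr: "H.r = real r" by (simp add: H.r_def)
  have Hs: "H.s = sqrt (2 * real r)" by (simp add: H.s_def Hr)
  have s0: "0 < H.s" using r by (simp add: Hs)
  define err where "err A = G0.err A + Gr.err A" for A
  define bad where "bad A = G0.bad A + Gr.bad A" for A
  have err0: "0 \<le> G0.err A" "0 \<le> Gr.err A" for A
    using G0.U_nonneg[of A] Gr.U_nonneg[of A] G0.n2 b_ge
    by (auto simp: G0.err_def Gr.err_def G0.K_def Gr.K_def intro!: add_nonneg_nonneg sum_nonneg)
  have bad0: "0 \<le> G0.bad A" "0 \<le> Gr.bad A" for A
    using G0.U_nonneg[of A] Gr.U_nonneg[of A]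
    by (auto simp: G0.bad_def Gr.bad_def intro!: add_nonneg_nonneg sum_nonneg)
  \<comment> \<open>The squares of the nodes constrained in neither problem cancel, which leaves
    exactly the first \<open>r\<close> nodes.\<close>
  have N: "H.N A = G0.stat A - Gr.stat A" for A
  proof -
    have "H.N A = (\<Sum>i<r. (xi i A)\<^sup>2 / V i)"
      unfolding H.N_def using r by (intro sum.mono_neutral_cong_right) (auto simp: H.c_def)
    moreover have "G0.stat A = (\<Sum>i<r. (xi i A)\<^sup>2 / V i) + Gr.stat A"
      unfolding G0.stat_def Gr.stat_def lessThan_atLeast0 using r
      by (simp add: sum.atLeastLessThan_concat)
    ultimately show ?thesis by simp
  qed
  let ?L = "lrt_norm n r \<Theta>"
  let ?W = "\<lambda>A. (H.N A - H.r) / H.s"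
  have point: "\<bar>cos (t * ?L A + \<theta>) - cos (t * ?W A + \<theta>)\<bar> \<le> 2 * bad A + \<bar>t\<bar> * (2 * err A / H.s)" for A
  proof (cases "bad A < 1")
    case True
    have b: "G0.bad A < 1" "Gr.bad A < 1" using True bad0[of A] by (auto simp: bad_def)
    have 0: "\<bar>(SUP b'. loglik n A b') - loglik n A beta - G0.stat A / 2\<bar> \<le> G0.err A"
      using G0.sup_loglik_bound[OF b(1), of "\<lambda>_. True"] by simp
    have 1: "\<bar>(SUP b'\<in>{b'. \<Theta> b'}. loglik n A b') - loglik n A beta - Gr.stat A / 2\<bar> \<le> Gr.err A"
      using b(2) lower upper by (rule Gr.sup_loglik_bound)
    have "\<bar>lrt n \<Theta> A - H.N A\<bar> \<le> 2 * err A"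
      using 0 1 unfolding lrt_def N err_def by (simp add: abs_le_iff)
    then have "\<bar>lrt n \<Theta> A - H.N A\<bar> / H.s \<le> 2 * err A / H.s"
      using s0 by (intro divide_right_mono) auto
    moreover have "?L A - ?W A = (lrt n \<Theta> A - H.N A) / H.s"
      by (simp add: lrt_norm_def Hs Hr diff_divide_distrib)
    ultimately have "\<bar>?L A - ?W A\<bar> \<le> 2 * err A / H.s" using s0 by simp
    then have "\<bar>t\<bar> * \<bar>?L A - ?W A\<bar> \<le> \<bar>t\<bar> * (2 * err A / H.s)" by (intro mult_left_mono) auto
    moreover have "\<bar>cos (t * ?L A + \<theta>) - cos (t * ?W A + \<theta>)\<bar> \<le> \<bar>t\<bar> * \<bar>?L A - ?W A\<bar>"
      using abs_cos_diff_le[of "t * ?L A + \<theta>" "t * ?W A + \<theta>"]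
      by (simp add: abs_mult[symmetric] right_diff_distrib)
    ultimately show ?thesis using bad0[of A] by (simp add: bad_def)
  next
    case False
    \<comment> \<open>Two cosines differ by at most 2, hence by at most \<open>2 * bad A\<close>
      here; this turns the exceptional event into an expectation.\<close>
    have "\<bar>cos (t * ?L A + \<theta>) - cos (t * ?W A + \<theta>)\<bar> \<le> \<bar>cos (t * ?L A + \<theta>)\<bar> + \<bar>cos (t * ?W A + \<theta>)\<bar>"
      by (rule abs_triangle_ineq4)
    also have "\<dots> \<le> 1 + 1" by (intro add_mono abs_cos_le_one)
    finally have "\<bar>cos (t * ?L A + \<theta>) - cos (t * ?W A + \<theta>)\<bar> \<le> 2 * bad A" using False by simp
    moreover have "0 \<le> \<bar>t\<bar> * (2 * err A / H.s)" using s0 err0[of A] by (simp add: err_def)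
    ultimately show ?thesis by simp
  qed
  define q where "q = b ^ 3 / sqrt (real r)"
  have r1: "1 \<le> sqrt (real r)" "sqrt (real r) * sqrt (real r) = real r" using r by auto
  have b1: "1 \<le> b" using b_ge by simp
  have B2b: "H.B \<le> 2 * b"
  proof -
    have "real n \<le> 2 * (real n - 1)" using n_ge by simp
    then have "real n * b / (real n - 1) \<le> 2 * (real n - 1) * b / (real n - 1)"
      using b1 n_ge by (intro divide_right_mono mult_right_mono) auto
    also have "2 * (real n - 1) * b / (real n - 1) = 2 * b"
      using n_ge nonzero_mult_div_cancel_left[of "real n - 1" "2 * b"] by (simp add: mult_ac)
    finally show ?thesis by (simp add: H.B_def eta_def)
  qed
  have B0: "0 \<le> H.B" using H.B_ge by simp
  have b3: "0 \<le> b ^ 3" "1 \<le> b ^ 3" "b\<^sup>2 \<le> b ^ 3" "b \<le> b ^ 3"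
    using b1 power_increasing[of 2 3 b] power_increasing[of 1 3 b] by auto
  have q0: "0 \<le> q" using b1 by (simp add: q_def)
  have inv: "1 / sqrt (real r) \<le> q" unfolding q_def using b3 by (intro divide_right_mono) auto
  have over_r: "y / real r \<le> k * q" if "y \<le> k * b ^ 3" "0 \<le> k" for y k
  proof -
    have "sqrt (real r) * 1 \<le> sqrt (real r) * sqrt (real r)" using r1 by (intro mult_left_mono) auto
    then have "sqrt (real r) \<le> real r" using r1(2) by simp
    then have "k * b ^ 3 / real r \<le> k * b ^ 3 / sqrt (real r)"
      using r that b3 by (intro divide_left_mono) auto
    moreover have "y / real r \<le> k * b ^ 3 / real r" using that by (intro divide_right_mono) auto
    ultimately show ?thesis by (simp add: q_def)
  qed
  have B2: "H.B\<^sup>2 \<le> 4 * b ^ 3"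
    using power_mono[OF B2b B0, of 2] b3 by (simp add: power_mult_distrib)
  have B3: "H.B ^ 3 \<le> 8 * b ^ 3"
    using power_mono[OF B2b B0, of 3] by (simp add: power_mult_distrib)
  have q3: "H.B ^ 3 / real n \<le> 8 * q"
  proof -
    have "H.B ^ 3 / real n \<le> H.B ^ 3 / real r" using r B0 by (intro divide_left_mono) auto
    then show ?thesis using over_r[OF B3] by simp
  qed
  have q2: "H.B\<^sup>2 / sqrt (real r) \<le> 4 * q"
    using divide_right_mono[OF B2, of "sqrt (real r)"] by (simp add: q_def)
  \<comment> \<open>Uses r <= n: eta <= 2 b / r <= 4 b^6 / r.\<close>
  have q_eta: "sqrt eta \<le> 2 * q"
  proof (rule real_le_lsqrt)
    have "eta = H.B / real n" using n_ge by (simp add: H.B_def)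
    also have "\<dots> \<le> 2 * b / real r" using B2b B0 r by (intro frac_le) auto
    also have "\<dots> \<le> 4 * (b ^ 3 * b ^ 3) / real r"
      using mult_mono[OF b3(4) b3(2)] b3 b1 by (intro divide_right_mono) auto
    also have "\<dots> = (2 * q)\<^sup>2" by (simp add: q_def power2_eq_square power_divide r1(2))
    finally show "eta \<le> (2 * q)\<^sup>2" .
  qed (use q0 in simp)
  \<comment> \<open>232 = 4 * 2 + 152 + 18 * 4.\<close>
  have del: "H.\<delta> \<le> 232 * q"
    using q_eta inv over_r[OF B2] unfolding H.\<delta>_def Hr by simp
  have bad_le: "expec bad \<le> 100000 * (H.B ^ 3 / real n)"
  proof -
    have "expec bad = expec G0.bad + expec Gr.bad" unfolding bad_def[abs_def] by (rule expec_add)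
    then show ?thesis using G0.expec_bad Gr.expec_bad by simp
  qed
  have err_le: "expec err \<le> 1600 * H.B\<^sup>2"
  proof -
    have "expec err = expec G0.err + expec Gr.err" unfolding err_def[abs_def] by (rule expec_add)
    then show ?thesis using G0.expec_err Gr.expec_err by simp
  qed
  have "\<bar>expec (\<lambda>A. cos (t * ?L A + \<theta>)) - H.\<phi> \<theta> t\<bar> \<le> expec (\<lambda>A. 2 * bad A + \<bar>t\<bar> * (2 * err A / H.s))"
    unfolding H.\<phi>_def H.phase_def expec_diff[symmetric]
    by (rule order_trans[OF abs_expec_le expec_mono[OF point]])
  also have "\<dots> = 2 * expec bad + \<bar>t\<bar> * (2 * expec err / H.s)"
    by (simp only: expec_add expec_cmult expec_divide)
  also have "\<dots> \<le> 2 * (100000 * (H.B ^ 3 / real n)) + \<bar>t\<bar> * (2 * (1600 * H.B\<^sup>2) / H.s)"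
    using bad_le err_le s0 by (intro add_mono mult_left_mono divide_right_mono) auto
  also have "\<dots> = 200000 * (H.B ^ 3 / real n) + \<bar>t\<bar> * (3200 * (H.B\<^sup>2 / H.s))" by simp
  also have "\<dots> \<le> 200000 * (8 * q) + \<bar>t\<bar> * (3200 * (4 * q))"
  proof -
    have "H.B\<^sup>2 / H.s \<le> H.B\<^sup>2 / sqrt (real r)"
      unfolding Hs using r by (intro divide_left_mono) auto
    then have "H.B\<^sup>2 / H.s \<le> 4 * q" using q2 by simp
    then show ?thesis using q3 by (intro add_mono mult_left_mono) auto
  qed
  finally have 1: "\<bar>expec (\<lambda>A. cos (t * ?L A + \<theta>)) - H.\<phi> \<theta> t\<bar> \<le> 1600000 * q + 12800 * \<bar>t\<bar> * q" by simp
  have "\<bar>H.\<phi> \<theta> t - cos \<theta> * exp (- t\<^sup>2 / 2)\<bar> \<le> \<bar>t\<bar> * (exp (t\<^sup>2 / 2) * ((\<bar>t\<bar> + t\<^sup>2) * (2 * H.\<delta>)))"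
    by (rule H.phi_approx) (use r Hr in simp)
  also have "\<dots> \<le> \<bar>t\<bar> * (exp (t\<^sup>2 / 2) * ((\<bar>t\<bar> + t\<^sup>2) * (2 * (232 * q))))"
    using del by (intro mult_left_mono) auto
  finally have 2: "\<bar>H.\<phi> \<theta> t - cos \<theta> * exp (- t\<^sup>2 / 2)\<bar> \<le> 464 * (\<bar>t\<bar> * (exp (t\<^sup>2 / 2) * (\<bar>t\<bar> + t\<^sup>2))) * q"
    by simp
  have "\<bar>expec (\<lambda>A. cos (t * ?L A + \<theta>)) - cos \<theta> * exp (- t\<^sup>2 / 2)\<bar>
      \<le> \<bar>expec (\<lambda>A. cos (t * ?L A + \<theta>)) - H.\<phi> \<theta> t\<bar> + \<bar>H.\<phi> \<theta> t - cos \<theta> * exp (- t\<^sup>2 / 2)\<bar>"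
    using abs_triangle_ineq[of "expec (\<lambda>A. cos (t * ?L A + \<theta>)) - H.\<phi> \<theta> t" "H.\<phi> \<theta> t - cos \<theta> * exp (- t\<^sup>2 / 2)"] by simp
  also have "\<dots> \<le> (1600000 + 12800 * \<bar>t\<bar> + 464 * (\<bar>t\<bar> * (exp (t\<^sup>2 / 2) * (\<bar>t\<bar> + t\<^sup>2)))) * q"
    unfolding distrib_right using 1 2 by (intro add_mono) auto
  finally show ?thesis unfolding q_def beta_model_eq expec_def .
qed

section \<open>From the bound for finite n to convergence in distribution\<close>

lemma bn_cn_facts:
  assumes n: "3 \<le> n"
  shows "beta_graph n beta (bn n beta)" "0 < cn n beta" "cn n beta \<le> bn n beta"
proof -
  let ?f = "\<lambda>i j. (1 + exp (beta i + beta j))\<^sup>2 / exp (beta i + beta j)"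
  let ?S = "{?f i j | i j. i < n \<and> j < n \<and> i \<noteq> j}"
  have "?S \<subseteq> (\<lambda>(i, j). ?f i j) ` ({..<n} \<times> {..<n})" by auto
  then have fin: "finite ?S" by (rule finite_subset) simp
  have mem: "?f 0 1 \<in> ?S" using n by (intro CollectI exI[of _ 0] exI[of _ 1]) auto
  have pos: "0 < z" if "z \<in> ?S" for z
  proof -
    have "1 + exp y \<noteq> 0" for y :: real using exp_gt_zero[of y] by linarith
    then show ?thesis using that by auto
  qed
  show "0 < cn n beta" unfolding cn_def using Min_in[OF fin] mem by (intro pos) auto
  have "cn n beta \<le> ?f 0 1" unfolding cn_def by (rule Min_le[OF fin mem])
  also have "\<dots> \<le> bn n beta" unfolding bn_def by (rule Max_ge[OF fin mem])
  finally show "cn n beta \<le> bn n beta" .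
  show "beta_graph n beta (bn n beta)"
  proof
    fix e assume e: "e \<in> node_pairs n"
    let ?E = "exp (beta (fst e) + beta (snd e))"
    have "?f (fst e) (snd e) \<in> ?S"
      using node_pairsD[OF e] by (intro CollectI exI[of _ "fst e"] exI[of _ "snd e"]) auto
    then have le: "?f (fst e) (snd e) \<le> bn n beta" unfolding bn_def by (rule Max_ge[OF fin])
    have p: "0 < 1 + ?E" by (simp add: add_pos_pos)
    have w: "edge_weight beta e * (1 - edge_weight beta e) = ?E / (1 + ?E)\<^sup>2"
    proof -
      have "1 - edge_weight beta e = 1 / (1 + ?E)"
        using p by (simp add: edge_weight_def edge_prob_def field_simps)
      then show ?thesis by (simp add: edge_weight_def edge_prob_def power2_eq_square)
    qed
    have "1 = ?f (fst e) (snd e) * (?E / (1 + ?E)\<^sup>2)" using p by simp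
    also have "\<dots> \<le> bn n beta * (?E / (1 + ?E)\<^sup>2)" using le by (intro mult_right_mono) auto
    finally show "1 \<le> bn n beta * (edge_weight beta e * (1 - edge_weight beta e))" unfolding w .
  qed (rule n)
qed

lemma lrt_norm_weak_conv:
  fixes beta :: "nat \<Rightarrow> nat \<Rightarrow> real" and r :: "nat \<Rightarrow> nat"
  assumes r_le: "\<And>n. r n \<le> n" and r_inf: "filterlim r at_top sequentially"
    and rate: "(\<lambda>n. bn n (beta n) ^ 3 / sqrt (real (r n))) \<longlonglongrightarrow> 0"
    and lower: "\<And>n y. (\<And>i. i < r n \<Longrightarrow> y i = 0) \<Longrightarrow> \<Theta> n (\<lambda>i. beta n i + y i)"
    and upper: "\<And>n b' i j. \<Theta> n b' \<Longrightarrow> i < r n \<Longrightarrow> j < r n \<Longrightarrow> b' i - beta n i = b' j - beta n j"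
  shows "weak_conv_m (\<lambda>n. distr (measure_pmf (beta_model n (beta n))) borel (lrt_norm n (r n) (\<Theta> n)))
    std_normal_distribution"
proof (rule levy_continuity)
  show "real_distribution (distr (measure_pmf (beta_model n (beta n))) borel (lrt_norm n (r n) (\<Theta> n)))" for n
    by (rule prob_space.real_distribution_distr[OF measure_pmf.prob_space_axioms]) simp
  show "real_distribution std_normal_distribution" by (rule real_dist_normal_dist)
  fix t :: real
  let ?q = "\<lambda>n. bn n (beta n) ^ 3 / sqrt (real (r n))"
  let ?M = "\<lambda>n. measure_pmf (beta_model n (beta n))" and ?L = "\<lambda>n. lrt_norm n (r n) (\<Theta> n)"
  \<comment> \<open>The rate condition implies \<open>eta <= 1\<close> for large n: b <= b^3 <=
    sqrt(r) / 2 <= sqrt(n) / 2 <= n - 1.\<close>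
  have ev: "eventually (\<lambda>n. 3 \<le> n \<and> 0 < r n \<and> bn n (beta n) \<le> real n - 1) sequentially"
  proof -
    have "eventually (\<lambda>n. ?q n < 1 / 2) sequentially"
      by (rule order_tendstoD(2)[OF rate]) simp
    moreover have "eventually (\<lambda>n. 0 < r n) sequentially"
    proof -
      have "eventually (\<lambda>n. 1 \<le> r n) sequentially" using r_inf by (simp only: filterlim_at_top)
      then show ?thesis by eventually_elim simp
    qed
    moreover have "eventually (\<lambda>n. 3 \<le> n) sequentially" by (rule eventually_ge_at_top)
    ultimately show ?thesis
    proof eventually_elim
      case (elim n)
      then interpret beta_graph n "beta n" "bn n (beta n)" by (intro bn_cn_facts)
      have "bn n (beta n) \<le> bn n (beta n) ^ 3"
        using b_ge power_increasing[of 1 3 "bn n (beta n)"] by simp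
      also have "\<dots> \<le> sqrt (real (r n)) / 2" using elim by (simp add: divide_less_eq)
      also have "\<dots> \<le> sqrt (real n) / 2" using r_le[of n] by simp
      also have "\<dots> \<le> real n - 1"
      proof -
        have "sqrt (real n) \<le> real n" using elim by (intro real_le_lsqrt) (auto simp: power2_eq_square)
        then show ?thesis using elim by simp
      qed
      finally show ?case using elim by simp
    qed
  qed
  have cosconv: "(\<lambda>n. measure_pmf.expectation (beta_model n (beta n)) (\<lambda>A. cos (t * ?L n A + \<theta>)))
      \<longlonglongrightarrow> cos \<theta> * exp (- t\<^sup>2 / 2)" for \<theta>
  proof -
    define k where "k = 1600000 + 12800 * \<bar>t\<bar> + 464 * (\<bar>t\<bar> * (exp (t\<^sup>2 / 2) * (\<bar>t\<bar> + t\<^sup>2)))"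
    have "(\<lambda>n. measure_pmf.expectation (beta_model n (beta n)) (\<lambda>A. cos (t * ?L n A + \<theta>)) - cos \<theta> * exp (- t\<^sup>2 / 2))
      \<longlonglongrightarrow> 0"
    proof (rule Lim_null_comparison)
      show "eventually (\<lambda>n. norm (measure_pmf.expectation (beta_model n (beta n)) (\<lambda>A. cos (t * ?L n A + \<theta>))
          - cos \<theta> * exp (- t\<^sup>2 / 2)) \<le> k * ?q n) sequentially"
        using ev
      proof eventually_elim
        case (elim n)
        then show ?case
          unfolding k_def real_norm_def
          by (intro lrt_norm_cos_bound bn_cn_facts r_le lower upper) auto
      qed
      show "(\<lambda>n. k * ?q n) \<longlonglongrightarrow> 0" using tendsto_mult_left[OF rate, of k] by simp
    qed
    then show ?thesis by (rule LIM_zero_cancel)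
  qed
  have re: "(\<lambda>n. measure_pmf.expectation (beta_model n (beta n)) (\<lambda>A. cos (t * ?L n A))) \<longlonglongrightarrow> exp (- t\<^sup>2 / 2)"
    using cosconv[of 0] by simp
  \<comment> \<open>Shifting the cosine by a quarter period gives the sine, and the limit vanishes
    because cos(-pi/2) = 0.\<close>
  have im: "(\<lambda>n. measure_pmf.expectation (beta_model n (beta n)) (\<lambda>A. sin (t * ?L n A))) \<longlonglongrightarrow> 0"
    using cosconv[of "- pi / 2"] by (simp add: cos_diff)
  have char: "char (distr (?M n) borel (?L n)) t
      = of_real (measure_pmf.expectation (beta_model n (beta n)) (\<lambda>A. cos (t * ?L n A)))
        + \<i> * of_real (measure_pmf.expectation (beta_model n (beta n)) (\<lambda>A. sin (t * ?L n A)))" if "3 \<le> n" for n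
  proof -
    interpret beta_graph n "beta n" "bn n (beta n)" using that by (rule bn_cn_facts)
    have fin: "finite (set_pmf (beta_model n (beta n)))" unfolding beta_model_eq by (rule finite_set_M)
    have int: "integrable (?M n) (f :: _ \<Rightarrow> complex)" for f by (rule integrable_measure_pmf_finite[OF fin])
    have euler: "iexp y = of_real (cos y) + \<i> * of_real (sin y)" for y
      by (simp add: exp_Euler cos_of_real sin_of_real)
    have "char (distr (?M n) borel (?L n)) t = (CLINT A|?M n. iexp (t * ?L n A))"
      unfolding char_def by (subst integral_distr) auto
    also have "\<dots> = (CLINT A|?M n. of_real (cos (t * ?L n A)) + \<i> * of_real (sin (t * ?L n A)))"
      by (simp only: euler)
    also have "\<dots> = (CLINT A|?M n. of_real (cos (t * ?L n A))) + (CLINT A|?M n. \<i> * of_real (sin (t * ?L n A)))"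
      by (rule Bochner_Integration.integral_add[OF int int])
    finally show ?thesis by simp
  qed
  have "(\<lambda>n. of_real (measure_pmf.expectation (beta_model n (beta n)) (\<lambda>A. cos (t * ?L n A)))
        + \<i> * of_real (measure_pmf.expectation (beta_model n (beta n)) (\<lambda>A. sin (t * ?L n A))))
      \<longlonglongrightarrow> of_real (exp (- t\<^sup>2 / 2)) + \<i> * complex_of_real 0"
    by (intro tendsto_intros re im)
  moreover have "eventually (\<lambda>n. of_real (measure_pmf.expectation (beta_model n (beta n)) (\<lambda>A. cos (t * ?L n A)))
        + \<i> * of_real (measure_pmf.expectation (beta_model n (beta n)) (\<lambda>A. sin (t * ?L n A)))
      = char (distr (?M n) borel (?L n)) t) sequentially"
    using eventually_ge_at_top[of 3] by eventually_elim (simp add: char)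
  ultimately show "(\<lambda>n. char (distr (?M n) borel (?L n)) t) \<longlonglongrightarrow> char std_normal_distribution t"
    by (simp add: char_std_normal_distribution tendsto_cong)
qed

text \<open>For n >= 3 the logarithm is at least 1, so dividing by its powers only strengthens the
  smallness condition.\<close>

lemma rate_from_smallo:
  fixes beta :: "nat \<Rightarrow> nat \<Rightarrow> real" and r :: "nat \<Rightarrow> nat" and m :: nat
  assumes small: "f \<in> o(\<lambda>n. sqrt (real (r n)) / (ln (real n)) ^ m)"
    and le: "\<And>n. 3 \<le> n \<Longrightarrow> bn n (beta n) ^ 3 \<le> f n"
  shows "(\<lambda>n. bn n (beta n) ^ 3 / sqrt (real (r n))) \<longlonglongrightarrow> 0"
proof (rule tendstoI)
  fix e :: real assume e: "0 < e"
  have "eventually (\<lambda>n. norm (f n) \<le> e / 2 * norm (sqrt (real (r n)) / (ln (real n)) ^ m)) sequentially"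
    using landau_o.smallD[OF small, of "e / 2"] e by simp
  then show "eventually (\<lambda>n. dist (bn n (beta n) ^ 3 / sqrt (real (r n))) 0 < e) sequentially"
    using eventually_ge_at_top[of 3]
  proof eventually_elim
    case (elim n)
    interpret beta_graph n "beta n" "bn n (beta n)" using elim by (intro bn_cn_facts) auto
    have "exp 1 \<le> real n" using exp_le elim by linarith
    then have "1 \<le> ln (real n)" using elim by (subst ln_ge_iff) auto
    then have l: "1 \<le> ln (real n) ^ m" by (rule one_le_power)
    have "bn n (beta n) ^ 3 \<le> norm (f n)" using le[of n] elim by simp
    also have "\<dots> \<le> e / 2 * (sqrt (real (r n)) / ln (real n) ^ m)" using elim l by simp
    also have "\<dots> \<le> e / 2 * (sqrt (real (r n)) / 1)"
      using e l by (intro mult_left_mono divide_left_mono) auto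
    finally have *: "bn n (beta n) ^ 3 \<le> e / 2 * sqrt (real (r n))" by simp
    have b0: "0 < bn n (beta n) ^ 3" using b_ge by simp
    from order_less_le_trans[OF this *] have "0 < sqrt (real (r n))" using e by (simp add: zero_less_mult_iff)
    then have "bn n (beta n) ^ 3 / sqrt (real (r n)) \<le> e / 2" using * by (simp add: divide_le_eq)
    moreover have "0 \<le> bn n (beta n) ^ 3 / sqrt (real (r n))" using b0 by simp
    ultimately show ?case unfolding dist_real_def diff_0_right using e by (simp only: abs_of_nonneg)
  qed
qed

theorem theorem1:
  fixes beta :: "nat \<Rightarrow> nat \<Rightarrow> real"   \<comment> \<open>true parameter beta^(n), n = number of nodes\<close>
    and r :: "nat \<Rightarrow> nat"
    and beta0 :: "nat \<Rightarrow> nat \<Rightarrow> real"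
  assumes r_le: "\<And>n. r n \<le> n"
    and r_inf: "filterlim r at_top sequentially"
  shows
    "((\<forall>n. \<forall>i < r n. beta n i = beta0 n i)
       \<and> (\<lambda>n. bn n (beta n) ^ 5 / cn n (beta n) ^ 2)
            \<in> o(\<lambda>n. sqrt (real (r n)) / (ln (real n)) ^ 2)
       \<longrightarrow> weak_conv_m
             (\<lambda>n. distr (measure_pmf (beta_model n (beta n))) borel
                (lrt_norm n (r n) (\<lambda>b. \<forall>i < r n. b i = beta0 n i)))
             std_normal_distribution)
     \<and> ((\<forall>n. \<forall>i < r n. \<forall>j < r n. beta n i = beta n j)
       \<and> (\<lambda>n. bn n (beta n) ^ 15 / cn n (beta n) ^ 9)
            \<in> o(\<lambda>n. sqrt (real (r n)) / (ln (real n)) ^ 3)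
       \<longrightarrow> weak_conv_m
             (\<lambda>n. distr (measure_pmf (beta_model n (beta n))) borel
                (lrt_norm n (r n) (\<lambda>b. \<forall>i < r n. \<forall>j < r n. b i = b j)))
             std_normal_distribution)"
proof (intro conjI impI; elim conjE)
  let ?b = "\<lambda>n. bn n (beta n)" and ?c = "\<lambda>n. cn n (beta n)"
  have bc: "1 \<le> ?b n" "0 < ?c n" "?c n \<le> ?b n" if "3 \<le> n" for n
    using bn_cn_facts[OF that, of "beta n"] beta_graph.b_ge[of n "beta n" "?b n"] by auto
  {
    assume null: "\<forall>n. \<forall>i<r n. beta n i = beta0 n i"
      and small: "(\<lambda>n. ?b n ^ 5 / ?c n ^ 2) \<in> o(\<lambda>n. sqrt (real (r n)) / (ln (real n)) ^ 2)"
    \<comment> \<open>Follows from c <= b, as b^3 c^2 <= b^5.\<close>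
    have "?b n ^ 3 \<le> ?b n ^ 5 / ?c n ^ 2" if "3 \<le> n" for n
    proof -
      have "?b n ^ 3 * ?c n ^ 2 \<le> ?b n ^ 3 * ?b n ^ 2"
        using bc[OF that] by (intro mult_left_mono power_mono) auto
      then show ?thesis using bc[OF that] by (simp add: le_divide_eq power_add[symmetric])
    qed
    then show "weak_conv_m (\<lambda>n. distr (measure_pmf (beta_model n (beta n))) borel
        (lrt_norm n (r n) (\<lambda>b. \<forall>i<r n. b i = beta0 n i))) std_normal_distribution"
      using null by (intro lrt_norm_weak_conv r_le r_inf rate_from_smallo[OF small]) auto
  }
  {
    assume null: "\<forall>n. \<forall>i<r n. \<forall>j<r n. beta n i = beta n j"
      and small: "(\<lambda>n. ?b n ^ 15 / ?c n ^ 9) \<in> o(\<lambda>n. sqrt (real (r n)) / (ln (real n)) ^ 3)"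
    \<comment> \<open>Here b^3 c^9 <= b^6 b^9, using b >= 1 besides c <= b.\<close>
    have "?b n ^ 3 \<le> ?b n ^ 15 / ?c n ^ 9" if "3 \<le> n" for n
    proof -
      have "?b n ^ 3 * ?c n ^ 9 \<le> ?b n ^ 6 * ?b n ^ 9"
        using bc[OF that] by (intro mult_mono power_mono power_increasing) auto
      then show ?thesis using bc[OF that] by (simp add: le_divide_eq power_add[symmetric])
    qed
    then show "weak_conv_m (\<lambda>n. distr (measure_pmf (beta_model n (beta n))) borel
        (lrt_norm n (r n) (\<lambda>b. \<forall>i<r n. \<forall>j<r n. b i = b j))) std_normal_distribution"
    proof (intro lrt_norm_weak_conv r_le r_inf rate_from_smallo[OF small])
      fix n and b' :: "nat \<Rightarrow> real" and i j
      assume "\<forall>i<r n. \<forall>j<r n. b' i = b' j" "i < r n" "j < r n"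
      then show "b' i - beta n i = b' j - beta n j" using null by metis
    next
      fix n and y :: "nat \<Rightarrow> real"
      assume "\<And>i. i < r n \<Longrightarrow> y i = 0"
      then show "\<forall>i<r n. \<forall>j<r n. beta n i + y i = beta n j + y j" using null by metis
    qed auto
  }
qed

end
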